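(* Let $X$ be a compact Riemann surface, $\Delta\subset X\times X$ the diagonal divisor, and $\Omega^{1/2}$ a square root of the canonical bundle $\Omega_X$. There is a canonical isomorphism of sheaves over $X\times X$ $$\chi:\ \mathcal O_{X\times X}(\Delta)/\mathcal O_{X\times X}(-\Delta)\ \longrightarrow\ \mathcal D_1(\Omega^{1/2}).$$
   Context: $\mathcal O_{X\times X}(-\Delta)$ is the sheaf of functions vanishing on $\Delta$, included in the sheaf $\mathcal O_{X\times X}(\Delta)$ of functions allowed a simple pole along $\Delta$; the quotient is supported on the first infinitesimal neighbourhood of $\Delta$. For a line bundle $\mathcal L$ on $X$, $\mathcal D_1(\mathcal L)$ is the sheaf of differential operators of order $\le1$ on $\mathcal L$; it has two commuting $\mathcal O_X$-module structures (composition with functions on the left and on the right), and is thereby regarded as a sheaf of $\mathcal O_{X\times X}$-modules supported on the first infinitesimal neighbourhood of $\Delta$ (functions on the first factor act by left multiplication, functions on the second factor by right composition). "Canonical" means in particular independent of the choice of local parameters and of the isomorphism $(\Omega^{1/2})^{\otimes2}\simeq\Omega_X$. In terms of a local parameter $z$ on $X$, with induced parameters $(z_1,z_2)$ on $X\times X$ and a local section $dz^{1/2}$ of $\Omega^{1/2}$ whose square is $dz$, the paper gives the explicit form of $\chi$: a section with local representative $a(z_1)(z_2-z_1)^{-1}+b(z_1)+\cdots$ is sent to the operator $f\,dz^{1/2}\mapsto\bigl(a(z)\tfrac{df}{dz}+b(z)f\bigr)dz^{1/2}$. *)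

theory Defs
  imports "HOL-Complex_Analysis.Complex_Analysis"
begin

section \<open>Riemann surfaces\<close>

text \<open>A surface is the universe of a Hausdorff type together with a holomorphic atlas.  A chart is
  a pair of its domain and its coordinate function; \<^term>\<open>inv_into U z\<close> is the inverse
  coordinate.\<close>

type_synonym 'a chart = "'a set \<times> ('a \<Rightarrow> complex)"

definition is_chart :: "'a::topological_space chart \<Rightarrow> bool" where
  "is_chart = (\<lambda>(U, z). open U \<and> open (z ` U) \<and> homeomorphism U (z ` U) z (inv_into U z))"

definition transition_holomorphic :: "'a chart \<Rightarrow> 'a chart \<Rightarrow> bool" where
  "transition_holomorphic = (\<lambda>(U, z) (V, w). (w \<circ> inv_into U z) holomorphic_on z ` (U \<inter> V))"

definition riemann_surface :: "'a::t2_space chart set \<Rightarrow> bool" where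
  "riemann_surface A \<longleftrightarrow>
     (\<forall>c\<in>A. is_chart c) \<and>
     (\<forall>c\<in>A. \<forall>c'\<in>A. transition_holomorphic c c') \<and>
     \<Union> (fst ` A) = UNIV \<and>
     connected (UNIV :: 'a set)"

definition compact_riemann_surface :: "'a::t2_space chart set \<Rightarrow> bool" where
  "compact_riemann_surface A \<longleftrightarrow> riemann_surface A \<and> compact (UNIV :: 'a set)"

text \<open>Local parameters are the charts of the maximal atlas.\<close>

definition local_parameter :: "'a::topological_space chart set \<Rightarrow> 'a set \<Rightarrow> ('a \<Rightarrow> complex) \<Rightarrow> bool" where
  "local_parameter A U z \<longleftrightarrow> is_chart (U, z) \<and>
     (\<forall>c\<in>A. transition_holomorphic (U, z) c \<and> transition_holomorphic c (U, z))"

definition hol_on :: "'a chart set \<Rightarrow> 'a set \<Rightarrow> ('a \<Rightarrow> complex) \<Rightarrow> bool" where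
  "hol_on A W f \<longleftrightarrow> (\<forall>(U, z)\<in>A. (f \<circ> inv_into U z) holomorphic_on z ` (U \<inter> W))"

text \<open>Holomorphy in two variables is complex differentiability: the total derivative exists and is
  complex linear.\<close>

definition holomorphic2_on :: "(complex \<times> complex \<Rightarrow> complex) \<Rightarrow> (complex \<times> complex) set \<Rightarrow> bool" where
  "holomorphic2_on G S \<longleftrightarrow>
     (\<forall>p\<in>S. \<exists>c d. (G has_derivative (\<lambda>(h, k). c * h + d * k)) (at p within S))"

definition hol2_on :: "'a chart set \<Rightarrow> ('a \<times> 'a) set \<Rightarrow> ('a \<times> 'a \<Rightarrow> complex) \<Rightarrow> bool" where
  "hol2_on A W F \<longleftrightarrow> (\<forall>(U, z)\<in>A. \<forall>(V, w)\<in>A.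
     holomorphic2_on (F \<circ> map_prod (inv_into U z) (inv_into V w))
       (map_prod z w ` (W \<inter> U \<times> V)))"


section \<open>Sheaves of functions and sheaves of modules\<close>

text \<open>Sections over \<open>W\<close> are represented by total functions that vanish outside \<open>W\<close>, so that
  equality of sections is equality of functions.  All sheaves are only meaningful on open sets.\<close>

definition restr :: "'p set \<Rightarrow> ('p \<Rightarrow> complex) \<Rightarrow> 'p \<Rightarrow> complex" where
  "restr V f = (\<lambda>x. if x \<in> V then f x else 0)"

definition O_X :: "'a chart set \<Rightarrow> 'a set \<Rightarrow> ('a \<Rightarrow> complex) set" where
  "O_X A W = {f. hol_on A W f \<and> (\<forall>x. x \<notin> W \<longrightarrow> f x = 0)}"

definition O_XX :: "'a chart set \<Rightarrow> ('a \<times> 'a) set \<Rightarrow> ('a \<times> 'a \<Rightarrow> complex) set" where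
  "O_XX A W = {F. hol2_on A W F \<and> (\<forall>p. p \<notin> W \<longrightarrow> F p = 0)}"

record ('p, 's) sheaf_of_modules =
  sec :: "'p set \<Rightarrow> 's set"
  res :: "'p set \<Rightarrow> 'p set \<Rightarrow> 's \<Rightarrow> 's"
  add :: "'p set \<Rightarrow> 's \<Rightarrow> 's \<Rightarrow> 's"
  scale :: "'p set \<Rightarrow> ('p \<Rightarrow> complex) \<Rightarrow> 's \<Rightarrow> 's"

text \<open>Isomorphisms of sheaves of modules over the sheaf of rings \<open>R\<close>; \<^term>\<open>res M W V\<close> is the
  restriction from \<open>W\<close> to \<open>V\<close>.\<close>

definition sheaf_iso ::
  "('p::topological_space set \<Rightarrow> ('p \<Rightarrow> complex) set) \<Rightarrow>
   ('p, 's) sheaf_of_modules \<Rightarrow> ('p, 't) sheaf_of_modules \<Rightarrow> ('p set \<Rightarrow> 's \<Rightarrow> 't) \<Rightarrow> bool" where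
  "sheaf_iso R M N \<phi> \<longleftrightarrow> (\<forall>W. open W \<longrightarrow>
     bij_betw (\<phi> W) (sec M W) (sec N W) \<and>
     (\<forall>s\<in>sec M W. \<forall>t\<in>sec M W. \<phi> W (add M W s t) = add N W (\<phi> W s) (\<phi> W t)) \<and>
     (\<forall>f\<in>R W. \<forall>s\<in>sec M W. \<phi> W (scale M W f s) = scale N W f (\<phi> W s)) \<and>
     (\<forall>V s. open V \<and> V \<subseteq> W \<and> s \<in> sec M W \<longrightarrow> \<phi> V (res M W V s) = res N W V (\<phi> W s)))"


section \<open>The quotient sheaf\<close>

text \<open>For presheaves of functions \<open>G \<subseteq> F\<close>, the quotient sheaf is the sheafification of the presheaf
  quotient: a section assigns to each point an element of the quotient of stalks, and is locally
  induced by sections of \<open>F\<close>.\<close>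

type_synonym 'p local_function = "'p set \<times> ('p \<Rightarrow> complex)"

definition stalk_rel ::
  "('p::topological_space set \<Rightarrow> ('p \<Rightarrow> complex) set) \<Rightarrow> ('p set \<Rightarrow> ('p \<Rightarrow> complex) set) \<Rightarrow> 'p \<Rightarrow>
   ('p local_function \<times> 'p local_function) set" where
  "stalk_rel F G p = {((N, f), (N', f')).
     open N \<and> p \<in> N \<and> f \<in> F N \<and> open N' \<and> p \<in> N' \<and> f' \<in> F N' \<and>
     (\<exists>M. open M \<and> p \<in> M \<and> M \<subseteq> N \<inter> N' \<and> restr M (\<lambda>q. f q - f' q) \<in> G M)}"

definition quotient_sheaf ::
  "('p::topological_space set \<Rightarrow> ('p \<Rightarrow> complex) set) \<Rightarrow> ('p set \<Rightarrow> ('p \<Rightarrow> complex) set) \<Rightarrow>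
   ('p, 'p \<Rightarrow> 'p local_function set) sheaf_of_modules" where
  "quotient_sheaf F G =
    \<lparr> sec = (\<lambda>W. {\<sigma>. (\<forall>p. p \<notin> W \<longrightarrow> \<sigma> p = {}) \<and>
        (\<forall>p\<in>W. \<exists>N f. open N \<and> p \<in> N \<and> N \<subseteq> W \<and> f \<in> F N \<and>
           (\<forall>q\<in>N. \<sigma> q = stalk_rel F G q `` {(N, f)}))}),
      res = (\<lambda>W V \<sigma> p. if p \<in> V then \<sigma> p else {}),
      add = (\<lambda>W \<sigma> \<tau> p. \<Union>(N, f)\<in>\<sigma> p. \<Union>(N', f')\<in>\<tau> p.
        stalk_rel F G p `` {(N \<inter> N', restr (N \<inter> N') (\<lambda>q. f q + f' q))}),
      scale = (\<lambda>W h \<sigma> p. \<Union>(N, f)\<in>\<sigma> p.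
        stalk_rel F G p `` {(N \<inter> W, restr (N \<inter> W) (\<lambda>q. h q * f q))}) \<rparr>"

text \<open>The value of a section of \<open>\<O>(\<Delta>)\<close> on the diagonal is meaningless and set to 0.
  With this convention sections of \<open>\<O>(-\<Delta>)\<close> are literally sections of \<open>\<O>(\<Delta>)\<close>.\<close>

definition O_plus_Delta :: "'a chart set \<Rightarrow> ('a \<times> 'a) set \<Rightarrow> ('a \<times> 'a \<Rightarrow> complex) set" where
  "O_plus_Delta A W = {F. F \<in> O_XX A (W - Id) \<and>
     (\<forall>(U, z)\<in>A. \<exists>H. hol2_on A (W \<inter> U \<times> U) H \<and>
        (\<forall>x y. (x, y) \<in> W \<inter> U \<times> U \<and> x \<noteq> y \<longrightarrow> H (x, y) = (z y - z x) * F (x, y)))}"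

definition O_minus_Delta :: "'a chart set \<Rightarrow> ('a \<times> 'a) set \<Rightarrow> ('a \<times> 'a \<Rightarrow> complex) set" where
  "O_minus_Delta A W = {F \<in> O_XX A W. \<forall>x. F (x, x) = 0}"

definition polar_quotient ::
  "'a::topological_space chart set \<Rightarrow>
   ('a \<times> 'a, 'a \<times> 'a \<Rightarrow> ('a \<times> 'a) local_function set) sheaf_of_modules" where
  "polar_quotient A = quotient_sheaf (O_plus_Delta A) (O_minus_Delta A)"


section \<open>Line bundles\<close>

text \<open>A holomorphic line bundle is given by an open cover \<^term>\<open>triv L i\<close> (\<open>i \<in> idx L\<close>) and
  transition functions \<^term>\<open>tf L i j\<close>; the fibre coordinates of a point over
  \<open>triv L i \<inter> triv L j\<close> are related by \<open>s\<^sub>i = tf L i j x * s\<^sub>j\<close>.\<close>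

record ('a, 'i) line_bundle =
  idx :: "'i set"
  triv :: "'i \<Rightarrow> 'a set"
  tf :: "'i \<Rightarrow> 'i \<Rightarrow> 'a \<Rightarrow> complex"

definition is_line_bundle :: "'a::topological_space chart set \<Rightarrow> ('a, 'i) line_bundle \<Rightarrow> bool" where
  "is_line_bundle A L \<longleftrightarrow>
     (\<forall>i\<in>idx L. open (triv L i)) \<and>
     (\<Union>i\<in>idx L. triv L i) = UNIV \<and>
     (\<forall>i\<in>idx L. \<forall>j\<in>idx L. hol_on A (triv L i \<inter> triv L j) (tf L i j)) \<and>
     (\<forall>i\<in>idx L. \<forall>x\<in>triv L i. tf L i i x = 1) \<and>
     (\<forall>i\<in>idx L. \<forall>j\<in>idx L. \<forall>k\<in>idx L. \<forall>x\<in>triv L i \<inter> triv L j \<inter> triv L k.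
        tf L i j x * tf L j k x = tf L i k x)"

type_synonym ('a, 'i) bundle_section = "'i \<Rightarrow> 'a \<Rightarrow> complex"

definition sections ::
  "'a chart set \<Rightarrow> ('a, 'i) line_bundle \<Rightarrow> 'a set \<Rightarrow> ('a, 'i) bundle_section set" where
  "sections A L U = {s.
     (\<forall>i x. i \<notin> idx L \<or> x \<notin> U \<inter> triv L i \<longrightarrow> s i x = 0) \<and>
     (\<forall>i\<in>idx L. hol_on A (U \<inter> triv L i) (s i)) \<and>
     (\<forall>i\<in>idx L. \<forall>j\<in>idx L. \<forall>x\<in>U \<inter> triv L i \<inter> triv L j. s i x = tf L i j x * s j x)}"

definition fscale :: "('a \<Rightarrow> complex) \<Rightarrow> ('a, 'i) bundle_section \<Rightarrow> ('a, 'i) bundle_section" where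
  "fscale f s = (\<lambda>i x. f x * s i x)"

definition sadd ::
  "('a, 'i) bundle_section \<Rightarrow> ('a, 'i) bundle_section \<Rightarrow> ('a, 'i) bundle_section" where
  "sadd s t = (\<lambda>i x. s i x + t i x)"

definition srestr :: "'a set \<Rightarrow> ('a, 'i) bundle_section \<Rightarrow> ('a, 'i) bundle_section" where
  "srestr V s = (\<lambda>i. restr V (s i))"

definition sheaf_of_sections ::
  "'a chart set \<Rightarrow> ('a, 'i) line_bundle \<Rightarrow> ('a, ('a, 'i) bundle_section) sheaf_of_modules" where
  "sheaf_of_sections A L =
    \<lparr> sec = sections A L, res = (\<lambda>U. srestr), add = (\<lambda>U. sadd), scale = (\<lambda>U. fscale) \<rparr>"

definition tensor_bundle ::
  "('a, 'i) line_bundle \<Rightarrow> ('a, 'j) line_bundle \<Rightarrow> ('a, 'i \<times> 'j) line_bundle" where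
  "tensor_bundle L M =
    \<lparr> idx = idx L \<times> idx M,
      triv = (\<lambda>(i, j). triv L i \<inter> triv M j),
      tf = (\<lambda>(i, j) (i', j') x. tf L i i' x * tf M j j' x) \<rparr>"

definition tensor_section ::
  "('a, 'i) bundle_section \<Rightarrow> ('a, 'j) bundle_section \<Rightarrow> ('a, 'i \<times> 'j) bundle_section" where
  "tensor_section s t = (\<lambda>(i, j) x. s i x * t j x)"

text \<open>The canonical bundle is trivialised over a chart \<open>(U, z)\<close> by \<open>dz\<close>, so that the section
  \<open>f dz = g dw\<close> has representatives \<open>f\<close>, \<open>g\<close> with \<open>f = (dw/dz) g\<close>.\<close>

definition canonical_bundle :: "'a chart set \<Rightarrow> ('a, 'a chart) line_bundle" where
  "canonical_bundle A =
    \<lparr> idx = A, triv = fst,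
      tf = (\<lambda>(U, z) (V, w) x. deriv (w \<circ> inv_into U z) (z x)) \<rparr>"

definition differential ::
  "'a chart set \<Rightarrow> 'a set \<Rightarrow> ('a \<Rightarrow> complex) \<Rightarrow> ('a, 'a chart) bundle_section" where
  "differential A U f = (\<lambda>(V, w) x.
     if (V, w) \<in> A \<and> x \<in> U \<inter> V then deriv (f \<circ> inv_into V w) (w x) else 0)"

text \<open>\<open>square_root_iso A L \<alpha>\<close>: \<open>\<alpha>\<close> is an isomorphism \<open>L \<otimes> L \<simeq> \<Omega>\<close>.\<close>

definition square_root_iso ::
  "'a::topological_space chart set \<Rightarrow> ('a, 'i) line_bundle \<Rightarrow>
   ('a set \<Rightarrow> ('a, 'i \<times> 'i) bundle_section \<Rightarrow> ('a, 'a chart) bundle_section) \<Rightarrow> bool" where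
  "square_root_iso A L \<alpha> \<longleftrightarrow>
     sheaf_iso (O_X A) (sheaf_of_sections A (tensor_bundle L L))
       (sheaf_of_sections A (canonical_bundle A)) \<alpha>"


section \<open>Differential operators of order at most one\<close>

text \<open>An operator over \<open>U\<close> is a \<open>\<complex>\<close>-linear endomorphism \<open>D\<close> of the sheaf of sections of \<open>L\<close> over \<open>U\<close>,
  with components \<^term>\<open>D V\<close> for open \<open>V \<subseteq> U\<close> (and 0 for all other arguments).  It has order at most
  one if \<open>[[D, f], g] = 0\<close> for all local functions \<open>f\<close>, \<open>g\<close>.\<close>

type_synonym ('a, 'i) operator = "'a set \<Rightarrow> ('a, 'i) bundle_section \<Rightarrow> ('a, 'i) bundle_section"

definition diffops1 ::
  "'a::topological_space chart set \<Rightarrow> ('a, 'i) line_bundle \<Rightarrow> 'a set \<Rightarrow> ('a, 'i) operator set" where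
  "diffops1 A L U = {D.
     (\<forall>V s. \<not> (open V \<and> V \<subseteq> U \<and> s \<in> sections A L V) \<longrightarrow> D V s = (\<lambda>i x. 0)) \<and>
     (\<forall>V. open V \<and> V \<subseteq> U \<longrightarrow>
        (\<forall>s\<in>sections A L V. D V s \<in> sections A L V) \<and>
        (\<forall>s\<in>sections A L V. \<forall>t\<in>sections A L V. D V (sadd s t) = sadd (D V s) (D V t)) \<and>
        (\<forall>c. \<forall>s\<in>sections A L V. D V (fscale (\<lambda>_. c) s) = fscale (\<lambda>_. c) (D V s)) \<and>
        (\<forall>V' s. open V' \<and> V' \<subseteq> V \<and> s \<in> sections A L V \<longrightarrow>
           D V' (srestr V' s) = srestr V' (D V s)) \<and>
        (\<forall>f\<in>O_X A V. \<forall>g\<in>O_X A V. \<forall>s\<in>sections A L V. \<forall>i x.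
           D V (fscale f (fscale g s)) i x - f x * D V (fscale g s) i x
             - g x * D V (fscale f s) i x + g x * f x * D V s i x = 0))}"

text \<open>As a sheaf on the product, \<open>D\<^sub>1(L)\<close> is pushed forward along the diagonal embedding.
  Since functions on the first factor act by left multiplication and functions on the second factor
  by right composition, \<open>F = \<Sum>k. f\<^sub>k \<boxtimes> g\<^sub>k\<close> sends \<open>D\<close> to
  \<open>s \<mapsto> (x \<mapsto> \<Sum>k. f\<^sub>k(x) D(g\<^sub>k s)(x)) = (x \<mapsto> D(F(x, -) s)(x))\<close>.  The last expression makes sense for
  every \<open>F\<close> on \<open>W\<close>: the section \<open>F(x, -) s\<close> lives on the neighbourhood
  \<open>V \<inter> {y. (x, y) \<in> W}\<close> of \<open>x\<close>.\<close>

definition diag_vimage :: "('a \<times> 'a) set \<Rightarrow> 'a set" where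
  "diag_vimage W = {x. (x, x) \<in> W}"

definition bimodule_action ::
  "'a::topological_space chart set \<Rightarrow> ('a, 'i) line_bundle \<Rightarrow> ('a \<times> 'a) set \<Rightarrow>
   ('a \<times> 'a \<Rightarrow> complex) \<Rightarrow> ('a, 'i) operator \<Rightarrow> ('a, 'i) operator" where
  "bimodule_action A L W F D = (\<lambda>V s i x.
     if open V \<and> V \<subseteq> diag_vimage W \<and> s \<in> sections A L V
     then let V' = {y \<in> V. (x, y) \<in> W} in D V' (fscale (\<lambda>y. F (x, y)) (srestr V' s)) i x
     else 0)"

lemma fscale_section:
  assumes "s \<in> sections A L V" "hol_on A V g"
  shows "fscale g s \<in> sections A L V"
proof -
  have "hol_on A (V \<inter> triv L i) (\<lambda>x. g x * s i x)" if "i \<in> idx L" for i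
  proof -
    have "(g \<circ> inv_into U z) holomorphic_on z ` (U \<inter> (V \<inter> triv L i))"
      if "(U, z) \<in> A" for U z
      using assms(2) that unfolding hol_on_def
      by (auto intro: holomorphic_on_subset)
    moreover have "(s i \<circ> inv_into U z) holomorphic_on z ` (U \<inter> (V \<inter> triv L i))"
      if "(U, z) \<in> A" for U z
      using assms(1) that \<open>i \<in> idx L\<close> unfolding sections_def hol_on_def by auto
    ultimately show ?thesis
      unfolding hol_on_def by (auto simp: o_def intro!: holomorphic_on_mult)
  qed
  moreover have "g x * s i x = tf L i j x * (g x * s j x)"
    if "i \<in> idx L" "j \<in> idx L" "x \<in> V \<inter> triv L i \<inter> triv L j" for i j x
  proof -
    have "s i x = tf L i j x * s j x"
      using assms(1) that unfolding sections_def by blast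
    then show ?thesis by simp
  qed
  moreover have "s i x = 0" if "i \<notin> idx L \<or> x \<notin> V \<inter> triv L i" for i x
    using assms(1) that unfolding sections_def by blast
  ultimately show ?thesis
    unfolding sections_def fscale_def by simp
qed

lemma hol_on_subset:
  assumes "hol_on A W f" "V \<subseteq> W"
  shows "hol_on A V f"
  unfolding hol_on_def
proof safe
  fix U z assume "(U, z) \<in> A"
  then have "(f \<circ> inv_into U z) holomorphic_on z ` (U \<inter> W)"
    using assms(1) by (auto simp: hol_on_def)
  moreover have "z ` (U \<inter> V) \<subseteq> z ` (U \<inter> W)"
    using assms(2) by blast
  ultimately show "(f \<circ> inv_into U z) holomorphic_on z ` (U \<inter> V)"
    by (rule holomorphic_on_subset)
qed

lemma srestr_section:
  assumes A: "riemann_surface A" and s: "s \<in> sections A L V" and V': "V' \<subseteq> V"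
  shows "srestr V' s \<in> sections A L V'"
proof -
  have "hol_on A (V' \<inter> triv L i) (restr V' (s i))" if "i \<in> idx L" for i
  proof -
    have si: "hol_on A (V' \<inter> triv L i) (s i)"
      using s that V' by (auto simp: sections_def intro: hol_on_subset[of _ "V \<inter> triv L i"])
    have inv: "inv_into U z (z x) = x" if "(U, z) \<in> A" "x \<in> U" for U z x
      using A that by (auto simp: riemann_surface_def is_chart_def homeomorphism_def)
    have "(restr V' (s i) \<circ> inv_into U z) holomorphic_on z ` (U \<inter> (V' \<inter> triv L i))"
      if c: "(U, z) \<in> A" for U z
    proof -
      have "(s i \<circ> inv_into U z) holomorphic_on z ` (U \<inter> (V' \<inter> triv L i))"
        using si c unfolding hol_on_def by blast
      moreover have "(s i \<circ> inv_into U z) p = (restr V' (s i) \<circ> inv_into U z) p"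
        if "p \<in> z ` (U \<inter> (V' \<inter> triv L i))" for p
        using that inv[OF c] by (auto simp: restr_def)
      ultimately show ?thesis
        by (rule holomorphic_transform)
    qed
    then show ?thesis
      by (auto simp: hol_on_def)
  qed
  moreover have zero: "s i x = 0" if "i \<notin> idx L \<or> x \<notin> V \<inter> triv L i" for i x
    using s that unfolding sections_def by blast
  ultimately show ?thesis
    unfolding sections_def srestr_def mem_Collect_eq
  proof (intro conjI allI ballI impI, goal_cases)
    case (1 i x)
    then show ?case
      using V' zero[of i x]
      by (auto simp: restr_def)
  next
    case (3 i j x)
    then have "x \<in> V'" "s i x = tf L i j x * s j x"
      using s V' unfolding sections_def by blast+
    then show ?case
      by (simp add: restr_def)
  qed
qed

text \<open>The action is indeed the one determined by the two \<open>\<O>\<^sub>X\<close>-module structures.\<close>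

lemma bimodule_action_outer_product:
  assumes A: "riemann_surface A" and W: "open W" and D: "D \<in> diffops1 A L (diag_vimage W)"
    and g: "g \<in> O_X A (diag_vimage W)"
    and F: "\<And>x y. (x, y) \<in> W \<Longrightarrow> F (x, y) = f x * g y"
    and V: "open V" "V \<subseteq> diag_vimage W" and s: "s \<in> sections A L V"
  shows "bimodule_action A L W F D V s = fscale f (D V (fscale g s))"
proof (intro ext)
  fix i x
  define V' where "V' = {y \<in> V. (x, y) \<in> W}"
  have gs: "fscale g s \<in> sections A L V"
    using g V(2) s by (auto intro!: fscale_section intro: hol_on_subset simp: O_X_def)
  have "open (Pair x -` W)"
    using W by (intro open_vimage continuous_intros)
  then have V': "open V'" "V' \<subseteq> V"
    using V(1) by (auto simp: V'_def vimage_def Collect_conj_eq)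
  note D_props =
    D[unfolded diffops1_def mem_Collect_eq, THEN conjunct2, THEN spec, THEN mp, OF conjI]
  have DV: "D V (fscale g s) \<in> sections A L V"
    using D_props[OF V, THEN conjunct1] gs by blast
  have DV': "D V' (srestr V' (fscale g s)) = srestr V' (D V (fscale g s))"
    using D_props[OF V, THEN conjunct2, THEN conjunct2, THEN conjunct2, THEN conjunct1] V' gs
    by blast
  have sV': "srestr V' (fscale g s) \<in> sections A L V'"
    using A gs V'(2) by (rule srestr_section)
  have "fscale (\<lambda>y. F (x, y)) (srestr V' s) = fscale (\<lambda>_. f x) (srestr V' (fscale g s))"
    using F by (auto simp: fscale_def srestr_def restr_def V'_def fun_eq_iff)
  moreover have "D V' (fscale (\<lambda>_. f x) (srestr V' (fscale g s)))
      = fscale (\<lambda>_. f x) (D V' (srestr V' (fscale g s)))"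
    using D_props[of V', THEN conjunct2, THEN conjunct2, THEN conjunct1] V' V(2) sV' by blast
  moreover have "x \<in> V' \<longleftrightarrow> x \<in> V"
    using V(2) by (auto simp: V'_def diag_vimage_def)
  moreover have "D V (fscale g s) i x = 0" if "x \<notin> V"
    using DV that unfolding sections_def by blast
  ultimately have "D V' (fscale (\<lambda>y. F (x, y)) (srestr V' s)) i x = f x * D V (fscale g s) i x"
    using DV' by (simp add: fscale_def srestr_def restr_def)
  then show "bimodule_action A L W F D V s i x = fscale f (D V (fscale g s)) i x"
    using V s unfolding bimodule_action_def Let_def V'_def[symmetric] by (simp add: fscale_def)
qed

definition D1_sheaf ::
  "'a::topological_space chart set \<Rightarrow> ('a, 'i) line_bundle \<Rightarrow>
   ('a \<times> 'a, ('a, 'i) operator) sheaf_of_modules" where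
  "D1_sheaf A L =
    \<lparr> sec = (\<lambda>W. diffops1 A L (diag_vimage W)),
      res = (\<lambda>W W' D V s. if V \<subseteq> diag_vimage W' then D V s else (\<lambda>i x. 0)),
      add = (\<lambda>W D E V s. sadd (D V s) (E V s)),
      scale = (\<lambda>W. bimodule_action A L W) \<rparr>"


section \<open>The local description of the isomorphism\<close>

text \<open>\<open>local_representative A \<sigma> U z a b\<close>: near each diagonal point of \<open>U \<times> U\<close> the section \<open>\<sigma>\<close> of the
  quotient is represented by \<open>a(z\<^sub>1)(z\<^sub>2 - z\<^sub>1)\<^sup>-\<^sup>1 + b(z\<^sub>1) + \<dots>\<close>, the omitted terms \<open>R\<close> being
  holomorphic and vanishing on the diagonal.\<close>

definition local_representative ::
  "'a::topological_space chart set \<Rightarrow> ('a \<times> 'a \<Rightarrow> ('a \<times> 'a) local_function set) \<Rightarrow>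
   'a set \<Rightarrow> ('a \<Rightarrow> complex) \<Rightarrow> ('a \<Rightarrow> complex) \<Rightarrow> ('a \<Rightarrow> complex) \<Rightarrow> bool" where
  "local_representative A \<sigma> U z a b \<longleftrightarrow>
     (\<forall>x\<in>U. \<exists>(N, F)\<in>\<sigma> (x, x). N \<subseteq> U \<times> U \<and>
        (\<exists>R\<in>O_minus_Delta A N. \<forall>p q. (p, q) \<in> N \<and> p \<noteq> q \<longrightarrow>
           F (p, q) = a p / (z q - z p) + b p + R (p, q)))"

definition param_deriv ::
  "'a set \<Rightarrow> ('a \<Rightarrow> complex) \<Rightarrow> ('a \<Rightarrow> complex) \<Rightarrow> 'a \<Rightarrow> complex" where
  "param_deriv U z f = (\<lambda>x. deriv (f \<circ> inv_into U z) (z x))"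

text \<open>\<open>e\<close> plays the role of \<open>dz\<^sup>1\<^sup>/\<^sup>2\<close>.\<close>

definition has_explicit_form ::
  "'a::topological_space chart set \<Rightarrow> ('a, 'i) line_bundle \<Rightarrow>
   ('a set \<Rightarrow> ('a, 'i \<times> 'i) bundle_section \<Rightarrow> ('a, 'a chart) bundle_section) \<Rightarrow>
   (('a \<times> 'a) set \<Rightarrow> ('a \<times> 'a \<Rightarrow> ('a \<times> 'a) local_function set) \<Rightarrow> ('a, 'i) operator) \<Rightarrow> bool" where
  "has_explicit_form A L \<alpha> \<Phi> \<longleftrightarrow>
     (\<forall>W \<sigma> U z e a b.
        open W \<and> \<sigma> \<in> sec (polar_quotient A) W \<and> U \<subseteq> diag_vimage W \<and>
        local_parameter A U z \<and>
        e \<in> sections A L U \<and> \<alpha> U (tensor_section e e) = differential A U z \<and>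
        a \<in> O_X A U \<and> b \<in> O_X A U \<and> local_representative A \<sigma> U z a b \<longrightarrow>
        (\<forall>V f. open V \<and> V \<subseteq> U \<and> f \<in> O_X A V \<longrightarrow>
           \<Phi> W \<sigma> V (fscale f e) =
             srestr V (fscale (\<lambda>x. a x * param_deriv U z f x + b x * f x) e)))"

end

theory Submission
  imports Defs
begin

text \<open>
  Let \<open>dz\<^sup>1\<^sup>/\<^sup>2\<close> be a local square root of \<open>dz\<close>.  The isomorphism sends a kernel \<open>F\<close> with a simple pole on the
  diagonal to the operator
  \<open>s \<mapsto> (x \<mapsto> Res\<^sub>y\<^sub>=\<^sub>x F(x, y) s(y) dz(x)\<^sup>1\<^sup>/\<^sup>2 dz(y)\<^sup>1\<^sup>/\<^sup>2 / (z(y) - z(x)))\<close>.  The kernel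
  \<open>dz(x)\<^sup>1\<^sup>/\<^sup>2 dz(y)\<^sup>1\<^sup>/\<^sup>2 / (z(y) - z(x))\<close> is independent of \<open>z\<close> up to terms vanishing on the diagonal, and for
  \<open>F = a(z\<^sub>1)(z\<^sub>2 - z\<^sub>1)\<^sup>-\<^sup>1 + b(z\<^sub>1) + \<dots>\<close> the residue is \<open>(a f' + b f) dz\<^sup>1\<^sup>/\<^sup>2\<close> if \<open>s = f dz\<^sup>1\<^sup>/\<^sup>2\<close>.  The proof works with
  the pair \<open>(a, b)\<close>, the polar jet of \<open>F\<close>, instead of residues.

  In a frame \<open>e\<close> of the bundle with \<open>e \<otimes> e = c dz\<close> the operator reads \<open>s \<mapsto> a s' + (a c'/(2c) + b) s\<close>, without
  square roots (\<open>twisted_derivative\<close>).  A change of parameter alters \<open>b\<close> by \<open>a z''/(2z')\<close>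
  (\<open>polar_jet_change\<close>), and the logarithmic derivative \<open>c'/c\<close> changes by the opposite amount
  (\<open>twisted_derivative_change\<close>), so the value at a point depends on the kernel alone.  Two identifications
  of the square of the bundle with the canonical bundle differ by a holomorphic function without
  zeros, which is constant on a compact connected surface (\<open>spin_form_unique\<close>) and leaves \<open>c'/c\<close>
  unchanged.  Linearity over functions on the product is the Leibniz rule, in the guise of
  \<open>polar_jet_mult\<close>.

  Bijectivity rests on division by the equation of the diagonal.  A holomorphic function of two
  variables has a holomorphic divided difference (\<open>cdiff2_divided_difference\<close>), hence a kernel is of
  the form \<open>a(z\<^sub>1)(z\<^sub>2 - z\<^sub>1)\<^sup>-\<^sup>1 + Q\<close> near the diagonal, and its class is determined by the jets
  \<open>(a(x), Q(x, x))\<close> (\<open>stalk_of_polar_jet\<close>); off the diagonal the quotient is zero.  The jets in turn are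
  determined by the operator (\<open>op_value_determines_jet\<close>).  Conversely the condition
  \<open>[[D, f], g] = 0\<close> forces \<open>D(f e) = f D e + f' (D(z e) - z D e)\<close> (\<open>diffop_fscale\<close>), so every operator of order at
  most one comes from a pair \<open>(a, b)\<close> of holomorphic functions, and the corresponding germs glue
  (\<open>inverse_section_section\<close>).
\<close>

section \<open>Holomorphic functions of two variables\<close>

text \<open>The pointwise form of \<open>holomorphic2_on\<close>, which on open sets is easier to combine and to transport
  along changes of coordinates.\<close>

definition cdiff2 :: "(complex \<times> complex \<Rightarrow> complex) \<Rightarrow> complex \<times> complex \<Rightarrow> bool" where
  "cdiff2 G p \<longleftrightarrow> (\<exists>c d. (G has_derivative (\<lambda>(h, k). c * h + d * k)) (at p))"

lemma cdiff2I: "(G has_derivative (\<lambda>(h, k). c * h + d * k)) (at p) \<Longrightarrow> cdiff2 G p"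
  unfolding cdiff2_def by blast

lemma holomorphic2_on_open:
  assumes "open S"
  shows "holomorphic2_on G S \<longleftrightarrow> (\<forall>p\<in>S. cdiff2 G p)"
  unfolding holomorphic2_on_def
proof (rule ball_cong[OF refl])
  fix p assume "p \<in> S"
  show "(\<exists>c d. (G has_derivative (\<lambda>(h, k). c * h + d * k)) (at p within S)) \<longleftrightarrow> cdiff2 G p"
    unfolding cdiff2_def at_within_open[OF \<open>p \<in> S\<close> assms] ..
qed

lemma cdiff2_transform:
  assumes "cdiff2 G p" "\<forall>\<^sub>F q in nhds p. G q = H q"
  shows "cdiff2 H p"
proof -
  obtain c d where "(G has_derivative (\<lambda>(h, k). c * h + d * k)) (at p)"
    using assms(1) unfolding cdiff2_def by blast
  moreover have "\<forall>\<^sub>F q in at p. G q = H q" "G p = H p"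
    using assms(2) eventually_nhds_x_imp_x[OF assms(2)] by (auto simp: eventually_at_filter elim: eventually_mono)
  ultimately show ?thesis
    by (intro cdiff2I[of H c d] has_derivative_transform_eventually[of G _ p UNIV H]) auto
qed

lemma cdiff2_isCont: "cdiff2 G p \<Longrightarrow> isCont G p"
  unfolding cdiff2_def by (blast intro: has_derivative_continuous)

lemma cdiff2_const: "cdiff2 (\<lambda>_. c) p"
  by (rule cdiff2I[of _ 0 0]) (simp add: case_prod_unfold)

lemma cdiff2_add:
  assumes "cdiff2 F p" "cdiff2 G p"
  shows "cdiff2 (\<lambda>q. F q + G q) p"
proof -
  obtain c d c' d' where
    "(F has_derivative (\<lambda>(h, k). c * h + d * k)) (at p)"
    "(G has_derivative (\<lambda>(h, k). c' * h + d' * k)) (at p)"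
    using assms unfolding cdiff2_def by blast
  from has_derivative_add[OF this] show ?thesis
    by (intro cdiff2I[of _ "c + c'" "d + d'"]) (simp add: case_prod_unfold algebra_simps)
qed

lemma cdiff2_mult:
  assumes "cdiff2 F p" "cdiff2 G p"
  shows "cdiff2 (\<lambda>q. F q * G q) p"
proof -
  obtain c d c' d' where
    "(F has_derivative (\<lambda>(h, k). c * h + d * k)) (at p)"
    "(G has_derivative (\<lambda>(h, k). c' * h + d' * k)) (at p)"
    using assms unfolding cdiff2_def by blast
  from has_derivative_mult[OF this] show ?thesis
    by (intro cdiff2I[of _ "F p * c' + c * G p" "F p * d' + d * G p"])
      (simp add: case_prod_unfold algebra_simps)
qed

lemma cdiff2_compose_prod:
  assumes "cdiff2 G (\<phi> x, \<psi> y)" "\<phi> field_differentiable at x" "\<psi> field_differentiable at y"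
  shows "cdiff2 (\<lambda>(s, t). G (\<phi> s, \<psi> t)) (x, y)"
proof -
  obtain c d where G: "(G has_derivative (\<lambda>(h, k). c * h + d * k)) (at (\<phi> x, \<psi> y))"
    using assms unfolding cdiff2_def by blast
  obtain u v where uv: "(\<phi> has_field_derivative u) (at x)" "(\<psi> has_field_derivative v) (at y)"
    using assms by (auto simp: field_differentiable_def)
  have "((\<lambda>q. \<phi> (fst q)) has_derivative (\<lambda>q. u * fst q)) (at (x, y))"
    by (rule has_derivative_compose[OF has_derivative_fst[OF has_derivative_ident],
          of "\<phi>" "(*) u", simplified]) (use uv in \<open>simp add: has_field_derivative_def\<close>)
  moreover have "((\<lambda>q. \<psi> (snd q)) has_derivative (\<lambda>q. v * snd q)) (at (x, y))"
    by (rule has_derivative_compose[OF has_derivative_snd[OF has_derivative_ident],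
          of "\<psi>" "(*) v", simplified]) (use uv in \<open>simp add: has_field_derivative_def\<close>)
  ultimately have "((\<lambda>q. (\<phi> (fst q), \<psi> (snd q))) has_derivative (\<lambda>q. (u * fst q, v * snd q))) (at (x, y))"
    by (rule has_derivative_Pair)
  from has_derivative_compose[OF this, of G "\<lambda>(h, k). c * h + d * k"] G
  have "((\<lambda>q. G (\<phi> (fst q), \<psi> (snd q))) has_derivative
      (\<lambda>q. c * (u * fst q) + d * (v * snd q))) (at (x, y))"
    by simp
  then show ?thesis
    by (intro cdiff2I[of _ "c * u" "d * v"]) (simp add: case_prod_unfold algebra_simps)
qed

lemma cdiff2_fst: "cdiff2 fst p" 
  by (rule cdiff2I[of _ 1 0]) (use has_derivative_fst[OF has_derivative_ident] in \<open>simp add: case_prod_unfold\<close>)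

lemma cdiff2_snd: "cdiff2 snd p" 
  by (rule cdiff2I[of _ 0 1]) (use has_derivative_snd[OF has_derivative_ident] in \<open>simp add: case_prod_unfold\<close>)

lemma cdiff2_on_fst:
  assumes "f field_differentiable at (fst p)"
  shows "cdiff2 (\<lambda>q. f (fst q)) p"
  using cdiff2_compose_prod[of fst f "fst p" "\<lambda>t. t" "snd p"] assms cdiff2_fst
  by (simp add: case_prod_unfold field_differentiable_ident)

lemma cdiff2_on_snd:
  assumes "f field_differentiable at (snd p)"
  shows "cdiff2 (\<lambda>q. f (snd q)) p"
  using cdiff2_compose_prod[of snd "\<lambda>t. t" "fst p" f "snd p"] assms cdiff2_snd
  by (simp add: case_prod_unfold field_differentiable_ident)

lemma field_differentiable_cdiff2:
  assumes "cdiff2 G (f x, g x)" "f field_differentiable at x" "g field_differentiable at x"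
  shows "(\<lambda>t. G (f t, g t)) field_differentiable at x"
proof -
  obtain c d where G: "(G has_derivative (\<lambda>(h, k). c * h + d * k)) (at (f x, g x))"
    using assms unfolding cdiff2_def by blast
  obtain u v where uv: "(f has_derivative (*) u) (at x)" "(g has_derivative (*) v) (at x)"
    using assms by (auto simp: field_differentiable_def has_field_derivative_def)
  from has_derivative_compose[OF has_derivative_Pair[OF uv] G]
  have "((\<lambda>t. G (f t, g t)) has_derivative (\<lambda>h. c * (u * h) + d * (v * h))) (at x)"
    by simp
  moreover have "(\<lambda>h. c * (u * h) + d * (v * h)) = (*) (c * u + d * v)"
    by (simp add: fun_eq_iff algebra_simps)
  ultimately have "((\<lambda>t. G (f t, g t)) has_derivative (*) (c * u + d * v)) (at x)"
    by (simp only:)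
  then show ?thesis
    unfolding field_differentiable_def has_field_derivative_def by blast
qed

lemma cdiff2_slice1: "cdiff2 G (x, y) \<Longrightarrow> (\<lambda>t. G (t, y)) field_differentiable at x"
  using field_differentiable_cdiff2[of G "\<lambda>t. t" x "\<lambda>_. y"] by simp

lemma cdiff2_slice2: "cdiff2 G (x, y) \<Longrightarrow> (\<lambda>t. G (x, t)) field_differentiable at y"
  using field_differentiable_cdiff2[of G "\<lambda>_. x" y "\<lambda>t. t"] by simp

lemma cdiff2_diagonal: "cdiff2 G (x, x) \<Longrightarrow> (\<lambda>t. G (t, t)) field_differentiable at x"
  using field_differentiable_cdiff2[of G "\<lambda>t. t" x "\<lambda>t. t"] by simp

lemma cdiff2_inverse:
  assumes "cdiff2 G p" "G p \<noteq> 0"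
  shows "cdiff2 (\<lambda>q. inverse (G q)) p"
proof -
  obtain c d where G: "(G has_derivative (\<lambda>(h, k). c * h + d * k)) (at p)"
    using assms unfolding cdiff2_def by blast
  from Deriv.has_derivative_inverse[of G p, OF assms(2) this] show ?thesis
    by (intro cdiff2I[of _ "- (inverse (G p) * c * inverse (G p))" "- (inverse (G p) * d * inverse (G p))"])
      (simp add: case_prod_unfold algebra_simps)
qed

lemma cdiff2_divide:
  assumes "cdiff2 F p" "cdiff2 G p" "G p \<noteq> 0"
  shows "cdiff2 (\<lambda>q. F q / G q) p"
  using cdiff2_mult[OF assms(1) cdiff2_inverse[OF assms(2,3)]] by (simp add: divide_inverse)

lemma cdiff2_diff:
  assumes "cdiff2 F p" "cdiff2 G p"
  shows "cdiff2 (\<lambda>q. F q - G q) p"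
  using cdiff2_add[OF assms(1) cdiff2_mult[OF cdiff2_const[of "-1"] assms(2)]] by simp

text \<open>By the maximum principle the difference of two slices on the disc is bounded by its values on the
  circle, so joint continuity only has to be known on the circle.  This is what controls difference
  quotients at the points where the denominator vanishes.\<close>

lemma continuous_on_holomorphic_slices:
  fixes Q :: "'a::metric_space \<Rightarrow> complex \<Rightarrow> complex"
  assumes r: "0 < r"
    and cont: "\<And>x. x \<in> X \<Longrightarrow> continuous_on (cball q r) (Q x)"
    and hol: "\<And>x. x \<in> X \<Longrightarrow> Q x holomorphic_on ball q r"
    and bd: "continuous_on (X \<times> sphere q r) (\<lambda>(x, y). Q x y)"
  shows "continuous_on (X \<times> ball q r) (\<lambda>(x, y). Q x y)"
proof -
  have *: "\<exists>d>0. \<forall>x\<in>X. dist x x0 < d \<longrightarrow> (\<forall>y\<in>sphere q r. norm (Q x y - Q x0 y) < e)"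
    if x0: "x0 \<in> X" and e: "0 < e" for x0 e
  proof (rule ccontr)
    assume "\<not> ?thesis"
    then have neg: "\<not> (\<forall>x\<in>X. dist x x0 < d \<longrightarrow> (\<forall>y\<in>sphere q r. norm (Q x y - Q x0 y) < e))" if "d > 0" for d
      using that by blast
    have "\<forall>n. \<exists>x y. x \<in> X \<and> dist x x0 < inverse (real (Suc n)) \<and> y \<in> sphere q r \<and>
        norm (Q x y - Q x0 y) \<ge> e"
    proof
      fix n
      have "0 < inverse (real (Suc n))" by simp
      from neg[OF this] show "\<exists>x y. x \<in> X \<and> dist x x0 < inverse (real (Suc n)) \<and> y \<in> sphere q r \<and>
          norm (Q x y - Q x0 y) \<ge> e"
        unfolding not_less[symmetric] by blast
    qed
    then have "\<exists>f g. \<forall>n. f n \<in> X \<and> dist (f n) x0 < inverse (real (Suc n)) \<and> g n \<in> sphere q r \<and>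
        norm (Q (f n) (g n) - Q x0 (g n)) \<ge> e"
      unfolding choice_iff by blast
    then obtain f g where fg: "\<And>n. f n \<in> X" "\<And>n. dist (f n) x0 < inverse (real (Suc n))"
      "\<And>n. g n \<in> sphere q r" "\<And>n. norm (Q (f n) (g n) - Q x0 (g n)) \<ge> e"
      by blast
    obtain l \<kappa> where l: "l \<in> sphere q r" "strict_mono (\<kappa> :: nat \<Rightarrow> nat)" "(g \<circ> \<kappa>) \<longlonglongrightarrow> l"
      using compact_sphere[of q r] fg(3) unfolding compact_eq_seq_compact_metric seq_compact_def by blast
    have "(\<lambda>n. dist (f n) x0) \<longlonglongrightarrow> 0"
      using fg(2) by (intro tendsto_sandwich[OF _ _ tendsto_const LIMSEQ_inverse_real_of_nat])
        (auto intro!: always_eventually less_imp_le)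
    then have "f \<longlonglongrightarrow> x0"
      by (subst tendsto_dist_iff)
    then have f: "(f \<circ> \<kappa>) \<longlonglongrightarrow> x0"
      using l(2) by (rule LIMSEQ_subseq_LIMSEQ)
    have in_K: "\<And>n. ((f \<circ> \<kappa>) n, (g \<circ> \<kappa>) n) \<in> X \<times> sphere q r" "\<And>n. (x0, (g \<circ> \<kappa>) n) \<in> X \<times> sphere q r"
      "(x0, l) \<in> X \<times> sphere q r"
      using fg x0 l(1) by auto
    have "(\<lambda>n. (case ((f \<circ> \<kappa>) n, (g \<circ> \<kappa>) n) of (x, y) \<Rightarrow> Q x y)) \<longlonglongrightarrow> (case (x0, l) of (x, y) \<Rightarrow> Q x y)"
      by (rule continuous_on_tendsto_compose[OF bd tendsto_Pair[OF f l(3)]])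
        (use in_K in \<open>simp_all del: o_apply\<close>)
    moreover have "(\<lambda>n. (case (x0, (g \<circ> \<kappa>) n) of (x, y) \<Rightarrow> Q x y)) \<longlonglongrightarrow> (case (x0, l) of (x, y) \<Rightarrow> Q x y)"
      by (rule continuous_on_tendsto_compose[OF bd tendsto_Pair[OF tendsto_const l(3)]])
        (use in_K in \<open>simp_all del: o_apply\<close>)
    ultimately have "(\<lambda>n. Q ((f \<circ> \<kappa>) n) ((g \<circ> \<kappa>) n) - Q x0 ((g \<circ> \<kappa>) n)) \<longlonglongrightarrow> Q x0 l - Q x0 l"
      by (simp only: prod.case tendsto_diff)
    then have "(\<lambda>n. norm (Q ((f \<circ> \<kappa>) n) ((g \<circ> \<kappa>) n) - Q x0 ((g \<circ> \<kappa>) n))) \<longlonglongrightarrow> 0"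
      using tendsto_norm by fastforce
    then have "e \<le> 0"
      using fg(4) by (intro tendsto_lowerbound[of _ 0 sequentially e]) auto
    then show False using e by simp
  qed
  show ?thesis
    unfolding continuous_on_iff
  proof (intro ballI allI impI)
    fix p and e :: real
    assume "p \<in> X \<times> ball q r" and e: "0 < e"
    then obtain x0 y0 where p: "p = (x0, y0)" and x0: "x0 \<in> X" and y0: "y0 \<in> ball q r"
      by blast
    obtain d1 where d1: "d1 > 0" "\<And>x y. x \<in> X \<Longrightarrow> dist x x0 < d1 \<Longrightarrow> y \<in> sphere q r \<Longrightarrow>
        norm (Q x y - Q x0 y) < e / 2"
      using *[OF x0, of "e / 2"] e by auto
    have near: "norm (Q x y - Q x0 y) \<le> e / 2" if "x \<in> X" "dist x x0 < d1" "y \<in> ball q r" for x y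
    proof (rule maximum_modulus_frontier[where S = "cball q r" and f = "\<lambda>y. Q x y - Q x0 y"])
      show "(\<lambda>y. Q x y - Q x0 y) holomorphic_on interior (cball q r)"
        using hol that x0 by (auto intro!: holomorphic_on_diff)
      show "continuous_on (closure (cball q r)) (\<lambda>y. Q x y - Q x0 y)"
        using cont that x0 by (auto intro!: continuous_on_diff)
      show "norm (Q x w - Q x0 w) \<le> e / 2" if "w \<in> frontier (cball q r)" for w
        using d1(2)[of x w] \<open>x \<in> X\<close> \<open>dist x x0 < d1\<close> that r by (auto simp: less_imp_le)
    qed (use that in auto)
    have "continuous_on (ball q r) (Q x0)"
      using cont[OF x0] ball_subset_cball by (rule continuous_on_subset)
    then obtain d2 where d2: "d2 > 0" "\<And>y. y \<in> ball q r \<Longrightarrow> dist y y0 < d2 \<Longrightarrow> dist (Q x0 y) (Q x0 y0) < e / 2"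
      unfolding continuous_on_iff using y0 e by (meson half_gt_zero)
    have "dist (Q x y) (Q x0 y0) < e"
      if "x \<in> X" "y \<in> ball q r" "dist (x, y) (x0, y0) < min d1 d2" for x y
    proof -
      have "dist x x0 < d1" "dist y y0 < d2"
        using that(3) dist_fst_le[of "(x, y)" "(x0, y0)"] dist_snd_le[of "(x, y)" "(x0, y0)"] by auto
      then show ?thesis
        using near[of x y] d2(2)[of y] that dist_triangle[of "Q x y" "Q x0 y0" "Q x0 y"]
        by (simp add: dist_norm)
    qed
    then show "\<exists>d>0. \<forall>u\<in>X \<times> ball q r. dist u p < d \<longrightarrow>
        dist (case u of (x, y) \<Rightarrow> Q x y) (case p of (x, y) \<Rightarrow> Q x y) < e"
      using d1(1) d2(1) unfolding p by (intro exI[of _ "min d1 d2"]) auto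
  qed
qed

lemma ball_Times_ball:
  fixes x :: "'a::metric_space" and y :: "'b::metric_space"
  assumes "open S" "(x, y) \<in> S"
  obtains R where "0 < R" "ball x R \<times> ball y R \<subseteq> S"
proof -
  obtain U V where UV: "open U" "open V" "x \<in> U" "y \<in> V" "U \<times> V \<subseteq> S"
    using open_prod_elim[OF assms] by (metis mem_Sigma_iff)
  obtain r1 r2 where "r1 > 0" "ball x r1 \<subseteq> U" "r2 > 0" "ball y r2 \<subseteq> V"
    using UV by (meson open_contains_ball)
  then show ?thesis
    using UV(5) by (intro that[of "min r1 r2"]) (auto simp: subset_iff)
qed

text \<open>A product is differentiable at a zero of a linear factor as soon as the other factor is
  continuous there.\<close>

lemma has_derivative_mult_vanishing:
  fixes f g :: "'a::real_normed_vector \<Rightarrow> 'b::real_normed_algebra"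
  assumes f: "bounded_linear f" and g: "isCont g p"
  shows "((\<lambda>q. f (q - p) * g q) has_derivative (\<lambda>h. f h * g p)) (at p)"
proof -
  obtain K where K: "\<And>x. norm (f x) \<le> norm x * K"
    using bounded_linear.bounded[OF f] by blast
  show ?thesis
  proof (rule has_derivativeI_sandwich[of 1])
    show "bounded_linear (\<lambda>h. f h * g p)"
      using f by (rule bounded_linear_mult_const)
    show "norm (f (q - p) * g q - f (p - p) * g p - f (q - p) * g p) / norm (q - p)
        \<le> K * norm (g q - g p)" if "q \<noteq> p" for q
    proof -
      have "f (p - p) = 0" using linear_0[OF bounded_linear.linear[OF f]] by simp
      then have "norm (f (q - p) * g q - f (p - p) * g p - f (q - p) * g p)
          = norm (f (q - p) * (g q - g p))"
        by (simp add: algebra_simps)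
      also have "\<dots> \<le> norm (f (q - p)) * norm (g q - g p)"
        by (rule norm_mult_ineq)
      also have "\<dots> \<le> (norm (q - p) * K) * norm (g q - g p)"
        by (rule mult_right_mono[OF K]) simp
      finally show ?thesis
        using that by (simp add: field_simps)
    qed
    have "((\<lambda>q. K * norm (g q - g p)) \<longlongrightarrow> K * norm (g p - g p)) (at p)"
      using g by (intro tendsto_intros) (simp add: isCont_def)
    then show "((\<lambda>q. K * norm (g q - g p)) \<longlongrightarrow> 0) (at p)" by simp
  qed simp
qed

text \<open>Write \<open>G(x, y) - G(x\<^sub>0, y\<^sub>0) = (x - x\<^sub>0) q(y, x) + (G(x\<^sub>0, y) - G(x\<^sub>0, y\<^sub>0))\<close>.  The difference quotient
  \<open>q(y, -)\<close> is holomorphic across \<open>x\<^sub>0\<close>, and \<open>q\<close> is continuous on \<open>|x - x\<^sub>0| = r\<close>, hence jointly continuous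
  near the base point by the maximum principle; this suffices for a total derivative.\<close>

lemma Osgood:
  assumes S: "open S" and cont: "continuous_on S G"
    and hol1: "\<And>x y. (x, y) \<in> S \<Longrightarrow> (\<lambda>t. G (t, y)) field_differentiable at x"
    and hol2: "\<And>x y. (x, y) \<in> S \<Longrightarrow> (\<lambda>t. G (x, t)) field_differentiable at y"
    and p: "p \<in> S"
  shows "cdiff2 G p"
proof -
  obtain x0 y0 where p_eq: "p = (x0, y0)" by (cases p)
  obtain R where R: "0 < R" "ball x0 R \<times> ball y0 R \<subseteq> S"
    by (rule ball_Times_ball[OF S p[unfolded p_eq]])
  define q where "q y x = (if x = x0 then deriv (\<lambda>t. G (t, y)) x0
      else (G (x, y) - G (x0, y)) / (x - x0))" for x y
  have holq: "q y holomorphic_on ball x0 R" if y: "y \<in> ball y0 R" for y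
  proof -
    have "(\<lambda>t. G (t, y)) holomorphic_on ball x0 R"
      unfolding holomorphic_on_def
    proof
      fix x assume "x \<in> ball x0 R"
      then have "(x, y) \<in> S" using R y by auto
      from hol1[OF this] show "(\<lambda>t. G (t, y)) field_differentiable at x within ball x0 R"
        by (rule field_differentiable_at_within)
    qed
    from pole_lemma_open[OF this open_ball, of x0] show ?thesis
      by (auto simp: q_def[abs_def])
  qed
  have sub: "cball x0 (R / 2) \<subseteq> ball x0 R" "ball x0 (R / 2) \<subseteq> ball x0 R"
    "sphere x0 (R / 2) \<subseteq> ball x0 R"
    using R(1) by auto
  have "continuous_on (ball y0 R \<times> ball x0 (R/2)) (\<lambda>(y, x). q y x)"
  proof (rule continuous_on_holomorphic_slices)
    show "continuous_on (cball x0 (R/2)) (q y)" "q y holomorphic_on ball x0 (R/2)"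
      if "y \<in> ball y0 R" for y
      using holq[OF that] sub holomorphic_on_imp_continuous_on holomorphic_on_subset by metis+
    have "continuous_on (ball y0 R \<times> sphere x0 (R/2)) (\<lambda>q. (snd q, fst q))"
      by (intro continuous_on_Pair continuous_on_fst continuous_on_snd continuous_on_id)
    then have c1: "continuous_on (ball y0 R \<times> sphere x0 (R/2)) (\<lambda>q. G (snd q, fst q))"
      by (rule continuous_on_compose2[OF cont]) (use R(2) sub(3) in fastforce)
    have "continuous_on (ball y0 R \<times> sphere x0 (R/2)) (\<lambda>q. (x0, fst q))"
      by (intro continuous_on_Pair continuous_on_fst continuous_on_const continuous_on_id)
    then have c2: "continuous_on (ball y0 R \<times> sphere x0 (R/2)) (\<lambda>q. G (x0, fst q))"
      by (rule continuous_on_compose2[OF cont]) (use R in fastforce)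
    have c3: "continuous_on (ball y0 R \<times> sphere x0 (R/2)) (\<lambda>q. snd q - x0)"
      by (intro continuous_on_diff continuous_on_snd continuous_on_const continuous_on_id)
    have "continuous_on (ball y0 R \<times> sphere x0 (R/2))
        (\<lambda>q. (G (snd q, fst q) - G (x0, fst q)) / (snd q - x0))"
      by (rule continuous_on_divide[OF continuous_on_diff[OF c1 c2] c3]) (use R(1) in auto)
    then show "continuous_on (ball y0 R \<times> sphere x0 (R/2)) (\<lambda>(y, x). q y x)"
      by (rule continuous_on_eq) (use R(1) in \<open>auto simp: q_def\<close>)
  qed (use R in auto)
  moreover have "open (ball y0 R \<times> ball x0 (R/2))"
    by (intro open_Times open_ball)
  ultimately have "isCont (\<lambda>(y, x). q y x) (y0, x0)"
    using R(1) by (auto simp: continuous_on_eq_continuous_at)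
  then have q_at: "isCont (\<lambda>(y, x). q y x) (y0, x0)" .
  have "((\<lambda>u. (snd u, fst u)) \<longlongrightarrow> (y0, x0)) (at (x0, y0))"
    using tendsto_Pair[OF tendsto_snd[OF tendsto_ident_at] tendsto_fst[OF tendsto_ident_at], of "(x0, y0)" UNIV]
    by simp
  from isCont_tendsto_compose[OF q_at this]
  have contq: "isCont (\<lambda>u. q (snd u) (fst u)) (x0, y0)"
    by (simp add: isCont_def)
  have 1: "((\<lambda>u. fst (u - (x0, y0)) * q (snd u) (fst u)) has_derivative
      (\<lambda>h. fst h * q y0 x0)) (at (x0, y0))"
    using has_derivative_mult_vanishing[OF bounded_linear_fst contq] by simp
  obtain d where "((\<lambda>t. G (x0, t)) has_derivative (*) d) (at y0)"
    using hol2[of x0 y0] p p_eq by (auto simp: field_differentiable_def has_field_derivative_def)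
  then have 2: "((\<lambda>u. G (x0, snd u)) has_derivative (\<lambda>h. d * snd h)) (at (x0, y0))"
    using has_derivative_compose[OF has_derivative_snd[OF has_derivative_ident], of "\<lambda>t. G (x0, t)" "(*) d" "(x0, y0)" UNIV]
    by simp
  have "((\<lambda>u. fst (u - (x0, y0)) * q (snd u) (fst u) + G (x0, snd u)) has_derivative
      (\<lambda>(h, k). q y0 x0 * h + d * k)) (at (x0, y0))"
    using has_derivative_add[OF 1 2] by (simp add: case_prod_unfold mult.commute)
  moreover have "fst (u - (x0, y0)) * q (snd u) (fst u) + G (x0, snd u) = G u" for u
    by (auto simp: q_def)
  ultimately show ?thesis
    unfolding p_eq by (intro cdiff2I) simp
qed

text \<open>The base point of the quotient moves along the diagonal, so that this is the coefficient of \<open>y - x\<close>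
  when \<open>G\<close> is divided by the equation of the diagonal.\<close>

definition divided_difference :: "(complex \<times> complex \<Rightarrow> complex) \<Rightarrow> complex \<times> complex \<Rightarrow> complex" where
  "divided_difference G = (\<lambda>(x, y).
     if x = y then deriv (\<lambda>t. G (x, t)) x else (G (x, y) - G (x, x)) / (y - x))"

lemma divided_difference_eq: "G (x, y) = G (x, x) + (y - x) * divided_difference G (x, y)"
  by (auto simp: divided_difference_def)

text \<open>Off the diagonal this is a quotient of holomorphic functions.  At a diagonal point the maximum
  principle gives continuity, removal of singularities gives holomorphy in either variable
  separately, and Osgood's lemma combines the two.\<close>

lemma cdiff2_divided_difference:
  assumes S: "open S" and G: "\<And>p. p \<in> S \<times> S \<Longrightarrow> cdiff2 G p" and p: "p \<in> S \<times> S"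
  shows "cdiff2 (divided_difference G) p"
proof -
  let ?Q = "divided_difference G"
  have off: "cdiff2 ?Q (x, y)" if "x \<in> S" "y \<in> S" "x \<noteq> y" for x y
  proof (rule cdiff2_transform)
    have "cdiff2 (\<lambda>u. G (fst u, fst u)) (x, y)"
      by (rule cdiff2_on_fst[where f = "\<lambda>t. G (t, t)"])
        (use G that in \<open>auto intro!: cdiff2_diagonal\<close>)
    then show "cdiff2 (\<lambda>u. (G u - G (fst u, fst u)) / (snd u - fst u)) (x, y)"
      using G that by (intro cdiff2_divide cdiff2_diff cdiff2_snd cdiff2_fst) auto
    have "open {u :: complex \<times> complex. fst u \<noteq> snd u}"
      by (intro open_Collect_neq continuous_intros)
    from eventually_nhds_in_open[OF this, of "(x, y)"] have "\<forall>\<^sub>F u in nhds (x, y). fst u \<noteq> snd u"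
      using that(3) by simp
    then show "\<forall>\<^sub>F u in nhds (x, y). (G u - G (fst u, fst u)) / (snd u - fst u) = ?Q u"
      by eventually_elim (auto simp: divided_difference_def)
  qed
  have slice2: "(\<lambda>y. ?Q (x, y)) holomorphic_on S" if "x \<in> S" for x
  proof -
    have "(\<lambda>t. G (x, t)) holomorphic_on S"
      unfolding holomorphic_on_def
    proof
      fix y assume "y \<in> S"
      have "(\<lambda>t. G (x, t)) field_differentiable at y"
        using G \<open>x \<in> S\<close> \<open>y \<in> S\<close> by (intro cdiff2_slice2) auto
      then show "(\<lambda>t. G (x, t)) field_differentiable at y within S"
        by (rule field_differentiable_at_within)
    qed
    from pole_lemma_open[OF this S, of x] show ?thesis
      by (rule holomorphic_transform) (auto simp: divided_difference_def)
  qed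
  have diag: "cdiff2 ?Q (p, p)" if pS: "p \<in> S" for p
  proof -
    obtain R where R: "0 < R" "ball p R \<subseteq> S"
      using S pS by (meson open_contains_ball)
    define r where "r = R / 2"
    have r: "0 < r" "cball p r \<subseteq> S" "sphere p r \<subseteq> S" "ball p r \<subseteq> S"
      using R by (auto simp: r_def subset_iff)
    have "continuous_on (ball p (r/2) \<times> ball p r) (\<lambda>(x, y). ?Q (x, y))"
    proof (rule continuous_on_holomorphic_slices)
      show "continuous_on (cball p r) (\<lambda>y. ?Q (x, y))" "(\<lambda>y. ?Q (x, y)) holomorphic_on ball p r"
        if "x \<in> ball p (r/2)" for x
      proof -
        have "x \<in> S" using that r by (auto simp: subset_iff)
        then show "continuous_on (cball p r) (\<lambda>y. ?Q (x, y))" "(\<lambda>y. ?Q (x, y)) holomorphic_on ball p r"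
          using slice2 r holomorphic_on_imp_continuous_on holomorphic_on_subset by metis+
      qed
      have "isCont ?Q (x, y)" if "(x, y) \<in> ball p (r/2) \<times> sphere p r" for x y
      proof -
        have "x \<in> S" "y \<in> S" "x \<noteq> y"
          using that r by (auto simp: subset_iff)
        then show ?thesis using off cdiff2_isCont by blast
      qed
      then show "continuous_on (ball p (r/2) \<times> sphere p r) (\<lambda>(x, y). ?Q (x, y))"
        by (auto intro!: continuous_at_imp_continuous_on)
    qed (use r in auto)
    then have cont: "continuous_on (ball p (r/2) \<times> ball p r) ?Q"
      by simp
    have sub: "ball p (r/2) \<times> ball p (r/2) \<subseteq> ball p (r/2) \<times> ball p r"
      using r(1) by auto
    have S2: "ball p (r/2) \<subseteq> S"
      using r by (auto simp: subset_iff)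
    have cont': "continuous_on (ball p (r/2) \<times> ball p (r/2)) ?Q"
      using cont sub by (rule continuous_on_subset)
    show ?thesis
    proof (rule Osgood[OF _ cont'])
      show "open (ball p (r/2) \<times> ball p (r/2))" by (intro open_Times open_ball)
      show "(p, p) \<in> ball p (r/2) \<times> ball p (r/2)" using r by auto
      fix x y assume xy: "(x, y) \<in> ball p (r/2) \<times> ball p (r/2)"
      show "(\<lambda>t. ?Q (x, t)) field_differentiable at y"
        using slice2[of x] S2 S xy holomorphic_on_imp_differentiable_at[of _ S y] by blast
      have "(\<lambda>t. ?Q (t, y)) holomorphic_on ball p (r/2)"
      proof (rule no_isolated_singularity[where K = "{y}"])
        show "continuous_on (ball p (r/2)) (\<lambda>t. ?Q (t, y))"
          by (rule continuous_on_compose2[OF cont']) (use xy in \<open>auto intro!: continuous_intros\<close>)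
        have "(\<lambda>t. ?Q (t, y)) field_differentiable at x" if "x \<in> ball p (r/2) - {y}" for x
        proof -
          have "x \<in> S" "y \<in> S" "x \<noteq> y" using that xy S2 by blast+
          then show ?thesis by (intro cdiff2_slice1 off)
        qed
        then show "(\<lambda>t. ?Q (t, y)) holomorphic_on ball p (r/2) - {y}"
          unfolding holomorphic_on_def by (blast intro: field_differentiable_at_within)
      qed auto
      then show "(\<lambda>t. ?Q (t, y)) field_differentiable at x"
        using xy by (auto intro: holomorphic_on_imp_differentiable_at)
    qed
  qed
  show ?thesis
    using off diag p by (cases p) auto
qed

section \<open>Holomorphy at a point of a Riemann surface\<close>

lemma field_differentiable_cong_nhds:
  assumes "f field_differentiable at a" "\<forall>\<^sub>F w in nhds a. f w = g w"
  shows "g field_differentiable at a"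
  using assms DERIV_cong_ev[OF refl assms(2) refl] unfolding field_differentiable_def by blast

lemma is_chartD:
  assumes "is_chart (U, z)"
  shows "open U" "open (z ` U)" "continuous_on U z" "continuous_on (z ` U) (inv_into U z)"
    and "\<And>x. x \<in> U \<Longrightarrow> inv_into U z (z x) = x" "inj_on z U"
  using assms by (auto simp: is_chart_def homeomorphism_def intro: inj_on_inverseI)

lemma open_chart_image:
  assumes "is_chart (U, z)" "open V"
  shows "open (z ` (U \<inter> V))"
proof -
  have "z ` (U \<inter> V) = z ` U \<inter> inv_into U z -` V"
    using is_chartD(5)[OF assms(1)] by auto
  then show ?thesis
    using continuous_open_preimage[OF is_chartD(4)[OF assms(1)] is_chartD(2)[OF assms(1)] assms(2)] by simp
qed

lemma filterlim_chart:
  fixes U :: "'a::t2_space set"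
  assumes "is_chart (U, z)" "x \<in> U"
  shows "filterlim z (nhds (z x)) (nhds x)" "filterlim (inv_into U z) (nhds x) (nhds (z x))"
proof -
  have "isCont z x" "isCont (inv_into U z) (z x)"
    using is_chartD[OF assms(1)] assms(2) by (auto simp: continuous_on_eq_continuous_at)
  then show "filterlim z (nhds (z x)) (nhds x)" "filterlim (inv_into U z) (nhds x) (nhds (z x))"
    using tendsto_at_iff_tendsto_nhds[of z x] tendsto_at_iff_tendsto_nhds[of "inv_into U z" "z x"]
    by (simp_all add: isCont_def is_chartD(5)[OF assms])
qed

lemma eventually_chart:
  fixes U :: "'a::t2_space set"
  assumes "is_chart (U, z)" "x \<in> U" "\<forall>\<^sub>F y in nhds x. P y"
  shows "\<forall>\<^sub>F w in nhds (z x). P (inv_into U z w)"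
  using filterlim_chart(2)[OF assms(1,2)] assms(3) by (simp add: filterlim_iff)

lemma eventually_in_chart:
  fixes U :: "'a::t2_space set"
  assumes "is_chart (U, z)" "x \<in> U"
  shows "\<forall>\<^sub>F y in nhds x. y \<in> U" "\<forall>\<^sub>F w in nhds (z x). inv_into U z w \<in> U"
    "\<forall>\<^sub>F w in nhds (z x). z (inv_into U z w) = w"
proof -
  show 1: "\<forall>\<^sub>F y in nhds x. y \<in> U"
    using is_chartD(1)[OF assms(1)] assms(2) by (rule eventually_nhds_in_open)
  show "\<forall>\<^sub>F w in nhds (z x). inv_into U z w \<in> U"
    by (rule eventually_chart[OF assms 1])
  have "\<forall>\<^sub>F w in nhds (z x). w \<in> z ` U"
    by (rule eventually_nhds_in_open) (use is_chartD(2)[OF assms(1)] assms(2) in auto)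
  then show "\<forall>\<^sub>F w in nhds (z x). z (inv_into U z w) = w"
    by eventually_elim (rule f_inv_into_f)
qed

lemma filterlim_chart_at:
  fixes U :: "'a::t2_space set"
  assumes "is_chart (U, z)" "x \<in> U"
  shows "filterlim z (at (z x)) (at x)"
  unfolding filterlim_at
proof
  have "\<forall>\<^sub>F y in at x. y \<in> U \<and> y \<noteq> x"
    using eventually_in_chart(1)[OF assms] by (simp add: eventually_at_filter eventually_mono)
  then show "\<forall>\<^sub>F y in at x. z y \<in> UNIV \<and> z y \<noteq> z x"
    by eventually_elim (use is_chartD(6)[OF assms(1)] assms(2) in \<open>auto dest: inj_onD\<close>)
  show "(z \<longlongrightarrow> z x) (at x)"
    by (rule filterlim_mono[OF filterlim_chart(1)[OF assms] order_refl]) (simp add: at_within_def)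
qed

lemma at_neq_bot_chart:
  fixes U :: "'a::t2_space set"
  assumes "is_chart (U, z)" "x \<in> U"
  shows "at x \<noteq> bot"
proof
  assume "at x = bot"
  then have "open {x}" by (simp add: at_eq_bot_iff)
  from open_chart_image[OF assms(1) this] have "open {z x}"
    using assms(2) by simp
  then show False using not_open_singleton by blast
qed

lemma field_differentiable_change_chart:
  fixes U :: "'a::t2_space set"
  assumes c: "is_chart (U, z)" "x \<in> U" and c': "is_chart (V, w)" "x \<in> V"
    and tr: "(z \<circ> inv_into V w) field_differentiable at (w x)"
    and f: "(f \<circ> inv_into U z) field_differentiable at (z x)"
  shows "(f \<circ> inv_into V w) field_differentiable at (w x)"
proof (rule field_differentiable_cong_nhds)
  show "((f \<circ> inv_into U z) \<circ> (z \<circ> inv_into V w)) field_differentiable at (w x)"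
    using tr f is_chartD(5)[OF c'] by (intro field_differentiable_compose) auto
  show "\<forall>\<^sub>F u in nhds (w x). ((f \<circ> inv_into U z) \<circ> (z \<circ> inv_into V w)) u = (f \<circ> inv_into V w) u"
    using eventually_chart[OF c' eventually_in_chart(1)[OF c]]
    by eventually_elim (use is_chartD(5)[OF c(1)] in simp)
qed

text \<open>Holomorphy near a point may be tested in one chart of the atlas and used in every other one; the
  transition maps account for the difference.\<close>

definition hol_at :: "'a::topological_space chart set \<Rightarrow> ('a \<Rightarrow> complex) \<Rightarrow> 'a \<Rightarrow> bool" where
  "hol_at A f x \<longleftrightarrow> (\<exists>(U, z)\<in>A. x \<in> U \<and> (f \<circ> inv_into U z) field_differentiable at (z x))"

definition hol2_at :: "'a::topological_space chart set \<Rightarrow> ('a \<times> 'a \<Rightarrow> complex) \<Rightarrow> 'a \<times> 'a \<Rightarrow> bool" where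
  "hol2_at A G = (\<lambda>(x, y). \<exists>(U, z)\<in>A. \<exists>(V, w)\<in>A. x \<in> U \<and> y \<in> V \<and>
     cdiff2 (G \<circ> map_prod (inv_into U z) (inv_into V w)) (z x, w y))"

locale holomorphic_atlas =
  fixes A :: "'a::t2_space chart set"
  assumes riemann: "riemann_surface A"
begin

lemma chart: "(U, z) \<in> A \<Longrightarrow> is_chart (U, z)"
  using riemann unfolding riemann_surface_def by blast

lemma chart_around:
  obtains U z where "(U, z) \<in> A" "x \<in> U"
proof -
  have "x \<in> \<Union> (fst ` A)" using riemann unfolding riemann_surface_def by simp
  then obtain c where "c \<in> A" "x \<in> fst c" by blast
  then show ?thesis using that[of "fst c" "snd c"] by simp
qed

lemma transition_differentiable:
  assumes "(U, z) \<in> A" "(V, w) \<in> A" "x \<in> U" "x \<in> V"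
  shows "(w \<circ> inv_into U z) field_differentiable at (z x)"
proof -
  have "transition_holomorphic (U, z) (V, w)"
    using riemann assms unfolding riemann_surface_def by blast
  then have "(w \<circ> inv_into U z) holomorphic_on z ` (U \<inter> V)"
    by (simp add: transition_holomorphic_def)
  moreover have "open (z ` (U \<inter> V))"
    using open_chart_image[OF chart] is_chartD(1)[OF chart] assms by blast
  ultimately show ?thesis
    using assms by (intro holomorphic_on_imp_differentiable_at) auto
qed

lemma hol_atI:
  "(U, z) \<in> A \<Longrightarrow> x \<in> U \<Longrightarrow> (f \<circ> inv_into U z) field_differentiable at (z x) \<Longrightarrow> hol_at A f x"
  unfolding hol_at_def by blast

lemma hol_atD:
  assumes "hol_at A f x" "(U, z) \<in> A" "x \<in> U"
  shows "(f \<circ> inv_into U z) field_differentiable at (z x)"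
proof -
  obtain V w where Vw: "(V, w) \<in> A" "x \<in> V" "(f \<circ> inv_into V w) field_differentiable at (w x)"
    using assms(1) unfolding hol_at_def by blast
  show ?thesis
    by (rule field_differentiable_change_chart[OF chart[OF Vw(1)] Vw(2) chart[OF assms(2)] assms(3)
          transition_differentiable[OF assms(2) Vw(1) assms(3) Vw(2)] Vw(3)])
qed

text \<open>On open sets the sheaf-theoretic notion is a condition at each point, so that sections can be
  combined and glued pointwise.\<close>

lemma hol_on_iff:
  assumes "open V"
  shows "hol_on A V f \<longleftrightarrow> (\<forall>x\<in>V. hol_at A f x)"
proof
  assume f: "hol_on A V f"
  show "\<forall>x\<in>V. hol_at A f x"
  proof
    fix x assume "x \<in> V"
    obtain U z where Uz: "(U, z) \<in> A" "x \<in> U" by (rule chart_around)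
    then have "(f \<circ> inv_into U z) holomorphic_on z ` (U \<inter> V)"
      using f unfolding hol_on_def by blast
    moreover have "open (z ` (U \<inter> V))"
      using open_chart_image[OF chart[OF Uz(1)] assms] .
    ultimately have "(f \<circ> inv_into U z) field_differentiable at (z x)"
      using \<open>x \<in> V\<close> Uz by (intro holomorphic_on_imp_differentiable_at) auto
    then show "hol_at A f x" using Uz by (intro hol_atI)
  qed
next
  assume f: "\<forall>x\<in>V. hol_at A f x"
  show "hol_on A V f"
    unfolding hol_on_def
  proof safe
    fix U z assume Uz: "(U, z) \<in> A"
    show "(f \<circ> inv_into U z) holomorphic_on z ` (U \<inter> V)"
      unfolding holomorphic_on_def
    proof
      fix u assume "u \<in> z ` (U \<inter> V)"
      then obtain x where x: "u = z x" "x \<in> U" "x \<in> V" by blast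
      have "(f \<circ> inv_into U z) field_differentiable at (z x)"
        using f x Uz by (intro hol_atD) auto
      then show "(f \<circ> inv_into U z) field_differentiable at u within z ` (U \<inter> V)"
        unfolding x(1) by (rule field_differentiable_at_within)
    qed
  qed
qed

lemma hol_at_cong:
  assumes "hol_at A f x" "\<forall>\<^sub>F y in nhds x. f y = g y"
  shows "hol_at A g x"
proof -
  obtain U z where Uz: "(U, z) \<in> A" "x \<in> U" by (rule chart_around)
  have "(g \<circ> inv_into U z) field_differentiable at (z x)"
    by (rule field_differentiable_cong_nhds[OF hol_atD[OF assms(1) Uz]])
      (use eventually_chart[OF chart[OF Uz(1)] Uz(2) assms(2)] in simp)
  then show ?thesis using Uz by (intro hol_atI)
qed

lemma hol_at_const: "hol_at A (\<lambda>_. c) x"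
  by (rule chart_around[of x], rule hol_atI) (auto simp: o_def)

lemma hol_at_chart:
  assumes "(U, z) \<in> A" "x \<in> U"
  shows "hol_at A z x"
  by (rule hol_atI[OF assms], rule field_differentiable_cong_nhds[OF field_differentiable_ident])
    (use eventually_in_chart(3)[OF chart[OF assms(1)] assms(2)] in \<open>simp add: eq_commute\<close>)

lemma hol_at_arith:
  assumes "hol_at A f x" "hol_at A g x"
  shows hol_at_add: "hol_at A (\<lambda>y. f y + g y) x"
    and hol_at_diff: "hol_at A (\<lambda>y. f y - g y) x"
    and hol_at_mult: "hol_at A (\<lambda>y. f y * g y) x"
proof -
  obtain U z where c: "(U, z) \<in> A" "x \<in> U" by (rule chart_around)
  note d = assms[THEN hol_atD, OF c]
  show "hol_at A (\<lambda>y. f y + g y) x" "hol_at A (\<lambda>y. f y - g y) x" "hol_at A (\<lambda>y. f y * g y) x"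
    using field_differentiable_add[OF d] field_differentiable_diff[OF d] field_differentiable_mult[OF d]
    by (auto intro!: hol_atI[OF c] simp: o_def)
qed

lemma hol_at_divide:
  "hol_at A f x \<Longrightarrow> hol_at A g x \<Longrightarrow> g x \<noteq> 0 \<Longrightarrow> hol_at A (\<lambda>y. f y / g y) x"
  using hol_atD[of f x] hol_atD[of g x] is_chartD(5)[OF chart]
  by (rule_tac chart_around[of x], rule_tac hol_atI) (auto simp: o_def intro!: field_differentiable_divide)

lemma hol_at_isCont:
  assumes "hol_at A f x"
  shows "isCont f x"
proof -
  obtain U z where Uz: "(U, z) \<in> A" "x \<in> U" by (rule chart_around)
  note c = chart[OF Uz(1)] Uz(2)
  have "isCont (f \<circ> inv_into U z) (z x)"
    by (rule field_differentiable_imp_continuous_at[OF hol_atD[OF assms Uz]])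
  then have "((\<lambda>y. (f \<circ> inv_into U z) (z y)) \<longlongrightarrow> (f \<circ> inv_into U z) (z x)) (nhds x)"
    by (rule isCont_tendsto_compose[OF _ filterlim_chart(1)[OF c]])
  moreover have "\<forall>\<^sub>F y in nhds x. (f \<circ> inv_into U z) (z y) = f y"
    using eventually_in_chart(1)[OF c] by eventually_elim (simp add: is_chartD(5)[OF c(1)])
  ultimately have "(f \<longlongrightarrow> f x) (nhds x)"
    using filterlim_cong[OF refl refl] is_chartD(5)[OF c] by fastforce
  then show ?thesis by (simp add: isCont_def tendsto_at_iff_tendsto_nhds)
qed

lemma has_param_deriv:
  assumes "hol_at A f x" "(U, z) \<in> A" "x \<in> U"
  shows "((f \<circ> inv_into U z) has_field_derivative param_deriv U z f x) (at (z x))"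
  using hol_atD[OF assms] unfolding param_deriv_def by (simp add: DERIV_deriv_iff_field_differentiable)

lemma param_deriv_eqI:
  assumes "((f \<circ> inv_into U z) has_field_derivative d) (at (z x))"
  shows "param_deriv U z f x = d"
  using assms unfolding param_deriv_def by (rule DERIV_imp_deriv)

lemma param_deriv_cong:
  assumes "(U, z) \<in> A" "x \<in> U" "\<forall>\<^sub>F y in nhds x. f y = g y"
  shows "param_deriv U z f x = param_deriv U z g x"
  unfolding param_deriv_def
  by (rule deriv_cong_ev) (use eventually_chart[OF chart[OF assms(1)] assms(2,3)] in auto)

lemma param_deriv_const: "param_deriv U z (\<lambda>_. c) x = 0"
  by (rule param_deriv_eqI) (auto simp: o_def)

lemma param_deriv_self:
  assumes "(U, z) \<in> A" "x \<in> U"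
  shows "param_deriv U z z x = 1"
proof (rule param_deriv_eqI)
  have "\<forall>\<^sub>F w in nhds (z x). (z \<circ> inv_into U z) w = w"
    using eventually_in_chart(3)[OF chart[OF assms(1)] assms(2)] by simp
  from DERIV_cong_ev[OF refl this refl] show "((z \<circ> inv_into U z) has_field_derivative 1) (at (z x))"
    using DERIV_ident by blast
qed

lemma param_deriv_add:
  assumes "hol_at A f x" "hol_at A g x" "(U, z) \<in> A" "x \<in> U"
  shows "param_deriv U z (\<lambda>y. f y + g y) x = param_deriv U z f x + param_deriv U z g x"
  using DERIV_add[OF has_param_deriv[OF assms(1,3,4)] has_param_deriv[OF assms(2,3,4)]]
  by (intro param_deriv_eqI) (simp add: o_def)

lemma param_deriv_mult:
  assumes "hol_at A f x" "hol_at A g x" "(U, z) \<in> A" "x \<in> U"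
  shows "param_deriv U z (\<lambda>y. f y * g y) x = param_deriv U z f x * g x + f x * param_deriv U z g x"
  using DERIV_mult[OF has_param_deriv[OF assms(1,3,4)] has_param_deriv[OF assms(2,3,4)]]
    is_chartD(5)[OF chart[OF assms(3)] assms(4)]
  by (intro param_deriv_eqI) (simp add: o_def mult.commute add.commute)

lemma hol_at_param_deriv:
  assumes "(U, z) \<in> A" "x \<in> U" "\<forall>\<^sub>F y in nhds x. hol_at A f y"
  shows "hol_at A (param_deriv U z f) x"
proof -
  note c = chart[OF assms(1)] assms(2)
  have "\<forall>\<^sub>F w in nhds (z x). hol_at A f (inv_into U z w) \<and> inv_into U z w \<in> U \<and> z (inv_into U z w) = w"
    using eventually_chart[OF c assms(3)] eventually_in_chart(2,3)[OF c] by eventually_elim simp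
  then obtain S where S: "open S" "z x \<in> S"
    "\<And>w. w \<in> S \<Longrightarrow> hol_at A f (inv_into U z w) \<and> inv_into U z w \<in> U \<and> z (inv_into U z w) = w"
    unfolding eventually_nhds by blast
  have "(f \<circ> inv_into U z) holomorphic_on S"
    unfolding holomorphic_on_def
  proof
    fix w assume w: "w \<in> S"
    have "(f \<circ> inv_into U z) field_differentiable at (z (inv_into U z w))"
      using S(3)[OF w] assms(1) by (intro hol_atD) auto
    then show "(f \<circ> inv_into U z) field_differentiable at w within S"
      using S(3)[OF w] by (auto intro: field_differentiable_at_within)
  qed
  then have "deriv (f \<circ> inv_into U z) holomorphic_on S"
    using S(1) by (rule holomorphic_deriv)
  then have d: "deriv (f \<circ> inv_into U z) field_differentiable at (z x)"
    using S by (intro holomorphic_on_imp_differentiable_at)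
  have "\<forall>\<^sub>F w in nhds (z x). w \<in> S"
    using S(1,2) by (rule eventually_nhds_in_open)
  then have "\<forall>\<^sub>F w in nhds (z x). deriv (f \<circ> inv_into U z) w = (param_deriv U z f \<circ> inv_into U z) w"
    by eventually_elim (use S(3) in \<open>simp add: param_deriv_def\<close>)
  from hol_atI[OF assms(1,2) field_differentiable_cong_nhds[OF d this]] show ?thesis .
qed

lemma param_deriv_chain:
  assumes "hol_at A f x" "(U, z) \<in> A" "x \<in> U" "(V, w) \<in> A" "x \<in> V"
  shows "param_deriv V w f x = param_deriv U z f x * param_deriv V w z x"
proof (rule param_deriv_eqI)
  note c = chart[OF assms(2)] assms(3) and c' = chart[OF assms(4)] assms(5)
  have "((f \<circ> inv_into U z) has_field_derivative param_deriv U z f x) (at ((z \<circ> inv_into V w) (w x)))"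
    using has_param_deriv[OF assms(1-3)] is_chartD(5)[OF c'] by simp
  from DERIV_chain[OF this has_param_deriv[OF hol_at_chart[OF assms(2,3)] assms(4,5)]]
  have "(f \<circ> inv_into U z \<circ> (z \<circ> inv_into V w) has_field_derivative
      param_deriv U z f x * param_deriv V w z x) (at (w x))" .
  moreover have "\<forall>\<^sub>F u in nhds (w x). (f \<circ> inv_into U z \<circ> (z \<circ> inv_into V w)) u = (f \<circ> inv_into V w) u"
    using eventually_chart[OF c' eventually_in_chart(1)[OF c]]
    by eventually_elim (use is_chartD(5)[OF c(1)] in simp)
  ultimately show "(f \<circ> inv_into V w has_field_derivative
      param_deriv U z f x * param_deriv V w z x) (at (w x))"
    using DERIV_cong_ev[OF refl _ refl] by blast
qed

lemma hol2_atI: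
  "(U, z) \<in> A \<Longrightarrow> (V, w) \<in> A \<Longrightarrow> x \<in> U \<Longrightarrow> y \<in> V \<Longrightarrow>
    cdiff2 (G \<circ> map_prod (inv_into U z) (inv_into V w)) (z x, w y) \<Longrightarrow> hol2_at A G (x, y)"
  unfolding hol2_at_def by blast

lemma filterlim_inv_charts:
  fixes U V :: "'a set"
  assumes "is_chart (U, z)" "is_chart (V, w)" "x \<in> U" "y \<in> V"
  shows "filterlim (map_prod (inv_into U z) (inv_into V w)) (nhds (x, y)) (nhds (z x, w y))"
proof -
  have "filterlim fst (nhds (z x)) (nhds (z x, w y))" "filterlim snd (nhds (w y)) (nhds (z x, w y))"
    unfolding nhds_prod by (rule filterlim_fst filterlim_snd)+
  then have "((\<lambda>q. (inv_into U z (fst q), inv_into V w (snd q))) \<longlongrightarrow> (x, y)) (nhds (z x, w y))"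
    by (intro tendsto_Pair filterlim_compose[OF filterlim_chart(2)[OF assms(1,3)]]
        filterlim_compose[OF filterlim_chart(2)[OF assms(2,4)]])
  then show ?thesis
    by (simp add: map_prod_def case_prod_unfold)
qed

lemma hol2_atD:
  assumes "hol2_at A G (x, y)" "(U, z) \<in> A" "(V, w) \<in> A" "x \<in> U" "y \<in> V"
  shows "cdiff2 (G \<circ> map_prod (inv_into U z) (inv_into V w)) (z x, w y)"
proof -
  obtain U' z' V' w' where c': "(U', z') \<in> A" "(V', w') \<in> A" "x \<in> U'" "y \<in> V'"
    "cdiff2 (G \<circ> map_prod (inv_into U' z') (inv_into V' w')) (z' x, w' y)"
    using assms(1) unfolding hol2_at_def by blast
  show ?thesis
  proof (rule cdiff2_transform)
    show "cdiff2 (\<lambda>(s, t). (G \<circ> map_prod (inv_into U' z') (inv_into V' w'))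
        ((z' \<circ> inv_into U z) s, (w' \<circ> inv_into V w) t)) (z x, w y)"
    proof (rule cdiff2_compose_prod)
      show "(z' \<circ> inv_into U z) field_differentiable at (z x)" "(w' \<circ> inv_into V w) field_differentiable at (w y)"
        using transition_differentiable c' assms by blast+
      show "cdiff2 (G \<circ> map_prod (inv_into U' z') (inv_into V' w'))
          ((z' \<circ> inv_into U z) (z x), (w' \<circ> inv_into V w) (w y))"
        using c'(5) is_chartD(5)[OF chart[OF assms(2)] assms(4)] is_chartD(5)[OF chart[OF assms(3)] assms(5)]
        by simp
    qed
    have "open (U' \<times> V')" using is_chartD(1)[OF chart] c' by (intro open_Times) auto
    then have "\<forall>\<^sub>F q in nhds (x, y). q \<in> U' \<times> V'"
      by (rule eventually_nhds_in_open) (use c' in auto)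
    then have "\<forall>\<^sub>F q in nhds (z x, w y). map_prod (inv_into U z) (inv_into V w) q \<in> U' \<times> V'"
      by (rule eventually_compose_filterlim[OF _ filterlim_inv_charts[OF chart chart, OF assms(2-5)]])
    then show "\<forall>\<^sub>F q in nhds (z x, w y). (\<lambda>(s, t). (G \<circ> map_prod (inv_into U' z') (inv_into V' w'))
        ((z' \<circ> inv_into U z) s, (w' \<circ> inv_into V w) t)) q
        = (G \<circ> map_prod (inv_into U z) (inv_into V w)) q"
      by eventually_elim (use is_chartD(5)[OF chart[OF c'(1)]] is_chartD(5)[OF chart[OF c'(2)]] in auto)
  qed
qed

lemma hol2_on_iff:
  assumes "open W"
  shows "hol2_on A W G \<longleftrightarrow> (\<forall>p\<in>W. hol2_at A G p)"
proof -
  have op: "open (map_prod z w ` (W \<inter> U \<times> V))" if Uz: "(U, z) \<in> A" and Vw: "(V, w) \<in> A" for U z V w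
  proof -
    note c = is_chartD[OF chart[OF Uz]] and c' = is_chartD[OF chart[OF Vw]]
    let ?i = "map_prod (inv_into U z) (inv_into V w)"
    have "continuous_on (z ` U \<times> w ` V) ?i"
      unfolding map_prod_def case_prod_unfold
      by (intro continuous_on_Pair continuous_on_compose2[OF c(4) continuous_on_fst[OF continuous_on_id]]
          continuous_on_compose2[OF c'(4) continuous_on_snd[OF continuous_on_id]]) auto
    then have "open ((z ` U \<times> w ` V) \<inter> ?i -` W)"
      using c(2) c'(2) assms by (intro continuous_open_preimage open_Times)
    moreover have "(z ` U \<times> w ` V) \<inter> ?i -` W = map_prod z w ` (W \<inter> U \<times> V)"
      using c(5) c'(5) by (auto simp: image_iff)
    ultimately show ?thesis by simp
  qed
  show ?thesis
  proof
    assume G: "hol2_on A W G"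
    show "\<forall>p\<in>W. hol2_at A G p"
    proof
      fix p assume p: "p \<in> W"
      obtain x y where xy: "p = (x, y)" by (cases p)
      obtain U z where Uz: "(U, z) \<in> A" "x \<in> U" by (rule chart_around)
      obtain V w where Vw: "(V, w) \<in> A" "y \<in> V" by (rule chart_around)
      have "holomorphic2_on (G \<circ> map_prod (inv_into U z) (inv_into V w)) (map_prod z w ` (W \<inter> U \<times> V))"
        using G Uz(1) Vw(1) unfolding hol2_on_def by fast
      from this[unfolded holomorphic2_on_open[OF op[OF Uz(1) Vw(1)]]]
      have all: "\<forall>q\<in>map_prod z w ` (W \<inter> U \<times> V). cdiff2 (G \<circ> map_prod (inv_into U z) (inv_into V w)) q" .
      have "(z x, w y) \<in> map_prod z w ` (W \<inter> U \<times> V)"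
        using p xy Uz Vw by (auto intro!: image_eqI[of _ _ "(x, y)"])
      with all have "cdiff2 (G \<circ> map_prod (inv_into U z) (inv_into V w)) (z x, w y)"
        by (rule bspec)
      then show "hol2_at A G p"
        unfolding xy by (rule hol2_atI[OF Uz(1) Vw(1) Uz(2) Vw(2)])
    qed
  next
    assume G: "\<forall>p\<in>W. hol2_at A G p"
    show "hol2_on A W G"
      unfolding hol2_on_def
    proof safe
      fix U z V w assume c: "(U, z) \<in> A" "(V, w) \<in> A"
      show "holomorphic2_on (G \<circ> map_prod (inv_into U z) (inv_into V w)) (map_prod z w ` (W \<inter> U \<times> V))"
        unfolding holomorphic2_on_open[OF op[OF c]]
        using G c by (auto intro!: hol2_atD)
    qed
  qed
qed

lemma hol2_at_cong:
  assumes "hol2_at A F p" "\<forall>\<^sub>F q in nhds p. F q = G q"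
  shows "hol2_at A G p"
proof -
  obtain x y where p: "p = (x, y)" by (cases p)
  obtain U z where Uz: "(U, z) \<in> A" "x \<in> U" by (rule chart_around)
  obtain V w where Vw: "(V, w) \<in> A" "y \<in> V" by (rule chart_around)
  have "\<forall>\<^sub>F q in nhds (z x, w y). F (map_prod (inv_into U z) (inv_into V w) q)
      = G (map_prod (inv_into U z) (inv_into V w) q)"
    by (rule eventually_compose_filterlim[OF assms(2)[unfolded p]
          filterlim_inv_charts[OF chart chart, OF Uz(1) Vw(1) Uz(2) Vw(2)]])
  then show ?thesis
    unfolding p
    by (intro hol2_atI[OF Uz(1) Vw(1) Uz(2) Vw(2)]
        cdiff2_transform[OF hol2_atD[OF assms(1)[unfolded p] Uz(1) Vw(1) Uz(2) Vw(2)]]) simp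
qed

lemma charts_around:
  obtains U z V w where "(U, z) \<in> A" "(V, w) \<in> A" "x \<in> U" "y \<in> V"
  by (rule chart_around[of x], rule chart_around[of y]) (rule that)

lemma hol2_at_arith:
  assumes "hol2_at A F p" "hol2_at A G p"
  shows hol2_at_add: "hol2_at A (\<lambda>q. F q + G q) p"
    and hol2_at_diff: "hol2_at A (\<lambda>q. F q - G q) p"
    and hol2_at_mult: "hol2_at A (\<lambda>q. F q * G q) p"
proof -
  obtain x y where p: "p = (x, y)" by (cases p)
  obtain U z V w where c: "(U, z) \<in> A" "(V, w) \<in> A" "x \<in> U" "y \<in> V" by (rule charts_around)
  note d = assms[unfolded p, THEN hol2_atD, OF c]
  show "hol2_at A (\<lambda>q. F q + G q) p" "hol2_at A (\<lambda>q. F q - G q) p" "hol2_at A (\<lambda>q. F q * G q) p"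
    unfolding p using cdiff2_add[OF d] cdiff2_diff[OF d] cdiff2_mult[OF d]
    by (auto intro!: hol2_atI[OF c] simp: o_def)
qed

lemma hol2_at_divide:
  assumes "hol2_at A F p" "hol2_at A G p" "G p \<noteq> 0"
  shows "hol2_at A (\<lambda>q. F q / G q) p"
proof (cases p)
  fix x y assume xy: "p = (x, y)"
  obtain U z V w where c: "(U, z) \<in> A" "(V, w) \<in> A" "x \<in> U" "y \<in> V" by (rule charts_around)
  have "(G \<circ> map_prod (inv_into U z) (inv_into V w)) (z x, w y) \<noteq> 0"
    using assms(3) xy c is_chartD(5)[OF chart] by simp
  from cdiff2_divide[OF hol2_atD[OF _ c, of F] hol2_atD[OF _ c, of G] this] assms show ?thesis
    unfolding xy by (intro hol2_atI[OF c]) (simp add: o_def)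
qed

lemma hol2_at_fst:
  assumes "hol_at A f x"
  shows "hol2_at A (\<lambda>q. f (fst q)) (x, y)"
proof -
  obtain U z V w where c: "(U, z) \<in> A" "(V, w) \<in> A" "x \<in> U" "y \<in> V" by (rule charts_around)
  have "cdiff2 (\<lambda>q. (f \<circ> inv_into U z) (fst q)) (z x, w y)"
    by (rule cdiff2_on_fst[where f = "f \<circ> inv_into U z"]) (use hol_atD[OF assms c(1,3)] in simp)
  then show ?thesis by (intro hol2_atI[OF c]) (simp add: o_def)
qed

lemma hol2_at_snd:
  assumes "hol_at A f y"
  shows "hol2_at A (\<lambda>q. f (snd q)) (x, y)"
proof -
  obtain U z V w where c: "(U, z) \<in> A" "(V, w) \<in> A" "x \<in> U" "y \<in> V" by (rule charts_around)
  have "cdiff2 (\<lambda>q. (f \<circ> inv_into V w) (snd q)) (z x, w y)"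
    by (rule cdiff2_on_snd[where f = "f \<circ> inv_into V w"]) (use hol_atD[OF assms c(2,4)] in simp)
  then show ?thesis by (intro hol2_atI[OF c]) (simp add: o_def)
qed

lemma hol_at_slice:
  assumes "hol2_at A G (x, y)"
  shows "hol_at A (\<lambda>t. G (x, t)) y"
proof -
  obtain U z V w where c: "(U, z) \<in> A" "(V, w) \<in> A" "x \<in> U" "y \<in> V" by (rule charts_around)
  from cdiff2_slice2[OF hol2_atD[OF assms c]] show ?thesis
    using is_chartD(5)[OF chart[OF c(1)] c(3)] by (intro hol_atI[OF c(2,4)]) (simp add: o_def)
qed

lemma hol_at_diagonal:
  assumes "hol2_at A G (x, x)"
  shows "hol_at A (\<lambda>t. G (t, t)) x"
proof -
  obtain U z where c: "(U, z) \<in> A" "x \<in> U" by (rule chart_around)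
  from cdiff2_diagonal[OF hol2_atD[OF assms c(1) c(1) c(2) c(2)]] show ?thesis
    by (intro hol_atI[OF c]) (simp add: o_def)
qed

end

section \<open>Polar parts along the diagonal\<close>

text \<open>The extended difference quotient \<open>q\<close> satisfies \<open>f = f(a) + (u - a) q\<close>; differentiating twice gives
  \<open>f''(a) = 2 q'(a)\<close>.\<close>

lemma second_order_slope:
  assumes f: "f holomorphic_on S" and S: "open S" "a \<in> S"
  shows "((\<lambda>u. ((f u - f a) / (u - a) - deriv f a) / (u - a)) \<longlongrightarrow> deriv (deriv f) a / 2) (at a)"
proof -
  define q where "q u = (if u = a then deriv f a else (f u - f a) / (u - a))" for u
  have q: "q holomorphic_on S"
    using pole_lemma_open[OF f S(1), of a] by (simp add: q_def[abs_def])
  have f_eq: "f u = f a + (u - a) * q u" for u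
    by (simp add: q_def)
  have der_q: "(q has_field_derivative deriv q u) (at u)" if "u \<in> S" for u
    using q S(1) that by (rule holomorphic_derivI)
  have der_f: "deriv f u = q u + (u - a) * deriv q u" if "u \<in> S" for u
  proof (rule DERIV_imp_deriv)
    have "((\<lambda>u. f a + (u - a) * q u) has_field_derivative q u + (u - a) * deriv q u) (at u)"
      using der_q[OF that] by (auto intro!: derivative_eq_intros)
    then show "(f has_field_derivative q u + (u - a) * deriv q u) (at u)"
      by (simp add: f_eq[symmetric])
  qed
  have "deriv (deriv f) a = 2 * deriv q a"
  proof (rule DERIV_imp_deriv)
    have "(deriv q has_field_derivative deriv (deriv q) a) (at a)"
      using holomorphic_deriv[OF q S(1)] S by (rule holomorphic_derivI)
    then have "((\<lambda>u. q u + (u - a) * deriv q u) has_field_derivative 2 * deriv q a) (at a)"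
      using der_q[OF S(2)] by (auto intro!: derivative_eq_intros)
    moreover have "\<forall>\<^sub>F u in nhds a. q u + (u - a) * deriv q u = deriv f u"
      using eventually_nhds_in_open[OF S] by eventually_elim (simp add: der_f)
    from DERIV_cong_ev[OF refl this refl] have "((\<lambda>u. q u + (u - a) * deriv q u) has_field_derivative 2 * deriv q a) (at a)
        \<longleftrightarrow> (deriv f has_field_derivative 2 * deriv q a) (at a)" .
    ultimately show "(deriv f has_field_derivative 2 * deriv q a) (at a)"
      by simp
  qed
  moreover have "((\<lambda>u. (q u - q a) / (u - a)) \<longlongrightarrow> deriv q a) (at a)"
    using der_q[OF S(2)] by (simp add: has_field_derivative_iff)
  ultimately have "((\<lambda>u. (q u - q a) / (u - a)) \<longlongrightarrow> deriv (deriv f) a / 2) (at a)"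
    by simp
  moreover have "\<forall>\<^sub>F u in at a. (q u - q a) / (u - a) = ((f u - f a) / (u - a) - deriv f a) / (u - a)"
    by (simp add: eventually_at_filter q_def)
  ultimately show ?thesis
    by (rule Lim_transform_eventually)
qed

text \<open>On the slice \<open>{x} \<times> X\<close> the function \<open>F\<close> is \<open>a (z(y) - z(x))\<^sup>-\<^sup>1 + b + o(1)\<close>.  The condition is a limit,
  so that no holomorphic numerator of \<open>F\<close> has to be chosen.\<close>

definition polar_jet ::
  "('a::topological_space \<Rightarrow> complex) \<Rightarrow> ('a \<times> 'a \<Rightarrow> complex) \<Rightarrow> 'a \<Rightarrow> complex \<Rightarrow> complex \<Rightarrow> bool" where
  "polar_jet z F x a b \<longleftrightarrow> ((\<lambda>y. F (x, y) - a / (z y - z x)) \<longlongrightarrow> b) (at x)"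

lemma polar_jet_unique:
  fixes U :: "'a::t2_space set"
  assumes c: "is_chart (U, z)" "x \<in> U" and "polar_jet z F x a b" "polar_jet z F x a' b'"
  shows "a = a'" "b = b'"
proof -
  have d0: "((\<lambda>y. z y - z x) \<longlongrightarrow> 0) (at x)"
    using filterlim_chart_at[OF c] by (simp add: filterlim_at LIM_zero_iff)
  have ev: "\<forall>\<^sub>F y in at x. z y - z x \<noteq> 0"
    using filterlim_chart_at[OF c] by (simp add: filterlim_at)
  have "((\<lambda>y. (z y - z x) * F (x, y)) \<longlongrightarrow> a) (at x)" if "polar_jet z F x a b" for a b
  proof -
    have "((\<lambda>y. (z y - z x) * (F (x, y) - a / (z y - z x)) + a) \<longlongrightarrow> 0 * b + a) (at x)"
      using that unfolding polar_jet_def by (intro tendsto_intros d0)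
    moreover have "\<forall>\<^sub>F y in at x. (z y - z x) * (F (x, y) - a / (z y - z x)) + a = (z y - z x) * F (x, y)"
      using ev by eventually_elim (simp add: field_simps)
    ultimately have "((\<lambda>y. (z y - z x) * F (x, y)) \<longlongrightarrow> 0 * b + a) (at x)"
      by (rule Lim_transform_eventually)
    then show ?thesis by simp
  qed
  from this[OF assms(3)] this[OF assms(4)] show "a = a'"
    by (rule tendsto_unique[OF at_neq_bot_chart[OF c]])
  then show "b = b'"
    using assms(3,4) tendsto_unique[OF at_neq_bot_chart[OF c]] unfolding polar_jet_def by blast
qed

lemma polar_jet_add:
  assumes "polar_jet z F x a b" "polar_jet z G x a' b'"
  shows "polar_jet z (\<lambda>p. F p + G p) x (a + a') (b + b')"
  using tendsto_add[OF assms[unfolded polar_jet_def]] unfolding polar_jet_def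
  by (simp add: add_divide_distrib algebra_simps)

lemma polar_jet_perturb:
  assumes "polar_jet z F x a b" "((\<lambda>y. G (x, y) - F (x, y)) \<longlongrightarrow> 0) (at x)"
  shows "polar_jet z G x a b"
  using tendsto_add[OF assms(1)[unfolded polar_jet_def] assms(2)] unfolding polar_jet_def
  by (simp add: algebra_simps)

text \<open>The expansion \<open>F = a(z\<^sub>1)(z\<^sub>2 - z\<^sub>1)\<^sup>-\<^sup>1 + Q\<close> on a square neighbourhood; its jet at \<open>x\<close> is \<open>(a(x), Q(x, x))\<close>.\<close>

definition polar_local_form where
  "polar_local_form A U z F M a Q \<longleftrightarrow> open M \<and> M \<subseteq> U \<and> (\<forall>x\<in>M. hol_at A a x) \<and>
     (\<forall>p\<in>M \<times> M. hol2_at A Q p) \<and>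
     (\<forall>x\<in>M. \<forall>y\<in>M. x \<noteq> y \<longrightarrow> F (x, y) = a x / (z y - z x) + Q (x, y))"

definition polar_numerator where
  "polar_numerator A W F U z H \<longleftrightarrow> (\<forall>p\<in>W \<inter> U \<times> U. hol2_at A H p) \<and>
     (\<forall>x y. (x, y) \<in> W \<inter> U \<times> U \<and> x \<noteq> y \<longrightarrow> H (x, y) = (z y - z x) * F (x, y))"

context holomorphic_atlas
begin

lemma slope_tendsto:
  assumes "hol_at A f x" "(U, z) \<in> A" "x \<in> U"
  shows "((\<lambda>y. (f y - f x) / (z y - z x)) \<longlongrightarrow> param_deriv U z f x) (at x)"
proof -
  note c = chart[OF assms(2)] assms(3)
  have "((\<lambda>w. ((f \<circ> inv_into U z) w - (f \<circ> inv_into U z) (z x)) / (w - z x)) \<longlongrightarrow> param_deriv U z f x) (at (z x))"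
    using has_param_deriv[OF assms] by (simp add: has_field_derivative_iff)
  from filterlim_compose[OF this filterlim_chart_at[OF c]]
  have "((\<lambda>y. ((f \<circ> inv_into U z) (z y) - (f \<circ> inv_into U z) (z x)) / (z y - z x)) \<longlongrightarrow> param_deriv U z f x) (at x)" .
  moreover have "\<forall>\<^sub>F y in at x. ((f \<circ> inv_into U z) (z y) - (f \<circ> inv_into U z) (z x)) / (z y - z x)
      = (f y - f x) / (z y - z x)"
    using eventually_in_chart(1)[OF c] unfolding eventually_at_filter
    by eventually_elim (simp add: is_chartD(5)[OF c(1)] c(2))
  ultimately show ?thesis by (rule Lim_transform_eventually)
qed

lemma second_slope_tendsto:
  assumes f: "\<forall>\<^sub>F y in nhds x. hol_at A f y" and "(U, z) \<in> A" "x \<in> U"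
  shows "((\<lambda>y. ((f y - f x) / (z y - z x) - param_deriv U z f x) / (z y - z x)) \<longlongrightarrow>
    param_deriv U z (param_deriv U z f) x / 2) (at x)"
proof -
  note c = chart[OF assms(2)] assms(3)
  let ?g = "f \<circ> inv_into U z"
  obtain N where N: "open N" "x \<in> N" "\<And>y. y \<in> N \<Longrightarrow> hol_at A f y"
    using f unfolding eventually_nhds by blast
  have "hol_on A N f" using N by (simp add: hol_on_iff)
  then have hol: "?g holomorphic_on z ` (U \<inter> N)"
    using assms(2) unfolding hol_on_def by blast
  have op: "open (z ` (U \<inter> N))" "z x \<in> z ` (U \<inter> N)"
    using open_chart_image[OF c(1) N(1)] N(2) c(2) by auto
  have "\<forall>\<^sub>F w in nhds (z x). deriv ?g w = (param_deriv U z f \<circ> inv_into U z) w"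
    using eventually_in_chart(3)[OF c] by eventually_elim (simp add: param_deriv_def)
  then have d2: "deriv (deriv ?g) (z x) = param_deriv U z (param_deriv U z f) x"
    unfolding param_deriv_def by (intro deriv_cong_ev) (auto simp: param_deriv_def)
  have "((\<lambda>y. ((?g (z y) - ?g (z x)) / (z y - z x) - deriv ?g (z x)) / (z y - z x)) \<longlongrightarrow>
      param_deriv U z (param_deriv U z f) x / 2) (at x)"
    using filterlim_compose[OF second_order_slope[OF hol op] filterlim_chart_at[OF c]] unfolding d2 .
  moreover have "\<forall>\<^sub>F y in at x. ((?g (z y) - ?g (z x)) / (z y - z x) - deriv ?g (z x)) / (z y - z x)
      = ((f y - f x) / (z y - z x) - param_deriv U z f x) / (z y - z x)"
    using eventually_in_chart(1)[OF c] unfolding eventually_at_filter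
    by eventually_elim (simp add: is_chartD(5)[OF c(1)] c(2) param_deriv_def)
  ultimately show ?thesis by (rule Lim_transform_eventually)
qed

text \<open>Expand \<open>h(x, y) = h(x, x) + h\<^sub>2(x, x)(z\<^sub>2 - z\<^sub>1) + \<dots>\<close>: the linear term meets the pole and contributes to \<open>b\<close>.
  This is the Leibniz rule of the corresponding operator.\<close>

lemma polar_jet_mult:
  assumes "polar_jet z F x a b" "hol_at A (\<lambda>y. h (x, y)) x" "(U, z) \<in> A" "x \<in> U"
  shows "polar_jet z (\<lambda>p. h p * F p) x (h (x, x) * a)
    (h (x, x) * b + a * param_deriv U z (\<lambda>y. h (x, y)) x)"
proof -
  have "((\<lambda>y. h (x, y)) \<longlongrightarrow> h (x, x)) (at x)"
    using hol_at_isCont[OF assms(2)] by (simp add: isCont_def)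
  then have "((\<lambda>y. h (x, y) * (F (x, y) - a / (z y - z x)) + a * ((h (x, y) - h (x, x)) / (z y - z x)))
      \<longlongrightarrow> h (x, x) * b + a * param_deriv U z (\<lambda>y. h (x, y)) x) (at x)"
    using assms(1) slope_tendsto[OF assms(2-4)] unfolding polar_jet_def by (intro tendsto_intros)
  moreover have "h (x, y) * (F (x, y) - a / (z y - z x)) + a * ((h (x, y) - h (x, x)) / (z y - z x))
      = h (x, y) * F (x, y) - h (x, x) * a / (z y - z x)" for y
    by (simp add: algebra_simps diff_divide_distrib)
  ultimately show ?thesis unfolding polar_jet_def by simp
qed

text \<open>With \<open>w\<close> as parameter, \<open>z\<^sub>2 - z\<^sub>1 = z' (w\<^sub>2 - w\<^sub>1) + z'' (w\<^sub>2 - w\<^sub>1)\<^sup>2 / 2 + \<dots>\<close>, so \<open>(w\<^sub>2 - w\<^sub>1)\<^sup>-\<^sup>1\<close> and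
  \<open>z' (z\<^sub>2 - z\<^sub>1)\<^sup>-\<^sup>1\<close> differ by the constant \<open>z'' / (2 z')\<close> up to terms vanishing on the diagonal.\<close>

lemma polar_jet_change:
  assumes jet: "polar_jet w F x a b" and "(V, w) \<in> A" "x \<in> V"
    and z: "\<forall>\<^sub>F y in nhds x. hol_at A z y" "param_deriv V w z x \<noteq> 0"
  shows "polar_jet z F x (a * param_deriv V w z x)
    (b + a * param_deriv V w (param_deriv V w z) x / (2 * param_deriv V w z x))"
proof -
  let ?d = "param_deriv V w z x" and ?d2 = "param_deriv V w (param_deriv V w z) x"
  let ?q = "\<lambda>y. (z y - z x) / (w y - w x)"
  have q: "(?q \<longlongrightarrow> ?d) (at x)"
    using slope_tendsto[OF eventually_nhds_x_imp_x[OF z(1)] assms(2,3)] .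
  have ev: "\<forall>\<^sub>F y in at x. ?q y \<noteq> 0"
    using tendsto_imp_eventually_ne[OF q z(2)] .
  have "((\<lambda>y. (F (x, y) - a / (w y - w x)) + a * (((?q y - ?d) / (w y - w x)) / ?q y))
      \<longlongrightarrow> b + a * ((?d2 / 2) / ?d)) (at x)"
    by (rule tendsto_add[OF jet[unfolded polar_jet_def] tendsto_mult[OF tendsto_const[of a]
          tendsto_divide[OF second_slope_tendsto[OF z(1) assms(2,3)] q z(2)]]])
  moreover have "\<forall>\<^sub>F y in at x. (F (x, y) - a / (w y - w x)) + a * (((?q y - ?d) / (w y - w x)) / ?q y)
      = F (x, y) - a * ?d / (z y - z x)"
    using ev
  proof eventually_elim
    case (elim y)
    then have ne: "w y - w x \<noteq> 0" "z y - z x \<noteq> 0" by auto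
    have "a * (((s / p - d) / p) / (s / p)) = a / p - a * d / s" if "p \<noteq> 0" "s \<noteq> 0" for p s d
      using that by (simp add: field_simps)
    from this[OF ne] show ?case by simp
  qed
  ultimately have "((\<lambda>y. F (x, y) - a * ?d / (z y - z x)) \<longlongrightarrow> b + a * ((?d2 / 2) / ?d)) (at x)"
    by (rule Lim_transform_eventually)
  then show ?thesis
    unfolding polar_jet_def by simp
qed

lemma open_Diff_Id: "open W \<Longrightarrow> open (W - (Id :: ('a \<times> 'a) set))"
proof -
  have "(Id :: ('a \<times> 'a) set) = {y. \<exists>x. y = (x, x)}" by auto
  then have "closed (Id :: ('a \<times> 'a) set)" using closed_diagonal[where 'a = 'a] by (simp only:)
  then show "open W \<Longrightarrow> open (W - Id)" by (rule open_Diff[rotated])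
qed

lemma O_XX_iff: "open W \<Longrightarrow> F \<in> O_XX A W \<longleftrightarrow> (\<forall>p\<in>W. hol2_at A F p) \<and> (\<forall>p. p \<notin> W \<longrightarrow> F p = 0)"
  unfolding O_XX_def by (simp add: hol2_on_iff)

lemma O_minus_Delta_iff:
  "open W \<Longrightarrow> F \<in> O_minus_Delta A W \<longleftrightarrow>
    (\<forall>p\<in>W. hol2_at A F p) \<and> (\<forall>p. p \<notin> W \<longrightarrow> F p = 0) \<and> (\<forall>x. F (x, x) = 0)"
  unfolding O_minus_Delta_def by (simp add: O_XX_iff)

lemma O_plus_Delta_iff:
  assumes "open W"
  shows "F \<in> O_plus_Delta A W \<longleftrightarrow>
    (\<forall>p\<in>W - Id. hol2_at A F p) \<and> (\<forall>p. p \<notin> W - Id \<longrightarrow> F p = 0) \<and>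
    (\<forall>U z. (U, z) \<in> A \<longrightarrow> (\<exists>H. polar_numerator A W F U z H))"
proof -
  have "hol2_on A (W \<inter> U \<times> U) H \<longleftrightarrow> (\<forall>p\<in>W \<inter> U \<times> U. hol2_at A H p)" if "(U, z) \<in> A" for U z H
    using that assms is_chartD(1)[OF chart] by (intro hol2_on_iff open_Int open_Times) auto
  then have "(\<forall>U z. (U, z) \<in> A \<longrightarrow> (\<exists>H. hol2_on A (W \<inter> U \<times> U) H \<and>
      (\<forall>x y. (x, y) \<in> W \<inter> U \<times> U \<and> x \<noteq> y \<longrightarrow> H (x, y) = (z y - z x) * F (x, y)))) \<longleftrightarrow>
    (\<forall>U z. (U, z) \<in> A \<longrightarrow> (\<exists>H. polar_numerator A W F U z H))"
    unfolding polar_numerator_def by (intro all_cong1 imp_cong refl ex_cong1 conj_cong) fast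
  moreover have "(\<forall>(U, z)\<in>A. P U z) \<longleftrightarrow> (\<forall>U z. (U, z) \<in> A \<longrightarrow> P U z)" for P
    by auto
  ultimately show ?thesis
    unfolding O_plus_Delta_def mem_Collect_eq O_XX_iff[OF open_Diff_Id[OF assms]] by (simp only: conj_assoc)
qed

lemma O_plus_DeltaE:
  assumes "F \<in> O_plus_Delta A W" "open W" "(U, z) \<in> A"
  obtains H where "polar_numerator A W F U z H"
  using assms(1)[unfolded O_plus_Delta_iff[OF assms(2)], THEN conjunct2, THEN conjunct2, rule_format, OF assms(3)]
  by (elim exE) (rule that)

text \<open>Division by the equation \<open>z\<^sub>2 - z\<^sub>1\<close> of the diagonal, possible because divided differences in the chart are
  holomorphic.\<close>

lemma surface_divided_difference:
  assumes c: "(U, z) \<in> A" and M: "open M" "M \<subseteq> U" and H: "\<And>p. p \<in> M \<times> M \<Longrightarrow> hol2_at A H p"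
  obtains Q where "\<forall>p\<in>M \<times> M. hol2_at A Q p"
    "\<forall>x\<in>M. \<forall>y\<in>M. H (x, y) = H (x, x) + (z y - z x) * Q (x, y)"
proof -
  let ?i = "map_prod (inv_into U z) (inv_into U z)"
  define S where "S = z ` M"
  have S: "open S"
    using open_chart_image[OF chart[OF c] M(1)] M(2) by (simp add: S_def Int_absorb1)
  note inv = is_chartD(5)[OF chart[OF c]]
  have Hc: "cdiff2 (H \<circ> ?i) p" if "p \<in> S \<times> S" for p
  proof -
    obtain u v where "p = (u, v)" by (cases p)
    with that obtain x y where p: "p = (z x, z y)" "x \<in> M" "y \<in> M"
      unfolding S_def by blast
    then have "x \<in> U" "y \<in> U" "hol2_at A H (x, y)"
      using M H[of "(x, y)"] by blast+
    then show ?thesis unfolding p(1) by (intro hol2_atD c)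
  qed
  define Q where "Q = divided_difference (H \<circ> ?i) \<circ> map_prod z z"
  have Q: "hol2_at A Q (x, y)" if xy: "x \<in> M" "y \<in> M" for x y
  proof (rule hol2_atI[OF c c])
    show "x \<in> U" "y \<in> U" using M xy by auto
    show "cdiff2 (Q \<circ> ?i) (z x, z y)"
    proof (rule cdiff2_transform)
      show "cdiff2 (divided_difference (H \<circ> ?i)) (z x, z y)"
        by (rule cdiff2_divided_difference[OF S Hc]) (use xy in \<open>auto simp: S_def\<close>)
      have "\<forall>\<^sub>F q in nhds (z x, z y). q \<in> S \<times> S"
        by (rule eventually_nhds_in_open) (use S xy in \<open>auto simp: S_def intro!: open_Times\<close>)
      then show "\<forall>\<^sub>F q in nhds (z x, z y). divided_difference (H \<circ> ?i) q = (Q \<circ> ?i) q"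
        by eventually_elim (use M(2) inv in \<open>auto simp: Q_def S_def subset_iff\<close>)
    qed
  qed
  have eq: "H (x, y) = H (x, x) + (z y - z x) * Q (x, y)" if "x \<in> M" "y \<in> M" for x y
  proof -
    have "x \<in> U" "y \<in> U" using that M by auto
    then show ?thesis
      using divided_difference_eq[of "H \<circ> ?i" "z x" "z y"] inv by (simp add: Q_def)
  qed
  show ?thesis
  proof (rule that[of Q])
    show "\<forall>p\<in>M \<times> M. hol2_at A Q p" using Q by auto
    show "\<forall>x\<in>M. \<forall>y\<in>M. H (x, y) = H (x, x) + (z y - z x) * Q (x, y)" using eq by blast
  qed
qed

lemma polar_local_form:
  assumes N: "open N" "(x, x) \<in> N" and F: "F \<in> O_plus_Delta A N" and c: "(U, z) \<in> A" "x \<in> U"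
  obtains M a Q where "x \<in> M" "M \<times> M \<subseteq> N" "polar_local_form A U z F M a Q"
proof -
  obtain H where H: "polar_numerator A N F U z H"
    by (rule O_plus_DeltaE[OF F N(1) c(1)])
  have "open (N \<inter> U \<times> U)" using N is_chartD(1)[OF chart[OF c(1)]] by (intro open_Int open_Times)
  then obtain M1 M2 where M12: "open M1" "open M2" "(x, x) \<in> M1 \<times> M2" "M1 \<times> M2 \<subseteq> N \<inter> U \<times> U"
    using N c by (elim open_prod_elim) auto
  define M where "M = M1 \<inter> M2"
  have M: "open M" "x \<in> M" "M \<times> M \<subseteq> N \<inter> U \<times> U" "M \<subseteq> U"
    using M12 by (auto simp: M_def)
  have hol: "hol2_at A H p" if "p \<in> M \<times> M" for p
    using H[unfolded polar_numerator_def, THEN conjunct1] subsetD[OF M(3) that] by (rule bspec)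
  obtain Q where Q: "\<forall>p\<in>M \<times> M. hol2_at A Q p"
    "\<forall>x\<in>M. \<forall>y\<in>M. H (x, y) = H (x, x) + (z y - z x) * Q (x, y)"
    by (rule surface_divided_difference[OF c(1) M(1,4) hol])
  have "F (x, y) = H (x, x) / (z y - z x) + Q (x, y)" if "x \<in> M" "y \<in> M" "x \<noteq> y" for x y
  proof -
    have "(x, y) \<in> N \<inter> U \<times> U" using M(3) that by blast
    then have "(z y - z x) * F (x, y) = H (x, x) + (z y - z x) * Q (x, y)"
      using H[unfolded polar_numerator_def, THEN conjunct2, rule_format, of x y] that
        Q(2)[rule_format, OF that(1,2)] by simp
    moreover have "z y - z x \<noteq> 0"
      using is_chartD(6)[OF chart[OF c(1)]] M(4) that by (auto dest: inj_onD)
    ultimately show ?thesis by (simp add: field_simps)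
  qed
  moreover have "hol_at A (\<lambda>y. H (y, y)) y" if "y \<in> M" for y
    using that by (intro hol_at_diagonal hol) blast
  ultimately have "polar_local_form A U z F M (\<lambda>y. H (y, y)) Q"
    unfolding polar_local_form_def using M Q(1) by blast
  then show ?thesis using M that by blast
qed

lemma polar_local_form_jet:
  assumes "polar_local_form A U z F M a Q" "x \<in> M"
  shows "polar_jet z F x (a x) (Q (x, x))"
proof -
  have "((\<lambda>y. Q (x, y)) \<longlongrightarrow> Q (x, x)) (at x)"
    using hol_at_isCont[OF hol_at_slice[of Q x x]] assms by (auto simp: polar_local_form_def isCont_def)
  moreover have "\<forall>\<^sub>F y in at x. Q (x, y) = F (x, y) - a x / (z y - z x)"
    using eventually_nhds_in_open[of M x] assms unfolding eventually_at_filter polar_local_form_def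
    by (auto elim!: eventually_mono)
  ultimately show ?thesis unfolding polar_jet_def by (rule Lim_transform_eventually)
qed

lemma polar_jet_exists:
  assumes "open N" "(x, x) \<in> N" "F \<in> O_plus_Delta A N" "(U, z) \<in> A" "x \<in> U"
  obtains a b where "polar_jet z F x a b"
  using polar_local_form[OF assms] polar_local_form_jet by metis

section \<open>Stalks of the quotient\<close>

abbreviation stalk where "stalk \<equiv> stalk_rel (O_plus_Delta A) (O_minus_Delta A)"

lemma stalkI:
  assumes "open N" "p \<in> N" "F \<in> O_plus_Delta A N" "open N'" "p \<in> N'" "F' \<in> O_plus_Delta A N'"
    "open M" "p \<in> M" "M \<subseteq> N \<inter> N'" "restr M (\<lambda>q. F q - F' q) \<in> O_minus_Delta A M"
  shows "((N, F), (N', F')) \<in> stalk p"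
  using assms unfolding stalk_rel_def by blast

lemma O_minus_Delta_zero: "open M \<Longrightarrow> (\<lambda>_. 0) \<in> O_minus_Delta A M"
proof -
  have "hol2_at A (\<lambda>_. 0) p" for p
    using hol2_at_fst[OF hol_at_const[of 0]] by (cases p) auto
  then show "open M \<Longrightarrow> (\<lambda>_. 0) \<in> O_minus_Delta A M" by (simp add: O_minus_Delta_iff)
qed

lemma hol2_at_restr: "hol2_at A F p \<Longrightarrow> open M \<Longrightarrow> p \<in> M \<Longrightarrow> hol2_at A (restr M F) p"
  by (rule hol2_at_cong[of F]) (auto simp: restr_def elim!: eventually_mono[OF eventually_nhds_in_open])

lemma stalk_refl:
  assumes "open N" "p \<in> N" "F \<in> O_plus_Delta A N"
  shows "((N, F), (N, F)) \<in> stalk p"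
  by (rule stalkI[OF assms assms assms(1,2)]) (simp_all add: O_minus_Delta_zero assms restr_def)

lemma stalk_sym:
  assumes "((N, F), (N', F')) \<in> stalk p"
  shows "((N', F'), (N, F)) \<in> stalk p"
proof -
  obtain M where *: "open N" "p \<in> N" "F \<in> O_plus_Delta A N" "open N'" "p \<in> N'" "F' \<in> O_plus_Delta A N'"
    and M: "open M" "p \<in> M" "M \<subseteq> N \<inter> N'" "restr M (\<lambda>q. F q - F' q) \<in> O_minus_Delta A M"
    using assms unfolding stalk_rel_def by blast
  have zero: "hol2_at A (\<lambda>_. 0) q" for q
    using O_minus_Delta_zero[of UNIV] unfolding O_minus_Delta_iff[OF open_UNIV] by blast
  have "restr M (\<lambda>q. F' q - F q) = (\<lambda>q. 0 - restr M (\<lambda>q. F q - F' q) q)"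
    by (auto simp: restr_def)
  then have "restr M (\<lambda>q. F' q - F q) \<in> O_minus_Delta A M"
    using M(4) hol2_at_diff[OF zero] by (simp add: O_minus_Delta_iff[OF M(1)])
  then show ?thesis
    using M(3) by (intro stalkI[OF *(4-6) *(1-3) M(1,2)]) auto
qed

lemma stalk_trans:
  assumes "((N, F), (N', F')) \<in> stalk p" "((N', F'), (N'', F'')) \<in> stalk p"
  shows "((N, F), (N'', F'')) \<in> stalk p"
proof -
  obtain M where *: "open N" "p \<in> N" "F \<in> O_plus_Delta A N"
    and M: "open M" "p \<in> M" "M \<subseteq> N \<inter> N'" "restr M (\<lambda>q. F q - F' q) \<in> O_minus_Delta A M"
    using assms(1) unfolding stalk_rel_def by blast
  obtain M' where **: "open N''" "p \<in> N''" "F'' \<in> O_plus_Delta A N''"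
    and M': "open M'" "p \<in> M'" "M' \<subseteq> N' \<inter> N''" "restr M' (\<lambda>q. F' q - F'' q) \<in> O_minus_Delta A M'"
    using assms(2) unfolding stalk_rel_def by blast
  let ?D = "restr (M \<inter> M') (\<lambda>q. F q - F'' q)"
  have D: "?D = restr (M \<inter> M') (\<lambda>q. restr M (\<lambda>q. F q - F' q) q + restr M' (\<lambda>q. F' q - F'' q) q)"
    by (auto simp: restr_def)
  have "hol2_at A ?D q" if "q \<in> M \<inter> M'" for q
  proof -
    have "hol2_at A (restr M (\<lambda>q. F q - F' q)) q" "hol2_at A (restr M' (\<lambda>q. F' q - F'' q)) q"
      using M(4) M'(4) that unfolding O_minus_Delta_iff[OF M(1)] O_minus_Delta_iff[OF M'(1)] by blast+
    from hol2_at_restr[OF hol2_at_add[OF this] open_Int[OF M(1) M'(1)] that] show ?thesis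
      unfolding D .
  qed
  moreover have "?D (x, x) = 0" for x
  proof -
    have "restr M (\<lambda>q. F q - F' q) (x, x) = 0" "restr M' (\<lambda>q. F' q - F'' q) (x, x) = 0"
      using M(4) M'(4) unfolding O_minus_Delta_iff[OF M(1)] O_minus_Delta_iff[OF M'(1)] by blast+
    then show ?thesis unfolding D by (simp add: restr_def[of "M \<inter> M'"])
  qed
  moreover have "?D q = 0" if "q \<notin> M \<inter> M'" for q
    using that unfolding restr_def by (rule if_not_P)
  ultimately have "?D \<in> O_minus_Delta A (M \<inter> M')"
    unfolding O_minus_Delta_iff[OF open_Int[OF M(1) M'(1)]] by blast
  then show ?thesis
    using M M' by (intro stalkI[OF * **, of "M \<inter> M'"]) auto
qed

lemma stalk_class_eq:
  assumes "((N, F), (N', F')) \<in> stalk p"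
  shows "stalk p `` {(N, F)} = stalk p `` {(N', F')}"
proof (rule set_eqI)
  fix q :: "('a \<times> 'a) local_function"
  obtain K G where q: "q = (K, G)" by (cases q)
  show "q \<in> stalk p `` {(N, F)} \<longleftrightarrow> q \<in> stalk p `` {(N', F')}"
    unfolding q using stalk_trans[OF assms] stalk_trans[OF stalk_sym[OF assms]] by blast
qed

text \<open>Away from the diagonal both sheaves are the structure sheaf, so the quotient vanishes there.\<close>

lemma stalk_off_diagonal:
  assumes "x \<noteq> y" "open N" "(x, y) \<in> N" "F \<in> O_plus_Delta A N"
    "open N'" "(x, y) \<in> N'" "F' \<in> O_plus_Delta A N'"
  shows "((N, F), (N', F')) \<in> stalk (x, y)"
proof (rule stalkI[OF assms(2-7)])
  let ?M = "N \<inter> N' - Id"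
  show M: "open ?M" using assms by (intro open_Diff_Id open_Int)
  show "(x, y) \<in> ?M" "?M \<subseteq> N \<inter> N'" using assms by auto
  have "hol2_at A (restr ?M (\<lambda>q. F q - F' q)) q" if "q \<in> ?M" for q
    using assms that M
    by (intro hol2_at_restr hol2_at_diff) (auto simp: O_plus_Delta_iff)
  then show "restr ?M (\<lambda>q. F q - F' q) \<in> O_minus_Delta A ?M"
    unfolding O_minus_Delta_iff[OF M] by (simp add: restr_def)
qed

lemma stalk_polar_jet:
  assumes "((N, F), (N', F')) \<in> stalk (x, x)"
  obtains M where "open M" "x \<in> M" "M \<subseteq> diag_vimage (N \<inter> N')"
    "\<And>y z a b. y \<in> M \<Longrightarrow> polar_jet z F y a b \<longleftrightarrow> polar_jet z F' y a b"
proof -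
  obtain M where M: "open M" "(x, x) \<in> M" "M \<subseteq> N \<inter> N'" "restr M (\<lambda>q. F q - F' q) \<in> O_minus_Delta A M"
    using assms unfolding stalk_rel_def by blast
  obtain M1 M2 where M12: "open M1" "open M2" "(x, x) \<in> M1 \<times> M2" "M1 \<times> M2 \<subseteq> M"
    using M by (elim open_prod_elim) auto
  have *: "((\<lambda>t. F (y, t) - F' (y, t)) \<longlongrightarrow> 0) (at y)" if y: "y \<in> M1 \<inter> M2" for y
  proof -
    let ?G = "restr M (\<lambda>q. F q - F' q)"
    have "hol2_at A ?G (y, y)" "?G (y, y) = 0"
      using M M12 y by (auto simp: O_minus_Delta_iff)
    then have "((\<lambda>t. ?G (y, t)) \<longlongrightarrow> 0) (at y)"
      using hol_at_isCont[OF hol_at_slice[of ?G y y]] by (simp add: isCont_def)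
    moreover have "\<forall>\<^sub>F t in at y. ?G (y, t) = F (y, t) - F' (y, t)"
    proof -
      have "\<forall>\<^sub>F t in nhds y. t \<in> M2" using M12 y by (intro eventually_nhds_in_open) auto
      then show ?thesis unfolding eventually_at_filter
        by eventually_elim (use y M12 in \<open>auto simp: restr_def\<close>)
    qed
    ultimately show ?thesis by (rule Lim_transform_eventually)
  qed
  have "((\<lambda>t. F' (y, t) - F (y, t)) \<longlongrightarrow> 0) (at y)" if "y \<in> M1 \<inter> M2" for y
    using tendsto_minus[OF *[OF that]] by simp
  then have "polar_jet z F y a b \<longleftrightarrow> polar_jet z F' y a b" if "y \<in> M1 \<inter> M2" for y z a b
    using * that polar_jet_perturb by blast
  moreover have "M1 \<inter> M2 \<subseteq> diag_vimage (N \<inter> N')"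
    using M12 M by (auto simp: diag_vimage_def)
  ultimately show ?thesis
    using that[of "M1 \<inter> M2"] M12 by auto
qed

text \<open>If the jets of \<open>F\<close> and \<open>F'\<close> agree at all nearby diagonal points, then in the local expansions the
  polar parts cancel and the holomorphic remainders agree on the diagonal.\<close>

lemma stalk_of_polar_jet:
  assumes N: "open N" "(x, x) \<in> N" "F \<in> O_plus_Delta A N"
    and N': "open N'" "(x, x) \<in> N'" "F' \<in> O_plus_Delta A N'"
    and c: "(U, z) \<in> A" "x \<in> U" and M0: "open M0" "x \<in> M0"
    and jets: "\<And>y a b a' b'. y \<in> M0 \<Longrightarrow> y \<in> U \<Longrightarrow> polar_jet z F y a b \<Longrightarrow> polar_jet z F' y a' b' \<Longrightarrow> a = a' \<and> b = b'"
  shows "((N, F), (N', F')) \<in> stalk (x, x)"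
proof -
  obtain M1 a Q where 1: "x \<in> M1" "M1 \<times> M1 \<subseteq> N" "polar_local_form A U z F M1 a Q"
    by (rule polar_local_form[OF N c])
  obtain M2 a' Q' where 2: "x \<in> M2" "M2 \<times> M2 \<subseteq> N'" "polar_local_form A U z F' M2 a' Q'"
    by (rule polar_local_form[OF N' c])
  define M where "M = M0 \<inter> M1 \<inter> M2"
  have M: "open M" "x \<in> M" using 1 2 M0 by (auto simp: M_def polar_local_form_def)
  have eq: "a y = a' y" "Q (y, y) = Q' (y, y)" if "y \<in> M" for y
    using jets[of y, OF _ _ polar_local_form_jet[OF 1(3)] polar_local_form_jet[OF 2(3)]] that 1(3)
    by (auto simp: M_def polar_local_form_def)
  let ?D = "restr (M \<times> M) (\<lambda>q. F q - F' q)"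
  have D: "?D q = Q q - Q' q" if q: "q \<in> M \<times> M" for q
  proof (cases q)
    case (Pair y y')
    have yM: "y \<in> M" "y' \<in> M" using q Pair by auto
    show ?thesis
    proof (cases "y = y'")
      case True
      have "F (y, y) = 0" "F' (y, y) = 0"
        using N(1,3) N'(1,3) by (auto simp: O_plus_Delta_iff)
      then show ?thesis using eq(2)[OF yM(1)] True Pair q by (simp add: restr_def)
    next
      case False
      have "F (y, y') = a y / (z y' - z y) + Q (y, y')" "F' (y, y') = a' y / (z y' - z y) + Q' (y, y')"
        using 1(3) 2(3) yM False by (auto simp: polar_local_form_def M_def)
      then show ?thesis using eq(1)[OF yM(1)] Pair q by (simp add: restr_def)
    qed
  qed
  have MM: "open (M \<times> M)" using M by (intro open_Times)
  have "hol2_at A ?D q" if q: "q \<in> M \<times> M" for q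
  proof (rule hol2_at_cong)
    show "hol2_at A (\<lambda>q. Q q - Q' q) q"
      using q 1(3) 2(3) by (intro hol2_at_diff) (auto simp: polar_local_form_def M_def)
    show "\<forall>\<^sub>F q in nhds q. Q q - Q' q = ?D q"
      using eventually_nhds_in_open[OF MM q] by eventually_elim (simp add: D)
  qed
  moreover have "?D (y, y) = 0" for y
    using N(1,3) N'(1,3) by (auto simp: O_plus_Delta_iff restr_def)
  ultimately have "?D \<in> O_minus_Delta A (M \<times> M)"
    unfolding O_minus_Delta_iff[OF MM] by (auto simp: restr_def)
  then show ?thesis
    using M 1 2 by (intro stalkI[OF N N' MM]) (auto simp: M_def)
qed

lemma O_plus_Delta_add:
  assumes "open N" "F \<in> O_plus_Delta A N" "open N'" "F' \<in> O_plus_Delta A N'"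
  shows "restr (N \<inter> N') (\<lambda>q. F q + F' q) \<in> O_plus_Delta A (N \<inter> N')"
proof -
  let ?N = "N \<inter> N'" and ?G = "restr (N \<inter> N') (\<lambda>q. F q + F' q)"
  have N: "open ?N" using assms by auto
  show ?thesis
    unfolding O_plus_Delta_iff[OF N]
  proof (intro conjI ballI allI impI)
    fix p assume "p \<in> ?N - Id"
    then show "hol2_at A ?G p"
      using assms N by (intro hol2_at_restr hol2_at_add) (auto simp: O_plus_Delta_iff)
  next
    fix p assume "p \<notin> ?N - Id"
    then show "?G p = 0"
      using assms by (auto simp: O_plus_Delta_iff restr_def)
  next
    fix U z assume c: "(U, z) \<in> A"
    obtain H where H: "polar_numerator A N F U z H" by (rule O_plus_DeltaE[OF assms(2,1) c])
    obtain H' where H': "polar_numerator A N' F' U z H'" by (rule O_plus_DeltaE[OF assms(4,3) c])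
    show "\<exists>K. polar_numerator A ?N ?G U z K"
      using H H' unfolding polar_numerator_def
      by (intro exI[of _ "\<lambda>p. H p + H' p"]) (auto simp: restr_def distrib_left intro!: hol2_at_add)
  qed
qed

lemma O_plus_Delta_scale:
  assumes "open N" "F \<in> O_plus_Delta A N" "open W" "\<And>p. p \<in> W \<Longrightarrow> hol2_at A h p"
  shows "restr (N \<inter> W) (\<lambda>q. h q * F q) \<in> O_plus_Delta A (N \<inter> W)"
proof -
  let ?N = "N \<inter> W" and ?G = "restr (N \<inter> W) (\<lambda>q. h q * F q)"
  have N: "open ?N" using assms by auto
  show ?thesis
    unfolding O_plus_Delta_iff[OF N]
  proof (intro conjI ballI allI impI)
    fix p assume "p \<in> ?N - Id"
    then show "hol2_at A ?G p"
      using assms N by (intro hol2_at_restr hol2_at_mult) (auto simp: O_plus_Delta_iff)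
  next
    fix p assume "p \<notin> ?N - Id"
    then show "?G p = 0"
      using assms(2) by (auto simp: O_plus_Delta_iff[OF assms(1)] restr_def)
  next
    fix U z assume c: "(U, z) \<in> A"
    obtain H where H: "polar_numerator A N F U z H" by (rule O_plus_DeltaE[OF assms(2,1) c])
    show "\<exists>K. polar_numerator A ?N ?G U z K"
      using H assms(4) unfolding polar_numerator_def
      by (intro exI[of _ "\<lambda>p. h p * H p"]) (auto simp: restr_def intro!: hol2_at_mult)
  qed
qed

text \<open>The pole condition has to hold in every chart of the atlas.  For another parameter \<open>z'\<close> the quotient
  \<open>(z'\<^sub>2 - z'\<^sub>1) / (z\<^sub>2 - z\<^sub>1)\<close> is holomorphic across the diagonal, again by division.\<close>

lemma O_plus_Delta_polar_part:
  assumes c: "(U, z) \<in> A" and M: "open M" "M \<subseteq> U"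
    and a: "\<And>x. x \<in> M \<Longrightarrow> hol_at A a x" and b: "\<And>x. x \<in> M \<Longrightarrow> hol_at A b x"
  shows "restr (M \<times> M - Id) (\<lambda>(p, q). a p / (z q - z p) + b p) \<in> O_plus_Delta A (M \<times> M)"
proof -
  let ?F = "restr (M \<times> M - Id) (\<lambda>(p, q). a p / (z q - z p) + b p)"
  have MM: "open (M \<times> M)" using M by (intro open_Times)
  have lifts: "hol2_at A (\<lambda>q. f (fst q)) (x, y)" "hol2_at A (\<lambda>q. f (snd q) - f (fst q)) (x, y)"
    if "hol_at A f x" "hol_at A f y" for f x y
    using hol2_at_fst[OF that(1)] hol2_at_diff[OF hol2_at_snd[OF that(2)] hol2_at_fst[OF that(1)]]
    by simp_all
  have off: "hol2_at A ?F (x, y)" if "x \<in> M" "y \<in> M" "x \<noteq> y" for x y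
  proof -
    have ne: "z y - z x \<noteq> 0" using is_chartD(6)[OF chart[OF c]] M that by (auto dest: inj_onD)
    have "hol2_at A (\<lambda>u. a (fst u) / (z (snd u) - z (fst u)) + b (fst u)) (x, y)"
      using that M a b hol_at_chart[OF c] ne by (intro hol2_at_add hol2_at_divide lifts) auto
    from hol2_at_restr[OF this open_Diff_Id[OF MM]] show ?thesis
      using that by (simp add: case_prod_unfold)
  qed
  show ?thesis
    unfolding O_plus_Delta_iff[OF MM]
  proof (intro conjI ballI allI impI)
    show "hol2_at A ?F p" if "p \<in> M \<times> M - Id" for p using off that by (cases p) auto
    show "?F p = 0" if "p \<notin> M \<times> M - Id" for p
      using that unfolding restr_def by (rule if_not_P)
    fix U' z' assume c': "(U', z') \<in> A"
    let ?S = "M \<inter> U'"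
    have S: "open ?S" "?S \<subseteq> U" using M is_chartD(1)[OF chart[OF c']] by auto
    have hol: "hol2_at A (\<lambda>u. z' (snd u)) p" if "p \<in> ?S \<times> ?S" for p
      using that by (cases p) (auto intro!: hol2_at_snd hol_at_chart[OF c'])
    obtain Q where Q: "\<forall>p\<in>?S \<times> ?S. hol2_at A Q p"
      "\<forall>x\<in>?S. \<forall>y\<in>?S. z' (snd (x, y)) = z' (snd (x, x)) + (z y - z x) * Q (x, y)"
      by (rule surface_divided_difference[OF c S hol])
    let ?H = "\<lambda>u. a (fst u) * Q u + b (fst u) * (z' (snd u) - z' (fst u))"
    show "\<exists>H. polar_numerator A (M \<times> M) ?F U' z' H"
      unfolding polar_numerator_def
    proof (intro exI[of _ ?H] conjI ballI allI impI)
      fix p assume "p \<in> M \<times> M \<inter> U' \<times> U'"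
      then obtain x y where p: "p = (x, y)" "x \<in> ?S" "y \<in> ?S" by auto
      show "hol2_at A ?H p"
        unfolding p(1) using p a b hol_at_chart[OF c'] Q(1)
        by (intro hol2_at_add hol2_at_mult lifts) auto
    next
      fix x y assume xy: "(x, y) \<in> M \<times> M \<inter> U' \<times> U' \<and> x \<noteq> y"
      then have ne: "z y - z x \<noteq> 0" using is_chartD(6)[OF chart[OF c]] M by (auto dest: inj_onD)
      have "z' y = z' x + (z y - z x) * Q (x, y)" using Q(2)[rule_format, of x y] xy by simp
      then have "a x * Q (x, y) = (z' y - z' x) * (a x / (z y - z x))"
        using ne by simp
      then show "?H (x, y) = (z' y - z' x) * ?F (x, y)"
        using xy by (simp add: restr_def algebra_simps)
    qed
  qed
qed

lemma polar_part_jet: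
  assumes "(U, z) \<in> A" "open M" "x \<in> M"
  shows "polar_jet z (restr (M \<times> M - Id) (\<lambda>(p, q). a p / (z q - z p) + b p)) x (a x) (b x)"
  unfolding polar_jet_def
proof (rule tendsto_eventually)
  show "\<forall>\<^sub>F y in at x. restr (M \<times> M - Id) (\<lambda>(p, q). a p / (z q - z p) + b p) (x, y) - a x / (z y - z x) = b x"
    using eventually_nhds_in_open[OF assms(2,3)] unfolding eventually_at_filter
    by eventually_elim (use assms in \<open>auto simp: restr_def\<close>)
qed

end

context holomorphic_atlas
begin

section \<open>The twisted derivative\<close>

text \<open>The modulus attains its maximum; the set where the maximal value is taken is closed, and open by
  the maximum principle.\<close>

lemma holomorphic_constant:
  assumes "compact (UNIV :: 'a set)" and h: "\<And>x. hol_at A h x"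
  obtains k where "\<And>x. h x = k"
proof -
  have cont: "continuous_on UNIV h"
    using hol_at_isCont[OF h] by (simp add: continuous_at_imp_continuous_on)
  then have "continuous_on UNIV (\<lambda>x. norm (h x))" by (intro continuous_intros)
  from continuous_attains_sup[OF assms(1) UNIV_not_empty this]
  obtain x0 where x0: "\<And>x. norm (h x) \<le> norm (h x0)" by auto
  define S where "S = {x. h x = h x0}"
  have "closed S"
    unfolding S_def using cont by (intro closed_Collect_eq) simp_all
  moreover have "open S"
  proof (subst open_subopen, intro ballI)
    fix x assume x: "x \<in> S"
    obtain U z where Uz: "(U, z) \<in> A" "x \<in> U" by (rule chart_around)
    note c = chart[OF Uz(1)] Uz(2)
    note inv = is_chartD(5)[OF c(1)]
    obtain r where r: "0 < r" "ball (z x) r \<subseteq> z ` U"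
      using is_chartD(2)[OF c(1)] c(2) by (meson imageI open_contains_ball)
    have "hol_on A UNIV h" using h by (simp add: hol_on_iff)
    then have "(h \<circ> inv_into U z) holomorphic_on z ` U"
      using Uz(1) unfolding hol_on_def by fastforce
    then have hol: "(h \<circ> inv_into U z) holomorphic_on ball (z x) r"
      using r(2) by (rule holomorphic_on_subset)
    have hx: "h (inv_into U z (z x)) = h x0" using x inv[OF c(2)] by (simp add: S_def)
    have "(h \<circ> inv_into U z) constant_on ball (z x) r"
      by (rule maximum_modulus_principle[OF hol open_ball connected_ball open_ball order_refl, of "z x"])
        (use r x0 hx in auto)
    then obtain k where k: "\<And>u. u \<in> ball (z x) r \<Longrightarrow> h (inv_into U z u) = k"
      unfolding constant_on_def by auto
    have kx: "k = h x0" using k[of "z x"] r(1) hx by simp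
    let ?T = "U \<inter> z -` ball (z x) r"
    have "open ?T"
      using is_chartD(3)[OF c(1)] is_chartD(1)[OF c(1)] open_ball by (rule continuous_open_preimage)
    moreover have "x \<in> ?T" using c(2) r(1) by simp
    moreover have "?T \<subseteq> S" using k kx inv by (auto simp: S_def) metis
    ultimately show "\<exists>T. open T \<and> x \<in> T \<and> T \<subseteq> S" by blast
  qed
  moreover have "connected (UNIV :: 'a set)"
    using riemann unfolding riemann_surface_def by blast
  moreover have "x0 \<in> S" by (simp add: S_def)
  ultimately have "S = UNIV"
    by (auto simp: connected_clopen)
  then show ?thesis using that[of "h x0"] by (auto simp: S_def)
qed

text \<open>If \<open>e\<close> is a frame of \<open>\<Omega>\<^sup>1\<^sup>/\<^sup>2\<close> with \<open>e \<otimes> e = c dz\<close>, then formally \<open>e = c\<^sup>1\<^sup>/\<^sup>2 dz\<^sup>1\<^sup>/\<^sup>2\<close>, and this is the coefficient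
  with respect to \<open>e\<close> of the operator \<open>f dz\<^sup>1\<^sup>/\<^sup>2 \<mapsto> (a f' + b f) dz\<^sup>1\<^sup>/\<^sup>2\<close> applied to \<open>s e\<close>.  Square roots cancel, and
  only the logarithmic derivative of \<open>c\<close> enters.\<close>

definition twisted_derivative ::
  "'a set \<Rightarrow> ('a \<Rightarrow> complex) \<Rightarrow> ('a \<Rightarrow> complex) \<Rightarrow> complex \<Rightarrow> complex \<Rightarrow> ('a \<Rightarrow> complex) \<Rightarrow> 'a \<Rightarrow> complex" where
  "twisted_derivative U z c a b s x =
     a * param_deriv U z s x + (a * param_deriv U z c x / (2 * c x) + b) * s x"

text \<open>A simultaneous change of frame by the factor \<open>t\<close> and of parameter from \<open>w\<close> to \<open>z\<close>.  The logarithmic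
  derivative of \<open>t\<^sup>2 r = k z'\<close> gives \<open>r'/(2r) = k'/(2k) + z''/(2z') - t'/t\<close>: the term \<open>t'/t\<close> cancels against
  the derivative of \<open>s = t f\<close>, and \<open>z''/(2z')\<close> is exactly the correction that the polar jet acquires.\<close>

lemma twisted_derivative_change:
  assumes c: "(V, w) \<in> A" "x \<in> V"
    and z: "\<forall>\<^sub>F y in nhds x. hol_at A z y" "param_deriv V w z x \<noteq> 0"
    and hol: "hol_at A t x" "hol_at A f x" "hol_at A r x" "hol_at A k x"
    and s: "\<forall>\<^sub>F y in nhds x. s y = t y * f y"
    and k: "\<forall>\<^sub>F y in nhds x. t y * t y * r y = k y * param_deriv V w z y"
    and ne: "t x \<noteq> 0" "r x \<noteq> 0"
  shows "twisted_derivative V w r a b s x =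
    t x * (a * param_deriv V w f x + (a * param_deriv V w k x / (2 * k x) +
      (b + a * param_deriv V w (param_deriv V w z) x / (2 * param_deriv V w z x))) * f x)"
proof -
  define D where "D = (\<lambda>f. param_deriv V w f x)"
  have sx: "s x = t x * f x" using eventually_nhds_x_imp_x[OF s] .
  have kx: "t x * t x * r x = k x * D z"
    using eventually_nhds_x_imp_x[OF k] by (simp add: D_def)
  have Ds: "D s = D t * f x + t x * D f"
    using param_deriv_cong[OF c s] param_deriv_mult[OF hol(1,2) c] by (simp add: D_def)
  have "D (\<lambda>y. t y * t y * r y) = D (\<lambda>y. k y * param_deriv V w z y)"
    using param_deriv_cong[OF c k] by (simp add: D_def)
  then have Dk: "2 * t x * D t * r x + t x * t x * D r = D k * D z + k x * D (param_deriv V w z)"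
    using param_deriv_mult[OF hol_at_mult[OF hol(1,1)] hol(3) c] param_deriv_mult[OF hol(1,1) c]
      param_deriv_mult[OF hol(4) hol_at_param_deriv[OF c z(1)] c]
    by (simp add: D_def algebra_simps)
  have nz: "D z \<noteq> 0" "k x \<noteq> 0"
    using z(2) kx ne by (auto simp: D_def)
  have "D r / (2 * r x) = D k / (2 * k x) + D (param_deriv V w z) / (2 * D z) - D t / t x"
  proof -
    have "D r / (2 * r x) = (t x * t x * D r) / (2 * (t x * t x * r x))"
      using ne by (simp add: field_simps)
    also have "\<dots> = (D k * D z + k x * D (param_deriv V w z) - 2 * t x * D t * r x) / (2 * (t x * t x * r x))"
    proof -
      have "t x * t x * D r = D k * D z + k x * D (param_deriv V w z) - 2 * t x * D t * r x"
        using Dk by (simp add: eq_diff_eq add.commute)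
      then show ?thesis by (simp only:)
    qed
    also have "\<dots> = (D k * D z + k x * D (param_deriv V w z)) / (2 * (k x * D z)) - D t / t x"
      using ne by (simp add: diff_divide_distrib kx[symmetric])
    also have "(D k * D z + k x * D (param_deriv V w z)) / (2 * (k x * D z))
        = D k / (2 * k x) + D (param_deriv V w z) / (2 * D z)"
      using nz by (simp add: field_simps)
    finally show ?thesis .
  qed
  then have "a * D s + (a * D r / (2 * r x) + b) * s x
      = a * (D t * f x + t x * D f) + (a * (D k / (2 * k x) + D (param_deriv V w z) / (2 * D z) - D t / t x) + b) * (t x * f x)"
    unfolding sx Ds by (metis times_divide_eq_right)
  also have "\<dots> = t x * (a * D f + (a * D k / (2 * k x) + (b + a * D (param_deriv V w z) / (2 * D z))) * f x)"
    using ne(1) by (simp add: algebra_simps)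
  finally show ?thesis
    unfolding twisted_derivative_def D_def .
qed

lemma param_deriv_transition_nonzero:
  assumes "(U, z) \<in> A" "x \<in> U" "(V, w) \<in> A" "x \<in> V"
  shows "param_deriv V w z x \<noteq> 0"
proof
  assume "param_deriv V w z x = 0"
  moreover have "param_deriv V w w x = param_deriv U z w x * param_deriv V w z x"
    using param_deriv_chain[OF hol_at_chart[OF assms(3,4)] assms] .
  ultimately show False using param_deriv_self[OF assms(3,4)] by simp
qed

lemma hol_at_chart_eventually:
  assumes "(U, z) \<in> A" "x \<in> U"
  shows "\<forall>\<^sub>F y in nhds x. hol_at A z y"
  using eventually_in_chart(1)[OF chart[OF assms(1)] assms(2)]
  by eventually_elim (rule hol_at_chart[OF assms(1)])

section \<open>Sections of line bundles\<close>

lemma sections_iff: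
  assumes V: "open V" and op: "\<And>i. i \<in> idx L \<Longrightarrow> open (triv L i)"
  shows "s \<in> sections A L V \<longleftrightarrow>
     (\<forall>i x. i \<notin> idx L \<or> x \<notin> V \<inter> triv L i \<longrightarrow> s i x = 0) \<and>
     (\<forall>i\<in>idx L. \<forall>x\<in>V \<inter> triv L i. hol_at A (s i) x) \<and>
     (\<forall>i\<in>idx L. \<forall>j\<in>idx L. \<forall>x\<in>V \<inter> triv L i \<inter> triv L j. s i x = tf L i j x * s j x)"
  unfolding sections_def mem_Collect_eq using hol_on_iff[OF open_Int[OF V op]] by simp

lemma O_X_iff: "open V \<Longrightarrow> f \<in> O_X A V \<longleftrightarrow> (\<forall>x\<in>V. hol_at A f x) \<and> (\<forall>x. x \<notin> V \<longrightarrow> f x = 0)"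
  unfolding O_X_def by (simp add: hol_on_iff)

lemma canonical_bundle_simps:
  "idx (canonical_bundle A) = A" "triv (canonical_bundle A) = fst"
  "tf (canonical_bundle A) (U, z) (V, w) x = param_deriv U z w x"
  by (simp_all add: canonical_bundle_def param_deriv_def)

lemma canonical_sections_iff:
  assumes "open V"
  shows "s \<in> sections A (canonical_bundle A) V \<longleftrightarrow>
     (\<forall>c x. c \<notin> A \<or> x \<notin> V \<inter> fst c \<longrightarrow> s c x = 0) \<and>
     (\<forall>c\<in>A. \<forall>x\<in>V \<inter> fst c. hol_at A (s c) x) \<and>
     (\<forall>c\<in>A. \<forall>d\<in>A. \<forall>x\<in>V \<inter> fst c \<inter> fst d. s c x = param_deriv (fst c) (snd c) (snd d) x * s d x)"
proof -
  have "open (fst c)" if "c \<in> A" for c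
    using is_chartD(1)[OF chart[of "fst c" "snd c"]] that by simp
  moreover have "tf (canonical_bundle A) c d x = param_deriv (fst c) (snd c) (snd d) x" for c d x
    using canonical_bundle_simps(3)[of "fst c" "snd c" "fst d" "snd d"] by simp
  ultimately show ?thesis
    using sections_iff[OF assms, of "canonical_bundle A" s] by (simp add: canonical_bundle_simps)
qed

lemma differential_section:
  assumes c: "(U, z) \<in> A" and V: "open V" "V \<subseteq> U"
  shows "differential A V z \<in> sections A (canonical_bundle A) V"
proof -
  have eq: "differential A V z d x = param_deriv (fst d) (snd d) z x" if "d \<in> A" "x \<in> V \<inter> fst d" for d x
    using that by (cases d) (simp add: differential_def param_deriv_def)
  have zero: "differential A V z d x = 0" if "d \<notin> A \<or> x \<notin> V \<inter> fst d" for d x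
    using that by (cases d) (auto simp: differential_def)
  have "hol_at A (differential A V z d) x" if d: "d \<in> A" "x \<in> V \<inter> fst d" for d x
  proof (rule hol_at_cong)
    have d': "(fst d, snd d) \<in> A" using d by simp
    show "hol_at A (param_deriv (fst d) (snd d) z) x"
      using d V by (intro hol_at_param_deriv[OF d'] hol_at_chart_eventually[OF c]) auto
    have "open (V \<inter> fst d)" using V is_chartD(1)[OF chart[OF d']] by auto
    from eventually_nhds_in_open[OF this d(2)]
    show "\<forall>\<^sub>F y in nhds x. param_deriv (fst d) (snd d) z y = differential A V z d y"
      by eventually_elim (simp add: eq[OF d(1)])
  qed
  moreover have "differential A V z d x = param_deriv (fst d) (snd d) (snd e) x * differential A V z e x"
    if "d \<in> A" "e \<in> A" "x \<in> V \<inter> fst d \<inter> fst e" for d e x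
  proof -
    have "param_deriv (fst d) (snd d) z x = param_deriv (fst e) (snd e) z x * param_deriv (fst d) (snd d) (snd e) x"
      using that V by (intro param_deriv_chain[OF hol_at_chart[OF c]]) auto
    then show ?thesis using that by (simp add: eq)
  qed
  ultimately show ?thesis
    unfolding canonical_sections_iff[OF V(1)] using zero by blast
qed

end

text \<open>The data of an isomorphism \<open>L \<otimes> L \<simeq> \<Omega>\<close> in terms of the frames \<open>e\<^sub>i\<close> of \<open>L\<close>: \<open>e\<^sub>i \<otimes> e\<^sub>i\<close> corresponds to
  \<open>\<rho> i (U, z) dz\<close>.\<close>

definition spin_form ::
  "'a::t2_space chart set \<Rightarrow> ('a, 'i) line_bundle \<Rightarrow> ('i \<Rightarrow> 'a chart \<Rightarrow> 'a \<Rightarrow> complex) \<Rightarrow> bool" where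
  "spin_form A L \<rho> \<longleftrightarrow> (\<forall>i\<in>idx L. \<forall>c\<in>A. \<forall>x\<in>triv L i \<inter> fst c.
     hol_at A (\<rho> i c) x \<and> \<rho> i c x \<noteq> 0 \<and>
     (\<forall>d\<in>A. x \<in> fst d \<longrightarrow> \<rho> i c x = param_deriv (fst c) (snd c) (snd d) x * \<rho> i d x) \<and>
     (\<forall>j\<in>idx L. x \<in> triv L j \<longrightarrow> \<rho> j c x = tf L i j x * tf L i j x * \<rho> i c x))"

locale bundle_on_surface = holomorphic_atlas A for A :: "'a::t2_space chart set" +
  fixes L :: "('a, 'i) line_bundle"
  assumes line_bundle: "is_line_bundle A L"
begin

lemma triv_open: "i \<in> idx L \<Longrightarrow> open (triv L i)"
  using line_bundle unfolding is_line_bundle_def by blast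

lemma triv_around:
  obtains i where "i \<in> idx L" "x \<in> triv L i"
proof -
  have "x \<in> (\<Union>i\<in>idx L. triv L i)" using line_bundle unfolding is_line_bundle_def by simp
  then show ?thesis using that by blast
qed

lemma tf_hol:
  assumes "i \<in> idx L" "j \<in> idx L" "x \<in> triv L i" "x \<in> triv L j"
  shows "hol_at A (tf L i j) x"
proof -
  have "hol_on A (triv L i \<inter> triv L j) (tf L i j)"
    using line_bundle assms unfolding is_line_bundle_def by blast
  then show ?thesis
    using hol_on_iff[OF open_Int[OF triv_open triv_open]] assms by blast
qed

lemma tf_self: "i \<in> idx L \<Longrightarrow> x \<in> triv L i \<Longrightarrow> tf L i i x = 1"
  using line_bundle unfolding is_line_bundle_def by blast

lemma tf_cocycle:
  "i \<in> idx L \<Longrightarrow> j \<in> idx L \<Longrightarrow> k \<in> idx L \<Longrightarrow> x \<in> triv L i \<Longrightarrow> x \<in> triv L j \<Longrightarrow> x \<in> triv L k \<Longrightarrow>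
    tf L i j x * tf L j k x = tf L i k x"
  using line_bundle unfolding is_line_bundle_def by blast

lemma tf_nonzero:
  assumes "i \<in> idx L" "j \<in> idx L" "x \<in> triv L i" "x \<in> triv L j"
  shows "tf L i j x \<noteq> 0"
  using tf_cocycle[of i j i x] tf_self[of i x] assms by auto

lemma section_iff:
  "open V \<Longrightarrow> s \<in> sections A L V \<longleftrightarrow>
     (\<forall>i x. i \<notin> idx L \<or> x \<notin> V \<inter> triv L i \<longrightarrow> s i x = 0) \<and>
     (\<forall>i\<in>idx L. \<forall>x\<in>V \<inter> triv L i. hol_at A (s i) x) \<and>
     (\<forall>i\<in>idx L. \<forall>j\<in>idx L. \<forall>x\<in>V \<inter> triv L i \<inter> triv L j. s i x = tf L i j x * s j x)"
  by (rule sections_iff[OF _ triv_open])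

lemma section_zero: "s \<in> sections A L V \<Longrightarrow> i \<notin> idx L \<or> x \<notin> V \<or> x \<notin> triv L i \<Longrightarrow> s i x = 0"
  unfolding sections_def by blast

lemma section_hol:
  "s \<in> sections A L V \<Longrightarrow> open V \<Longrightarrow> i \<in> idx L \<Longrightarrow> x \<in> V \<Longrightarrow> x \<in> triv L i \<Longrightarrow> hol_at A (s i) x"
  using section_iff by blast

lemma section_tf:
  "s \<in> sections A L V \<Longrightarrow> i \<in> idx L \<Longrightarrow> j \<in> idx L \<Longrightarrow> x \<in> V \<Longrightarrow> x \<in> triv L i \<Longrightarrow> x \<in> triv L j \<Longrightarrow>
    s i x = tf L i j x * s j x"
  unfolding sections_def by blast

definition frame :: "'i \<Rightarrow> 'a set \<Rightarrow> ('a, 'i) bundle_section" where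
  "frame i V = (\<lambda>j x. if j \<in> idx L \<and> x \<in> V \<inter> triv L j then tf L j i x else 0)"

lemma frame_section:
  assumes i: "i \<in> idx L" and V: "open V" "V \<subseteq> triv L i"
  shows "frame i V \<in> sections A L V"
  unfolding section_iff[OF V(1)]
proof (intro conjI ballI allI impI)
  fix j x assume "j \<notin> idx L \<or> x \<notin> V \<inter> triv L j"
  then show "frame i V j x = 0" by (auto simp: frame_def)
next
  fix j x assume j: "j \<in> idx L" and x: "x \<in> V \<inter> triv L j"
  show "hol_at A (frame i V j) x"
  proof (rule hol_at_cong)
    show "hol_at A (tf L j i) x" using i j V x by (intro tf_hol) auto
    have "open (V \<inter> triv L j)" using V triv_open[OF j] by auto
    from eventually_nhds_in_open[OF this x] show "\<forall>\<^sub>F y in nhds x. tf L j i y = frame i V j y"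
      by eventually_elim (simp add: frame_def j)
  qed
next
  fix j k x assume "j \<in> idx L" "k \<in> idx L" "x \<in> V \<inter> triv L j \<inter> triv L k"
  then show "frame i V j x = tf L j k x * frame i V k x"
    using i V tf_cocycle[of j k i x] by (auto simp: frame_def)
qed

lemma frame_self: "i \<in> idx L \<Longrightarrow> V \<subseteq> triv L i \<Longrightarrow> x \<in> V \<Longrightarrow> frame i V i x = 1"
  by (auto simp: frame_def tf_self)

lemma section_eq_frame:
  assumes "s \<in> sections A L V" "i \<in> idx L" "V \<subseteq> triv L i"
  shows "s = fscale (s i) (frame i V)"
proof (intro ext)
  fix j x
  show "s j x = fscale (s i) (frame i V) j x"
    using section_tf[OF assms(1), of j i x] section_zero[OF assms(1), of j x] assms(2,3)
    by (auto simp: fscale_def frame_def)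
qed

abbreviation "LL \<equiv> tensor_bundle L L"

lemma tensor_section_iff:
  assumes "open V"
  shows "s \<in> sections A LL V \<longleftrightarrow>
     (\<forall>i j x. i \<notin> idx L \<or> j \<notin> idx L \<or> x \<notin> V \<inter> triv L i \<inter> triv L j \<longrightarrow> s (i, j) x = 0) \<and>
     (\<forall>i\<in>idx L. \<forall>j\<in>idx L. \<forall>x\<in>V \<inter> triv L i \<inter> triv L j. hol_at A (s (i, j)) x) \<and>
     (\<forall>i\<in>idx L. \<forall>j\<in>idx L. \<forall>k\<in>idx L. \<forall>l\<in>idx L. \<forall>x\<in>V \<inter> triv L i \<inter> triv L j \<inter> triv L k \<inter> triv L l.
        s (i, j) x = tf L i k x * tf L j l x * s (k, l) x)"
proof -
  have "open (triv LL p)" if "p \<in> idx LL" for p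
    using that triv_open by (auto simp: tensor_bundle_def)
  then have iff: "s \<in> sections A LL V \<longleftrightarrow>
     (\<forall>i x. i \<notin> idx LL \<or> x \<notin> V \<inter> triv LL i \<longrightarrow> s i x = 0) \<and>
     (\<forall>i\<in>idx LL. \<forall>x\<in>V \<inter> triv LL i. hol_at A (s i) x) \<and>
     (\<forall>i\<in>idx LL. \<forall>j\<in>idx LL. \<forall>x\<in>V \<inter> triv LL i \<inter> triv LL j. s i x = tf LL i j x * s j x)"
    by (rule sections_iff[OF assms])
  have ball: "(\<forall>p\<in>I \<times> J. P p) \<longleftrightarrow> (\<forall>i\<in>I. \<forall>j\<in>J. P (i, j))" for I :: "'i set" and J :: "'i set" and P
    by auto
  show ?thesis
    unfolding iff
    by (simp only: tensor_bundle_def line_bundle.simps ball split_paired_All prod.case mem_Sigma_iff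
        de_Morgan_conj disj_assoc Int_assoc)
qed

lemma tensor_section_section:
  assumes V: "open V" and s: "s \<in> sections A L V" and t: "t \<in> sections A L V"
  shows "tensor_section s t \<in> sections A LL V"
  unfolding tensor_section_iff[OF V]
proof (intro conjI ballI allI impI)
  fix i j x assume "i \<notin> idx L \<or> j \<notin> idx L \<or> x \<notin> V \<inter> triv L i \<inter> triv L j"
  then show "tensor_section s t (i, j) x = 0"
    using section_zero[OF s, of i x] section_zero[OF t, of j x] by (auto simp: tensor_section_def)
next
  fix i j x assume "i \<in> idx L" "j \<in> idx L" "x \<in> V \<inter> triv L i \<inter> triv L j"
  then show "hol_at A (tensor_section s t (i, j)) x"
    using section_hol[OF s V, of i x] section_hol[OF t V, of j x]
    by (auto simp: tensor_section_def intro!: hol_at_mult)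
next
  fix i j k l x
  assume "i \<in> idx L" "j \<in> idx L" "k \<in> idx L" "l \<in> idx L"
    "x \<in> V \<inter> triv L i \<inter> triv L j \<inter> triv L k \<inter> triv L l"
  then show "tensor_section s t (i, j) x = tf L i k x * tf L j l x * tensor_section s t (k, l) x"
    using section_tf[OF s, of i k x] section_tf[OF t, of j l x] by (simp add: tensor_section_def)
qed

text \<open>By linearity over the structure sheaf an isomorphism \<open>\<alpha>\<close> is determined by the images of the
  \<open>e\<^sub>i \<otimes> e\<^sub>i\<close>, and these vanish nowhere because \<open>dz\<close> lies in the image of \<open>\<alpha>\<close>.\<close>

lemma square_root_spin_form:
  assumes \<alpha>: "square_root_iso A L \<alpha>"
  obtains \<rho> where "spin_form A L \<rho>"
    and "\<And>V e i c x. open V \<Longrightarrow> e \<in> sections A L V \<Longrightarrow> i \<in> idx L \<Longrightarrow> x \<in> V \<Longrightarrow> x \<in> triv L i \<Longrightarrow>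
      \<alpha> V (tensor_section e e) c x = e i x * e i x * \<rho> i c x"
proof -
  define \<tau> where "\<tau> i V = tensor_section (frame i V) (frame i V)" for i V
  define \<rho> where "\<rho> i = \<alpha> (triv L i) (\<tau> i (triv L i))" for i
  note iso = \<alpha>[unfolded square_root_iso_def sheaf_iso_def sheaf_of_sections_def, simplified, rule_format]
  have \<tau>: "\<tau> i V \<in> sections A LL V" if "i \<in> idx L" "open V" "V \<subseteq> triv L i" for i V
    unfolding \<tau>_def using that by (intro tensor_section_section frame_section)
  have bij: "bij_betw (\<alpha> V) (sections A LL V) (sections A (canonical_bundle A) V)" if "open V" for V
    using iso[OF that] by blast
  have scale: "\<alpha> V (fscale f s) = fscale f (\<alpha> V s)"
    if "open V" "f \<in> O_X A V" "s \<in> sections A LL V" for V f s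
    using iso[OF that(1)] that(2,3) by blast
  have res: "\<alpha> V' (srestr V' s) = srestr V' (\<alpha> V s)"
    if "open V" "open V'" "V' \<subseteq> V" "s \<in> sections A LL V" for V V' s
    using iso[OF that(1)] that(2-4) by blast
  have key: "\<alpha> V s c x = s (i, i) x * \<rho> i c x"
    if V: "open V" and s: "s \<in> sections A LL V" and i: "i \<in> idx L" "x \<in> triv L i" and x: "x \<in> V" for V s i c x
  proof -
    let ?V = "V \<inter> triv L i"
    have V': "open ?V" using V triv_open i by auto
    let ?f = "restr ?V (s (i, i))"
    note s' = s[unfolded tensor_section_iff[OF V]]
    have "?f \<in> O_X A ?V"
      unfolding O_X_iff[OF V']
    proof (intro conjI ballI allI impI)
      fix y assume y: "y \<in> ?V"
      then have "hol_at A (s (i, i)) y" using s' i by blast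
      then show "hol_at A ?f y"
        by (rule hol_at_cong) (use eventually_nhds_in_open[OF V' y] in \<open>eventually_elim, simp add: restr_def\<close>)
    next
      fix y assume "y \<notin> ?V"
      then show "?f y = 0" unfolding restr_def by (rule if_not_P)
    qed
    moreover have "srestr ?V s = fscale ?f (\<tau> i ?V)"
    proof (intro ext)
      fix p :: "'i \<times> 'i" and y
      obtain j k where p: "p = (j, k)" by (cases p)
      show "srestr ?V s p y = fscale ?f (\<tau> i ?V) p y"
      proof (cases "j \<in> idx L \<and> k \<in> idx L \<and> y \<in> ?V \<inter> triv L j \<inter> triv L k")
        case True
        then have "s (j, k) y = tf L j i y * tf L k i y * s (i, i) y"
          using s' i by blast
        then show ?thesis using True unfolding p
          by (simp add: srestr_def restr_def fscale_def \<tau>_def tensor_section_def frame_def)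
      next
        case False
        then have "y \<in> ?V \<Longrightarrow> s (j, k) y = 0" using s' by blast
        then show ?thesis using False unfolding p
          by (auto simp: srestr_def restr_def fscale_def \<tau>_def tensor_section_def frame_def)
      qed
    qed
    moreover have "\<tau> i ?V = srestr ?V (\<tau> i (triv L i))"
      by (auto simp: fun_eq_iff srestr_def restr_def \<tau>_def tensor_section_def frame_def)
    ultimately have "srestr ?V (\<alpha> V s) = fscale ?f (srestr ?V (\<rho> i))"
      using res[OF V V' _ s] scale[OF V' _ \<tau>[OF i(1) V']] res[OF triv_open[OF i(1)] V' _ \<tau>[OF i(1) triv_open[OF i(1)] order_refl]]
      by (simp add: \<rho>_def)
    then have "srestr ?V (\<alpha> V s) c x = fscale ?f (srestr ?V (\<rho> i)) c x" by simp
    then show ?thesis using x i by (simp add: srestr_def restr_def fscale_def)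
  qed
  have \<rho>_sec: "\<rho> i \<in> sections A (canonical_bundle A) (triv L i)" if "i \<in> idx L" for i
    unfolding \<rho>_def using bij[OF triv_open[OF that]] \<tau>[OF that triv_open[OF that] order_refl]
    by (auto simp: bij_betw_def)
  have "spin_form A L \<rho>"
    unfolding spin_form_def
  proof (intro ballI conjI impI)
    fix i c x assume i: "i \<in> idx L" and c: "c \<in> A" and x: "x \<in> triv L i \<inter> fst c"
    note \<rho>i = \<rho>_sec[OF i, unfolded canonical_sections_iff[OF triv_open[OF i]]]
    show "hol_at A (\<rho> i c) x" using \<rho>i c x by blast
    show "\<rho> i c x = param_deriv (fst c) (snd c) (snd d) x * \<rho> i d x" if "d \<in> A" "x \<in> fst d" for d
      using \<rho>i c x that by blast
    show "\<rho> j c x = tf L i j x * tf L i j x * \<rho> i c x" if j: "j \<in> idx L" "x \<in> triv L j" for j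
      using key[OF triv_open[OF j(1)] \<tau>[OF j(1) triv_open[OF j(1)] order_refl] i _ j(2), of c] x i j
      by (simp add: \<rho>_def \<tau>_def tensor_section_def frame_def)
    let ?V = "triv L i \<inter> fst c"
    have c': "(fst c, snd c) \<in> A" using c by simp
    have V: "open ?V" using triv_open[OF i] is_chartD(1)[OF chart[OF c']] by auto
    have "differential A ?V (snd c) \<in> \<alpha> ?V ` sections A LL ?V"
      using bij[OF V] differential_section[OF c' V] by (auto simp: bij_betw_def)
    then obtain s where s: "s \<in> sections A LL ?V" "\<alpha> ?V s = differential A ?V (snd c)" by auto
    have "param_deriv (fst c) (snd c) (snd c) x = 1"
      using param_deriv_self[OF c'] x by blast
    then have "differential A ?V (snd c) c x = 1"
      using c x by (cases c) (simp add: differential_def param_deriv_def)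
    then have "s (i, i) x * \<rho> i c x = 1"
      using key[OF V s(1) i _ x, of c] s(2) x by simp
    then show "\<rho> i c x \<noteq> 0" by auto
  qed
  moreover have "\<alpha> V (tensor_section e e) c x = e i x * e i x * \<rho> i c x"
    if "open V" "e \<in> sections A L V" "i \<in> idx L" "x \<in> V" "x \<in> triv L i" for V e i c x
    using key[OF that(1) tensor_section_section[OF that(1,2,2)] that(3,5,4), of c]
    by (simp add: tensor_section_def)
  ultimately show ?thesis using that by blast
qed

text \<open>The quotient of two spin forms does not depend on the frame or the chart, so it is a holomorphic
  function on a compact connected surface.  The constant then drops out of the twisted derivative,
  which is why the isomorphism does not depend on \<open>\<alpha>\<close>.\<close>

lemma spin_form_unique:
  assumes "compact (UNIV :: 'a set)" and \<rho>: "spin_form A L \<rho>" and \<rho>': "spin_form A L \<rho>'"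
  obtains k where "k \<noteq> 0"
    "\<And>i c x. i \<in> idx L \<Longrightarrow> c \<in> A \<Longrightarrow> x \<in> triv L i \<Longrightarrow> x \<in> fst c \<Longrightarrow> \<rho>' i c x = k * \<rho> i c x"
proof -
  note r = \<rho>[unfolded spin_form_def, rule_format] and r' = \<rho>'[unfolded spin_form_def, rule_format]
  define P where "P x p \<longleftrightarrow> fst p \<in> idx L \<and> snd p \<in> A \<and> x \<in> triv L (fst p) \<inter> fst (snd p)" for x p
  define h where "h x = (let p = SOME p. P x p in \<rho>' (fst p) (snd p) x / \<rho> (fst p) (snd p) x)" for x
  have h: "h x = \<rho>' i c x / \<rho> i c x" if "i \<in> idx L" "c \<in> A" "x \<in> triv L i" "x \<in> fst c" for i c x
  proof -
    define p where "p = (SOME p. P x p)"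
    have "P x p" unfolding p_def by (rule someI[of _ "(i, c)"]) (use that in \<open>simp add: P_def\<close>)
    then have p: "fst p \<in> idx L" "snd p \<in> A" "x \<in> triv L (fst p) \<inter> fst (snd p)" by (auto simp: P_def)
    let ?t = "tf L i (fst p) x" and ?d = "param_deriv (fst c) (snd c) (snd (snd p)) x"
    have x: "x \<in> triv L i \<inter> fst c" "x \<in> triv L i \<inter> fst (snd p)" using that p by auto
    have "\<rho> i c x = ?d * \<rho> i (snd p) x" "\<rho>' i c x = ?d * \<rho>' i (snd p) x"
      using r[OF that(1,2) x(1)] r'[OF that(1,2) x(1)] p by blast+
    moreover have "\<rho> (fst p) (snd p) x = ?t * ?t * \<rho> i (snd p) x" "\<rho>' (fst p) (snd p) x = ?t * ?t * \<rho>' i (snd p) x"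
      using r[OF that(1) p(2) x(2)] r'[OF that(1) p(2) x(2)] p by blast+
    moreover have "\<rho> i c x \<noteq> 0" "\<rho> (fst p) (snd p) x \<noteq> 0"
      using r[OF that(1,2) x(1)] r[OF p] by blast+
    ultimately show ?thesis
      by (auto simp: h_def p_def[symmetric] Let_def)
  qed
  have "hol_at A h x" for x
  proof -
    obtain i where i: "i \<in> idx L" "x \<in> triv L i" by (rule triv_around)
    obtain U z where c: "(U, z) \<in> A" "x \<in> U" by (rule chart_around)
    have xi: "x \<in> triv L i \<inter> fst (U, z)" using i c by simp
    have "hol_at A (\<lambda>y. \<rho>' i (U, z) y / \<rho> i (U, z) y) x"
      using r[OF i(1) c(1) xi] r'[OF i(1) c(1) xi] by (intro hol_at_divide) auto
    then show ?thesis
    proof (rule hol_at_cong)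
      have "open (triv L i \<inter> U)" "x \<in> triv L i \<inter> U"
        using triv_open[OF i(1)] is_chartD(1)[OF chart[OF c(1)]] i c by auto
      from eventually_nhds_in_open[OF this] show "\<forall>\<^sub>F y in nhds x. \<rho>' i (U, z) y / \<rho> i (U, z) y = h y"
        by eventually_elim (use h[OF i(1) c(1)] in simp)
    qed
  qed
  from holomorphic_constant[OF assms(1) this] obtain k where k: "\<And>x. h x = k" by blast
  have eq: "\<rho>' i c x = k * \<rho> i c x" if "i \<in> idx L" "c \<in> A" "x \<in> triv L i" "x \<in> fst c" for i c x
  proof -
    have "\<rho> i c x \<noteq> 0" using r[OF that(1,2)] that(3,4) by blast
    then show ?thesis using h[OF that] k[of x] by simp
  qed
  have "k \<noteq> 0"
  proof
    assume "k = 0"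
    define x :: 'a where "x = undefined"
    obtain i where i: "i \<in> idx L" "x \<in> triv L i" by (rule triv_around)
    obtain U z where c: "(U, z) \<in> A" "x \<in> U" by (rule chart_around)
    have "\<rho>' i (U, z) x = 0" using eq[OF i(1) c(1) i(2)] c(2) \<open>k = 0\<close> by simp
    moreover have "x \<in> triv L i \<inter> fst (U, z)" using i c by simp
    ultimately show False using r'[OF i(1) c(1)] by blast
  qed
  then show ?thesis using that eq by blast
qed

end

section \<open>The operator of a section of the quotient\<close>

lemma open_diag_vimage: "open W \<Longrightarrow> open (diag_vimage W)"
proof -
  have "diag_vimage W = (\<lambda>x. (x, x)) -` W" by (auto simp: diag_vimage_def)
  then show "open W \<Longrightarrow> open (diag_vimage W)"
    by (auto intro!: open_vimage continuous_on_Pair continuous_on_id)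
qed

text \<open>All members of the stalk element are required to have the jet, rather than a chosen one, so that the
  condition can be checked on the unions of classes by which sums and multiples are defined.\<close>

definition represented_jet ::
  "('a::topological_space \<times> 'a \<Rightarrow> ('a \<times> 'a) local_function set) \<Rightarrow> ('a \<Rightarrow> complex) \<Rightarrow> 'a \<Rightarrow> complex \<Rightarrow> complex \<Rightarrow> bool" where
  "represented_jet \<sigma> z x a b \<longleftrightarrow> \<sigma> (x, x) \<noteq> {} \<and> (\<forall>(N, F)\<in>\<sigma> (x, x). polar_jet z F x a b)"

context holomorphic_atlas
begin

lemma twisted_derivative_section_linear:
  "\<exists>k. \<forall>s. twisted_derivative U z c a b s x = a * param_deriv U z s x + k * s x"
  unfolding twisted_derivative_def by blast

lemma twisted_derivative_jet_linear:
  "\<exists>e. \<forall>a b. twisted_derivative U z c a b s x = a * e + b * s x"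
proof (intro exI allI)
  fix a b
  have "a * param_deriv U z c x / (2 * c x) = a * (param_deriv U z c x / (2 * c x))" by simp
  then show "twisted_derivative U z c a b s x
      = a * (param_deriv U z s x + param_deriv U z c x / (2 * c x) * s x) + b * s x"
    unfolding twisted_derivative_def by (simp only: ring_distribs mult.assoc add.assoc)
qed

lemma twisted_derivative_cong:
  assumes "\<forall>\<^sub>F y in nhds x. s y = t y" "(U, z) \<in> A" "x \<in> U"
  shows "twisted_derivative U z c a b s x = twisted_derivative U z c a b t x"
  using param_deriv_cong[OF assms(2,3,1)] eventually_nhds_x_imp_x[OF assms(1)]
  by (simp add: twisted_derivative_def)

lemma twisted_derivative_add:
  assumes "hol_at A s x" "hol_at A t x" "(U, z) \<in> A" "x \<in> U"
  shows "twisted_derivative U z c a b (\<lambda>y. s y + t y) x =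
    twisted_derivative U z c a b s x + twisted_derivative U z c a b t x"
proof -
  obtain k where "\<forall>s. twisted_derivative U z c a b s x = a * param_deriv U z s x + k * s x"
    using twisted_derivative_section_linear by blast
  then show ?thesis by (simp add: param_deriv_add[OF assms] algebra_simps)
qed

lemma twisted_derivative_mult:
  assumes "hol_at A f x" "hol_at A s x" "(U, z) \<in> A" "x \<in> U"
  shows "twisted_derivative U z c a b (\<lambda>y. f y * s y) x =
    f x * twisted_derivative U z c a b s x + a * param_deriv U z f x * s x"
proof -
  obtain k where "\<forall>s. twisted_derivative U z c a b s x = a * param_deriv U z s x + k * s x"
    using twisted_derivative_section_linear by blast
  then show ?thesis by (simp add: param_deriv_mult[OF assms] algebra_simps)
qed

lemma twisted_derivative_jet_add:
  "twisted_derivative U z c (a + a') (b + b') s x =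
    twisted_derivative U z c a b s x + twisted_derivative U z c a' b' s x"
proof -
  obtain e where "\<forall>a b. twisted_derivative U z c a b s x = a * e + b * s x"
    using twisted_derivative_jet_linear by blast
  then show ?thesis by (simp add: algebra_simps)
qed

lemma twisted_derivative_jet_scale:
  "twisted_derivative U z c (h * a) (h * b + a * h') s x =
    h * twisted_derivative U z c a b s x + a * h' * s x"
proof -
  obtain e where "\<forall>a b. twisted_derivative U z c a b s x = a * e + b * s x"
    using twisted_derivative_jet_linear by blast
  then show ?thesis by (simp add: algebra_simps)
qed

lemma hol_at_twisted_derivative:
  assumes c: "(U, z) \<in> A" "x \<in> U" and hol: "\<forall>\<^sub>F y in nhds x. hol_at A c y" "\<forall>\<^sub>F y in nhds x. hol_at A s y"
    and ab: "hol_at A a x" "hol_at A b x" and ne: "c x \<noteq> 0"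
  shows "hol_at A (\<lambda>y. twisted_derivative U z c (a y) (b y) s y) x"
  unfolding twisted_derivative_def
  using eventually_nhds_x_imp_x[OF hol(1)] eventually_nhds_x_imp_x[OF hol(2)] ne
  by (intro hol_at_add hol_at_mult hol_at_divide hol_at_param_deriv[OF c] hol_at_const ab hol) auto

lemma O_plus_Delta_zero: "open N \<Longrightarrow> (\<lambda>_. 0) \<in> O_plus_Delta A N"
proof -
  have "hol2_at A (\<lambda>_. 0) p" for p
    using hol2_at_fst[OF hol_at_const[of 0]] by (cases p) auto
  then show "open N \<Longrightarrow> (\<lambda>_. 0) \<in> O_plus_Delta A N"
    unfolding O_plus_Delta_iff by (intro conjI ballI allI impI exI[of _ "\<lambda>_. 0"]) (simp_all add: polar_numerator_def)
qed

lemma polar_quotient_sec: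
  "\<sigma> \<in> sec (polar_quotient A) W \<longleftrightarrow> (\<forall>p. p \<notin> W \<longrightarrow> \<sigma> p = {}) \<and>
    (\<forall>p\<in>W. \<exists>N F. open N \<and> p \<in> N \<and> N \<subseteq> W \<and> F \<in> O_plus_Delta A N \<and> (\<forall>q\<in>N. \<sigma> q = stalk q `` {(N, F)}))"
  by (simp add: polar_quotient_def quotient_sheaf_def)

lemma polar_quotient_local:
  assumes "\<sigma> \<in> sec (polar_quotient A) W" "p \<in> W"
  obtains N F where "open N" "p \<in> N" "N \<subseteq> W" "F \<in> O_plus_Delta A N" "\<forall>q\<in>N. \<sigma> q = stalk q `` {(N, F)}"
    "\<forall>q\<in>N. (N, F) \<in> \<sigma> q"
proof -
  obtain N F where "open N" "p \<in> N" "N \<subseteq> W" "F \<in> O_plus_Delta A N" "\<forall>q\<in>N. \<sigma> q = stalk q `` {(N, F)}"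
    using assms unfolding polar_quotient_sec by blast
  then show ?thesis using stalk_refl by (intro that[of N F]) auto
qed

lemma polar_quotient_element:
  assumes "\<sigma> \<in> sec (polar_quotient A) W" "(N, F) \<in> \<sigma> p"
  shows "open N" "p \<in> N" "F \<in> O_plus_Delta A N" "p \<in> W"
proof -
  show pW: "p \<in> W" using assms unfolding polar_quotient_sec by blast
  obtain N' F' where "\<forall>q\<in>N'. \<sigma> q = stalk q `` {(N', F')}" "p \<in> N'"
    using assms(1) pW unfolding polar_quotient_sec by blast
  then have "((N', F'), (N, F)) \<in> stalk p" using assms(2) by blast
  then show "open N" "p \<in> N" "F \<in> O_plus_Delta A N"
    unfolding stalk_rel_def by blast+
qed

lemma stalk_polar_jet_at:
  assumes "((N, F), (N', F')) \<in> stalk (x, x)"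
  shows "polar_jet z F x a b \<longleftrightarrow> polar_jet z F' x a b"
  by (rule stalk_polar_jet[OF assms]) simp

lemma represented_jetI:
  assumes "\<sigma> (x, x) = stalk (x, x) `` {(N, F)}" "(N, F) \<in> \<sigma> (x, x)" "polar_jet z F x a b"
  shows "represented_jet \<sigma> z x a b"
  unfolding represented_jet_def
proof (intro conjI ballI)
  show "\<sigma> (x, x) \<noteq> {}" using assms(2) by blast
  fix q assume q: "q \<in> \<sigma> (x, x)"
  obtain N' F' where q': "q = (N', F')" by (cases q)
  have "((N, F), (N', F')) \<in> stalk (x, x)" using q assms(1) unfolding q' by blast
  from stalk_polar_jet_at[OF this] show "case q of (N, F) \<Rightarrow> polar_jet z F x a b"
    using assms(3) q' by simp
qed

lemma represented_jet_exists:
  assumes "\<sigma> \<in> sec (polar_quotient A) W" "(x, x) \<in> W" "(U, z) \<in> A" "x \<in> U"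
  obtains a b where "represented_jet \<sigma> z x a b"
proof -
  obtain N F where N: "open N" "(x, x) \<in> N" "N \<subseteq> W" "F \<in> O_plus_Delta A N"
    "\<forall>q\<in>N. \<sigma> q = stalk q `` {(N, F)}" "\<forall>q\<in>N. (N, F) \<in> \<sigma> q"
    by (rule polar_quotient_local[OF assms(1,2)])
  obtain a b where "polar_jet z F x a b"
    by (rule polar_jet_exists[OF N(1,2,4) assms(3,4)])
  then show ?thesis using N by (intro that represented_jetI) auto
qed

lemma represented_jet_element:
  assumes "represented_jet \<sigma> z x a b" "(N, F) \<in> \<sigma> (x, x)"
  shows "polar_jet z F x a b"
  using assms unfolding represented_jet_def by blast

lemma polar_jet_restr:
  assumes "polar_jet z F x a b" "open N" "(x, x) \<in> N"
  shows "polar_jet z (restr N F) x a b"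
proof (rule polar_jet_perturb[OF assms(1)], rule tendsto_eventually)
  have "open (Pair x -` N)" using assms(2) by (intro open_vimage continuous_intros)
  from eventually_nhds_in_open[OF this, of x] have "\<forall>\<^sub>F y in nhds x. (x, y) \<in> N"
    using assms(3) by simp
  then show "\<forall>\<^sub>F y in at x. restr N F (x, y) - F (x, y) = 0"
    unfolding eventually_at_filter by eventually_elim (simp add: restr_def)
qed

text \<open>Sums and multiples of sections of the quotient are unions of classes over all choices of
  representatives; a jet common to all of these choices is the jet of the result.\<close>

lemma represented_jet_of_classes:
  assumes \<tau>: "\<tau> (x, x) = (\<Union>u\<in>I. stalk (x, x) `` {g u})" and ne: "I \<noteq> {}"
    and g: "\<And>u. u \<in> I \<Longrightarrow> case g u of (N, F) \<Rightarrow>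
      open N \<and> (x, x) \<in> N \<and> F \<in> O_plus_Delta A N \<and> polar_jet z F x a b"
  shows "represented_jet \<tau> z x a b"
  unfolding represented_jet_def
proof (intro conjI ballI)
  obtain u where u: "u \<in> I" using ne by blast
  obtain N F where "g u = (N, F)" by (cases "g u")
  then have "(g u, g u) \<in> stalk (x, x)" using g[OF u] stalk_refl[of N "(x, x)" F] by simp
  then show "\<tau> (x, x) \<noteq> {}" unfolding \<tau> using u by blast
next
  fix q assume "q \<in> \<tau> (x, x)"
  then obtain u where u: "u \<in> I" "(g u, q) \<in> stalk (x, x)" unfolding \<tau> by blast
  obtain N F K G where "g u = (N, F)" "q = (K, G)" by (cases "g u", cases q)
  then show "case q of (N, F) \<Rightarrow> polar_jet z F x a b"
    using g[OF u(1)] u(2) stalk_polar_jet_at by auto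
qed

lemma represented_jet_add:
  assumes \<sigma>: "\<sigma> \<in> sec (polar_quotient A) W" and \<tau>: "\<tau> \<in> sec (polar_quotient A) W"
    and j: "represented_jet \<sigma> z x a b" "represented_jet \<tau> z x a' b'"
  shows "represented_jet (add (polar_quotient A) W \<sigma> \<tau>) z x (a + a') (b + b')"
proof (rule represented_jet_of_classes[where I = "\<sigma> (x, x) \<times> \<tau> (x, x)"
      and g = "\<lambda>u. case u of ((N, F), (N', F')) \<Rightarrow> (N \<inter> N', restr (N \<inter> N') (\<lambda>q. F q + F' q))"])
  show "add (polar_quotient A) W \<sigma> \<tau> (x, x) = (\<Union>u\<in>\<sigma> (x, x) \<times> \<tau> (x, x).
      stalk (x, x) `` {case u of ((N, F), (N', F')) \<Rightarrow> (N \<inter> N', restr (N \<inter> N') (\<lambda>q. F q + F' q))})"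
    unfolding polar_quotient_def quotient_sheaf_def by auto
  show "\<sigma> (x, x) \<times> \<tau> (x, x) \<noteq> {}" using j unfolding represented_jet_def by blast
next
  fix u assume "u \<in> \<sigma> (x, x) \<times> \<tau> (x, x)"
  then obtain N F N' F' where u: "u = ((N, F), (N', F'))" and NF: "(N, F) \<in> \<sigma> (x, x)" "(N', F') \<in> \<tau> (x, x)"
    by (cases u) auto
  note n = polar_quotient_element[OF \<sigma> NF(1)] and n' = polar_quotient_element[OF \<tau> NF(2)]
  have N: "open (N \<inter> N')" "(x, x) \<in> N \<inter> N'" using n n' by auto
  have "polar_jet z (\<lambda>q. F q + F' q) x (a + a') (b + b')"
    using polar_jet_add[OF represented_jet_element[OF j(1) NF(1)] represented_jet_element[OF j(2) NF(2)]] .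
  with N O_plus_Delta_add[OF n(1,3) n'(1,3)] polar_jet_restr[OF this N]
  show "case (case u of ((N, F), (N', F')) \<Rightarrow> (N \<inter> N', restr (N \<inter> N') (\<lambda>q. F q + F' q))) of (N, F) \<Rightarrow>
      open N \<and> (x, x) \<in> N \<and> F \<in> O_plus_Delta A N \<and> polar_jet z F x (a + a') (b + b')"
    unfolding u by simp
qed

lemma represented_jet_scale:
  assumes W: "open W" and \<sigma>: "\<sigma> \<in> sec (polar_quotient A) W" and h: "h \<in> O_XX A W"
    and c: "(U, z) \<in> A" "x \<in> U" and j: "represented_jet \<sigma> z x a b"
  shows "represented_jet (scale (polar_quotient A) W h \<sigma>) z x (h (x, x) * a)
    (h (x, x) * b + a * param_deriv U z (\<lambda>y. h (x, y)) x)"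
proof (rule represented_jet_of_classes[where I = "\<sigma> (x, x)"
      and g = "\<lambda>(N, F). (N \<inter> W, restr (N \<inter> W) (\<lambda>q. h q * F q))"])
  show "scale (polar_quotient A) W h \<sigma> (x, x) = (\<Union>u\<in>\<sigma> (x, x).
      stalk (x, x) `` {case u of (N, F) \<Rightarrow> (N \<inter> W, restr (N \<inter> W) (\<lambda>q. h q * F q))})"
    unfolding polar_quotient_def quotient_sheaf_def by auto
  show "\<sigma> (x, x) \<noteq> {}" using j unfolding represented_jet_def by blast
next
  fix u assume u': "u \<in> \<sigma> (x, x)"
  obtain N F where u: "u = (N, F)" by (cases u)
  have hol: "\<And>p. p \<in> W \<Longrightarrow> hol2_at A h p" using h unfolding O_XX_iff[OF W] by blast
  note n = polar_quotient_element[OF \<sigma> u'[unfolded u]]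
  have N: "open (N \<inter> W)" "(x, x) \<in> N \<inter> W" using n W by auto
  have "polar_jet z (\<lambda>q. h q * F q) x (h (x, x) * a) (h (x, x) * b + a * param_deriv U z (\<lambda>y. h (x, y)) x)"
    using n by (intro polar_jet_mult[OF represented_jet_element[OF j u'[unfolded u]] hol_at_slice[OF hol] c])
  with N O_plus_Delta_scale[OF n(1,3) W hol] polar_jet_restr[OF this N]
  show "case (case u of (N, F) \<Rightarrow> (N \<inter> W, restr (N \<inter> W) (\<lambda>q. h q * F q))) of (N, F) \<Rightarrow>
      open N \<and> (x, x) \<in> N \<and> F \<in> O_plus_Delta A N \<and>
      polar_jet z F x (h (x, x) * a) (h (x, x) * b + a * param_deriv U z (\<lambda>y. h (x, y)) x)"
    unfolding u by simp
qed

end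

locale spin_surface = bundle_on_surface A L for A :: "'a::t2_space chart set" and L :: "('a, 'i) line_bundle" +
  fixes \<rho> :: "'i \<Rightarrow> 'a chart \<Rightarrow> 'a \<Rightarrow> complex"
  assumes spin: "spin_form A L \<rho>"
begin

lemma spin_formD:
  assumes "i \<in> idx L" "x \<in> triv L i" "(U, z) \<in> A" "x \<in> U"
  shows "hol_at A (\<rho> i (U, z)) x" "\<rho> i (U, z) x \<noteq> 0"
    and "\<And>V w. (V, w) \<in> A \<Longrightarrow> x \<in> V \<Longrightarrow> \<rho> i (U, z) x = param_deriv U z w x * \<rho> i (V, w) x"
    and "\<And>j. j \<in> idx L \<Longrightarrow> x \<in> triv L j \<Longrightarrow> \<rho> j (U, z) x = tf L i j x * tf L i j x * \<rho> i (U, z) x"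
proof -
  have "x \<in> triv L i \<inter> fst (U, z)" using assms by simp
  note * = spin[unfolded spin_form_def, rule_format, OF assms(1,3) this]
  show "hol_at A (\<rho> i (U, z)) x" "\<rho> i (U, z) x \<noteq> 0" using * by blast+
  show "\<rho> i (U, z) x = param_deriv U z w x * \<rho> i (V, w) x" if "(V, w) \<in> A" "x \<in> V" for V w
    using *[THEN conjunct2, THEN conjunct2, THEN conjunct1, rule_format, OF that(1)] that(2) by simp
  show "\<rho> j (U, z) x = tf L i j x * tf L i j x * \<rho> i (U, z) x" if "j \<in> idx L" "x \<in> triv L j" for j
    using * that by blast
qed

abbreviation op_value where "op_value U z a b s i x \<equiv> twisted_derivative U z (\<rho> i (U, z)) a b (s i) x"

lemma eventually_domain:
  assumes "i \<in> idx L" "x \<in> triv L i" "(U, z) \<in> A" "x \<in> U"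
  shows "\<forall>\<^sub>F y in nhds x. y \<in> triv L i" "\<forall>\<^sub>F y in nhds x. y \<in> U"
  using eventually_nhds_in_open[OF triv_open] eventually_in_chart(1)[OF chart] assms by auto

lemma op_value_index:
  assumes i: "i \<in> idx L" "x \<in> triv L i" and j: "j \<in> idx L" "x \<in> triv L j"
    and c: "(U, z) \<in> A" "x \<in> U" and s: "s \<in> sections A L V" "open V" "x \<in> V"
  shows "op_value U z a b s i x = tf L i j x * op_value U z a b s j x"
proof -
  \<comment> \<open>The parameter does not change here, so its second derivative gives no correction.\<close>
  have z2: "param_deriv U z (param_deriv U z z) x = 0"
  proof -
    have "\<forall>\<^sub>F y in nhds x. param_deriv U z z y = 1"
      using eventually_domain(2)[OF i c] by eventually_elim (rule param_deriv_self[OF c(1)])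
    from param_deriv_cong[OF c this] show ?thesis by (simp add: param_deriv_const)
  qed
  have "\<forall>\<^sub>F y in nhds x. y \<in> triv L i \<and> y \<in> triv L j \<and> y \<in> U \<and> y \<in> V"
    using eventually_domain[OF i c] eventually_domain(1)[OF j c] eventually_nhds_in_open[OF s(2,3)]
    by eventually_elim simp
  then have "\<forall>\<^sub>F y in nhds x. s i y = tf L i j y * s j y \<and>
      tf L i j y * tf L i j y * \<rho> i (U, z) y = \<rho> j (U, z) y * param_deriv U z z y"
  proof eventually_elim
    case (elim y)
    then have "s i y = tf L i j y * s j y" using section_tf[OF s(1)] i j by blast
    moreover have "tf L i j y * tf L i j y * \<rho> i (U, z) y = \<rho> j (U, z) y * param_deriv U z z y"
      using spin_formD(4)[OF i(1) _ c(1), of y j] j elim param_deriv_self[OF c(1), of y] by simp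
    ultimately show ?case ..
  qed
  then have ev: "\<forall>\<^sub>F y in nhds x. s i y = tf L i j y * s j y"
    "\<forall>\<^sub>F y in nhds x. tf L i j y * tf L i j y * \<rho> i (U, z) y = \<rho> j (U, z) y * param_deriv U z z y"
    by (auto simp: eventually_conj_iff)
  from twisted_derivative_change[OF c hol_at_chart_eventually[OF c] _ tf_hol[OF i(1) j(1) i(2) j(2)]
      section_hol[OF s(1,2) j(1) s(3) j(2)] spin_formD(1)[OF i c] spin_formD(1)[OF j c] ev
      tf_nonzero[OF i(1) j(1) i(2) j(2)] spin_formD(2)[OF i c], of a b]
  have "op_value U z a b s i x = tf L i j x * (a * param_deriv U z (s j) x +
      (a * param_deriv U z (\<rho> j (U, z)) x / (2 * \<rho> j (U, z) x) + b) * s j x)"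
    by (simp add: param_deriv_self[OF c] z2)
  then show ?thesis by (simp add: twisted_derivative_def)
qed

lemma op_value_chart:
  assumes i: "i \<in> idx L" "x \<in> triv L i" and c: "(U, z) \<in> A" "x \<in> U" and c': "(V, w) \<in> A" "x \<in> V"
    and s: "s \<in> sections A L N" "open N" "x \<in> N"
  shows "op_value V w a b s i x = op_value U z (a * param_deriv V w z x)
    (b + a * param_deriv V w (param_deriv V w z) x / (2 * param_deriv V w z x)) s i x"
proof -
  have "\<forall>\<^sub>F y in nhds x. y \<in> triv L i \<and> y \<in> U \<and> y \<in> V"
    using eventually_domain[OF i c] eventually_domain(2)[OF i c'] by eventually_elim simp
  then have ev: "\<forall>\<^sub>F y in nhds x. 1 * 1 * \<rho> i (V, w) y = \<rho> i (U, z) y * param_deriv V w z y"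
  proof eventually_elim
    case (elim y)
    then show ?case using spin_formD(3)[OF i(1) _ c'(1), of y U z] c(1) by simp
  qed
  have ev1: "\<forall>\<^sub>F y in nhds x. s i y = 1 * s i y" by simp
  note hols = section_hol[OF s(1,2) i(1) s(3) i(2)]
  note nz = param_deriv_transition_nonzero[OF c c']
  from twisted_derivative_change[OF c' hol_at_chart_eventually[OF c] nz hol_at_const
      hols spin_formD(1)[OF i c'] spin_formD(1)[OF i c] ev1 ev
      one_neq_zero spin_formD(2)[OF i c'], of a b]
  show ?thesis
    unfolding param_deriv_chain[OF hols c c'] param_deriv_chain[OF spin_formD(1)[OF i c] c c']
    by (simp add: twisted_derivative_def mult.assoc mult.left_commute)
qed

text \<open>The value of the operator depends on \<open>F\<close> alone: the transformation rules of the jet and of the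
  twisted derivative compensate each other.\<close>

lemma op_value_jet_unique:
  assumes i: "i \<in> idx L" "x \<in> triv L i" and c: "(U, z) \<in> A" "x \<in> U" and c': "(V, w) \<in> A" "x \<in> V"
    and s: "s \<in> sections A L N" "open N" "x \<in> N"
    and j: "polar_jet z F x a b" "polar_jet w F x a' b'"
  shows "op_value V w a' b' s i x = op_value U z a b s i x"
proof -
  have "polar_jet z F x (a' * param_deriv V w z x)
      (b' + a' * param_deriv V w (param_deriv V w z) x / (2 * param_deriv V w z x))"
    by (rule polar_jet_change[OF j(2) c' hol_at_chart_eventually[OF c] param_deriv_transition_nonzero[OF c c']])
  from polar_jet_unique[OF chart[OF c(1)] c(2) j(1) this] show ?thesis
    unfolding op_value_chart[OF i c c' s] by simp
qed

definition kernel_op :: "('a \<times> 'a \<Rightarrow> complex) \<Rightarrow> ('a, 'i) bundle_section \<Rightarrow> 'i \<Rightarrow> 'a \<Rightarrow> complex" where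
  "kernel_op F s i x = (THE v. \<exists>U z a b. (U, z) \<in> A \<and> x \<in> U \<and> polar_jet z F x a b \<and> v = op_value U z a b s i x)"

lemma kernel_op_eq:
  assumes "i \<in> idx L" "x \<in> triv L i" "(U, z) \<in> A" "x \<in> U" "s \<in> sections A L N" "open N" "x \<in> N"
    "polar_jet z F x a b"
  shows "kernel_op F s i x = op_value U z a b s i x"
  unfolding kernel_op_def
proof (rule the_equality)
  show "\<exists>U' z' a' b'. (U', z') \<in> A \<and> x \<in> U' \<and> polar_jet z' F x a' b' \<and>
      op_value U z a b s i x = op_value U' z' a' b' s i x"
    using assms by blast
  fix v assume "\<exists>U z a b. (U, z) \<in> A \<and> x \<in> U \<and> polar_jet z F x a b \<and> v = op_value U z a b s i x"
  then obtain V w a' b' where "(V, w) \<in> A" "x \<in> V" "polar_jet w F x a' b'" "v = op_value V w a' b' s i x"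
    by blast
  then show "v = op_value U z a b s i x"
    using op_value_jet_unique[OF assms(1-4) _ _ assms(5-8)] by blast
qed

text \<open>The map of the theorem.  The choice of a representative at each point is harmless because the
  value depends on its jet only.\<close>

definition polar_op :: "('a \<times> 'a) set \<Rightarrow> ('a \<times> 'a \<Rightarrow> ('a \<times> 'a) local_function set) \<Rightarrow> ('a, 'i) operator" where
  "polar_op W \<sigma> = (\<lambda>V s i x.
     if open V \<and> V \<subseteq> diag_vimage W \<and> s \<in> sections A L V \<and> i \<in> idx L \<and> x \<in> V \<inter> triv L i
     then kernel_op (snd (SOME NF. NF \<in> \<sigma> (x, x))) s i x else 0)"

lemma polar_op_eq:
  assumes "open V" "V \<subseteq> diag_vimage W" "s \<in> sections A L V" "i \<in> idx L" "x \<in> V" "x \<in> triv L i"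
    "(U, z) \<in> A" "x \<in> U" "represented_jet \<sigma> z x a b"
  shows "polar_op W \<sigma> V s i x = op_value U z a b s i x"
proof -
  let ?NF = "SOME NF. NF \<in> \<sigma> (x, x)"
  have "?NF \<in> \<sigma> (x, x)"
    using assms(9) unfolding represented_jet_def by (metis someI_ex ex_in_conv)
  then have "polar_jet z (snd ?NF) x a b"
    using represented_jet_element[OF assms(9), of "fst ?NF" "snd ?NF"] by simp
  from kernel_op_eq[OF assms(4,6-8,3,1,5) this] show ?thesis
    unfolding polar_op_def using assms by simp
qed

lemma polar_op_zero:
  "\<not> (open V \<and> V \<subseteq> diag_vimage W \<and> s \<in> sections A L V \<and> i \<in> idx L \<and> x \<in> V \<and> x \<in> triv L i) \<Longrightarrow> polar_op W \<sigma> V s i x = 0"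
  unfolding polar_op_def by auto

text \<open>Outside the domain of a component all values are 0 by convention, so identities between
  operators only have to be checked where a chart and a jet are available.\<close>

lemma polar_op_cases:
  assumes \<sigma>: "\<sigma> \<in> sec (polar_quotient A) W" and V: "open V" "V \<subseteq> diag_vimage W"
  obtains (inside) U z a b where "i \<in> idx L" "x \<in> V" "x \<in> triv L i" "(U, z) \<in> A" "x \<in> U" "represented_jet \<sigma> z x a b"
    | (outside) "\<not> (i \<in> idx L \<and> x \<in> V \<and> x \<in> triv L i)"
proof (cases "i \<in> idx L \<and> x \<in> V \<and> x \<in> triv L i")
  case True
  obtain U z where Uz: "(U, z) \<in> A" "x \<in> U" by (rule chart_around)
  have "(x, x) \<in> W" using True V by (auto simp: diag_vimage_def)
  from represented_jet_exists[OF \<sigma> this Uz] obtain a b where "represented_jet \<sigma> z x a b" .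
  then show ?thesis using True Uz inside by blast
qed (rule outside)

lemma polar_op_section:
  assumes \<sigma>: "\<sigma> \<in> sec (polar_quotient A) W" and V: "open V" "V \<subseteq> diag_vimage W" and s: "s \<in> sections A L V"
  shows "polar_op W \<sigma> V s \<in> sections A L V"
  unfolding section_iff[OF V(1)]
proof (intro conjI ballI allI impI)
  fix i x assume "i \<notin> idx L \<or> x \<notin> V \<inter> triv L i"
  then show "polar_op W \<sigma> V s i x = 0" by (intro polar_op_zero) auto
next
  fix i j x assume i: "i \<in> idx L" and j: "j \<in> idx L" and x: "x \<in> V \<inter> triv L i \<inter> triv L j"
  obtain U z a b where c: "(U, z) \<in> A" "x \<in> U" "represented_jet \<sigma> z x a b"
    by (rule polar_op_cases[OF \<sigma> V, of i x]) (use i x in auto)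
  then show "polar_op W \<sigma> V s i x = tf L i j x * polar_op W \<sigma> V s j x"
    using polar_op_eq[OF V s i _ _ c] polar_op_eq[OF V s j _ _ c] x op_value_index[OF i _ j _ c(1,2) s V(1)] by auto
next
  fix i x assume i: "i \<in> idx L" and x: "x \<in> V \<inter> triv L i"
  then have xW: "(x, x) \<in> W" using V by (auto simp: diag_vimage_def)
  obtain U z where c: "(U, z) \<in> A" "x \<in> U" by (rule chart_around)
  obtain N F where N: "open N" "(x, x) \<in> N" "N \<subseteq> W" "F \<in> O_plus_Delta A N"
    "\<forall>q\<in>N. \<sigma> q = stalk q `` {(N, F)}" "\<forall>q\<in>N. (N, F) \<in> \<sigma> q"
    by (rule polar_quotient_local[OF \<sigma> xW])
  obtain M a Q where M: "x \<in> M" "M \<times> M \<subseteq> N" "polar_local_form A U z F M a Q"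
    by (rule polar_local_form[OF N(1,2,4) c])
  note lf = M(3)[unfolded polar_local_form_def]
  let ?M = "M \<inter> V \<inter> triv L i"
  have op: "open ?M" "x \<in> ?M" using lf V triv_open[OF i] M x by auto
  have eq: "polar_op W \<sigma> V s i y = op_value U z (a y) (Q (y, y)) s i y" if y: "y \<in> ?M" for y
  proof (rule polar_op_eq[OF V s i _ _ c(1)])
    show "y \<in> V" "y \<in> triv L i" "y \<in> U" using y lf by auto
    have "(y, y) \<in> N" using y M(2) by auto
    then show "represented_jet \<sigma> z y (a y) (Q (y, y))"
      using y N(5,6) by (intro represented_jetI[where N = N and F = F] polar_local_form_jet[OF M(3)]) auto
  qed
  have ev: "\<forall>\<^sub>F y in nhds x. y \<in> ?M" by (rule eventually_nhds_in_open[OF op])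
  have "hol_at A (\<lambda>y. op_value U z (a y) (Q (y, y)) s i y) x"
  proof (rule hol_at_twisted_derivative[OF c])
    show "\<forall>\<^sub>F y in nhds x. hol_at A (\<rho> i (U, z)) y"
      using ev by eventually_elim (use lf in \<open>auto intro!: spin_formD(1)[OF i _ c(1)]\<close>)
    show "\<forall>\<^sub>F y in nhds x. hol_at A (s i) y"
      using ev by eventually_elim (auto intro!: section_hol[OF s V(1) i])
    show "hol_at A a x" using lf[THEN conjunct2, THEN conjunct2, THEN conjunct1] M(1) by (rule bspec)
    have "(x, x) \<in> M \<times> M" using M(1) by blast
    with lf[THEN conjunct2, THEN conjunct2, THEN conjunct2, THEN conjunct1] have "hol2_at A Q (x, x)"
      by (rule bspec)
    then show "hol_at A (\<lambda>y. Q (y, y)) x" by (rule hol_at_diagonal)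
    show "\<rho> i (U, z) x \<noteq> 0" using x by (intro spin_formD(2)[OF i _ c]) auto
  qed
  then show "hol_at A (polar_op W \<sigma> V s i) x"
    by (rule hol_at_cong) (use ev in \<open>eventually_elim, simp add: eq\<close>)
qed

lemma sadd_section:
  assumes "open V" "s \<in> sections A L V" "t \<in> sections A L V"
  shows "sadd s t \<in> sections A L V"
  unfolding section_iff[OF assms(1)]
proof (intro conjI ballI allI impI)
  fix i x assume "i \<notin> idx L \<or> x \<notin> V \<inter> triv L i"
  then show "sadd s t i x = 0"
    using section_zero[OF assms(2), of i x] section_zero[OF assms(3), of i x] by (auto simp: sadd_def)
next
  fix i x assume "i \<in> idx L" "x \<in> V \<inter> triv L i"
  then show "hol_at A (sadd s t i) x"
    using section_hol[OF assms(2,1)] section_hol[OF assms(3,1)] unfolding sadd_def by (intro hol_at_add) auto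
next
  fix i j x assume "i \<in> idx L" "j \<in> idx L" "x \<in> V \<inter> triv L i \<inter> triv L j"
  then show "sadd s t i x = tf L i j x * sadd s t j x"
    using section_tf[OF assms(2), of i j x] section_tf[OF assms(3), of i j x] by (simp add: sadd_def distrib_left)
qed

lemma fscale_section_hol_at:
  assumes "open V" "s \<in> sections A L V" "\<And>x. x \<in> V \<Longrightarrow> hol_at A f x"
  shows "fscale f s \<in> sections A L V"
  using assms by (intro fscale_section) (simp_all add: hol_on_iff)

lemma polar_op_fscale:
  assumes "open V" "V \<subseteq> diag_vimage W" "s \<in> sections A L V" "i \<in> idx L" "x \<in> V" "x \<in> triv L i"
    "(U, z) \<in> A" "x \<in> U" "represented_jet \<sigma> z x a b" and f: "\<And>y. y \<in> V \<Longrightarrow> hol_at A f y"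
  shows "polar_op W \<sigma> V (fscale f s) i x = f x * polar_op W \<sigma> V s i x + a * param_deriv U z f x * s i x"
proof -
  have fs: "fscale f s \<in> sections A L V"
    using assms(1,3) f by (rule fscale_section_hol_at)
  have "op_value U z a b (fscale f s) i x = f x * op_value U z a b s i x + a * param_deriv U z f x * s i x"
    unfolding fscale_def using assms
    by (intro twisted_derivative_mult section_hol[OF assms(3,1)]) auto
  then show ?thesis
    using polar_op_eq[OF assms(1-9)] polar_op_eq[OF assms(1,2) fs assms(4-9)] by simp
qed

lemma polar_op_diffop:
  assumes \<sigma>: "\<sigma> \<in> sec (polar_quotient A) W"
  shows "polar_op W \<sigma> \<in> diffops1 A L (diag_vimage W)"
  unfolding diffops1_def mem_Collect_eq
proof (intro conjI allI impI ballI)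
  fix V s assume "\<not> (open V \<and> V \<subseteq> diag_vimage W \<and> s \<in> sections A L V)"
  then show "polar_op W \<sigma> V s = (\<lambda>i x. 0)" by (intro ext polar_op_zero) auto
next
  fix V s assume "open V \<and> V \<subseteq> diag_vimage W" "s \<in> sections A L V"
  then show "polar_op W \<sigma> V s \<in> sections A L V" using polar_op_section[OF \<sigma>] by blast
next
  fix V s t assume "open V \<and> V \<subseteq> diag_vimage W" and s: "s \<in> sections A L V" and t: "t \<in> sections A L V"
  then have V: "open V" "V \<subseteq> diag_vimage W" by auto
  show "polar_op W \<sigma> V (sadd s t) = sadd (polar_op W \<sigma> V s) (polar_op W \<sigma> V t)"
  proof (intro ext)
    fix i x
    show "polar_op W \<sigma> V (sadd s t) i x = sadd (polar_op W \<sigma> V s) (polar_op W \<sigma> V t) i x"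
    proof (cases rule: polar_op_cases[OF \<sigma> V , of i x, case_names inside outside])
      case (inside U z a b)
      have "op_value U z a b (sadd s t) i x = op_value U z a b s i x + op_value U z a b t i x"
        unfolding sadd_def using inside V s t
        by (intro twisted_derivative_add section_hol[of _ V]) auto
      then show ?thesis
        using polar_op_eq[OF V s inside] polar_op_eq[OF V t inside] polar_op_eq[OF V sadd_section[OF V(1) s t] inside]
        by (simp add: sadd_def[of "polar_op W \<sigma> V s"])
    next
      case outside
      then show ?thesis by (simp add: polar_op_zero sadd_def)
    qed
  qed
next
  fix V c s assume "open V \<and> V \<subseteq> diag_vimage W" and s: "s \<in> sections A L V"
  then have V: "open V" "V \<subseteq> diag_vimage W" by auto
  show "polar_op W \<sigma> V (fscale (\<lambda>_. c) s) = fscale (\<lambda>_. c) (polar_op W \<sigma> V s)"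
  proof (intro ext)
    fix i x
    show "polar_op W \<sigma> V (fscale (\<lambda>_. c) s) i x = fscale (\<lambda>_. c) (polar_op W \<sigma> V s) i x"
    proof (cases rule: polar_op_cases[OF \<sigma> V , of i x, case_names inside outside])
      case (inside U z a b)
      then show ?thesis
        using polar_op_fscale[OF V s inside, of "\<lambda>_. c"] by (simp add: fscale_def param_deriv_const hol_at_const)
    next
      case outside
      then show ?thesis by (simp add: polar_op_zero fscale_def)
    qed
  qed
next
  fix V V' s assume "open V \<and> V \<subseteq> diag_vimage W" and "open V' \<and> V' \<subseteq> V \<and> s \<in> sections A L V"
  then have V: "open V" "V \<subseteq> diag_vimage W" and V': "open V'" "V' \<subseteq> V" "V' \<subseteq> diag_vimage W"
    and s: "s \<in> sections A L V" by auto
  show "polar_op W \<sigma> V' (srestr V' s) = srestr V' (polar_op W \<sigma> V s)"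
  proof (intro ext)
    fix i x
    show "polar_op W \<sigma> V' (srestr V' s) i x = srestr V' (polar_op W \<sigma> V s) i x"
    proof (cases rule: polar_op_cases[OF \<sigma> V'(1,3) , of i x, case_names inside outside])
      case (inside U z a b)
      then have xV: "x \<in> V" using V' by blast
      have "\<forall>\<^sub>F y in nhds x. srestr V' s i y = s i y"
        using eventually_nhds_in_open[OF V'(1) inside(2)] by eventually_elim (simp add: srestr_def restr_def)
      from twisted_derivative_cong[OF this inside(4,5)]
      show ?thesis
        using polar_op_eq[OF V s inside(1) xV inside(3-6)] inside(2)
          polar_op_eq[OF V'(1,3) srestr_section[OF riemann s V'(2)] inside]
        by (simp add: srestr_def restr_def)
    next
      case outside
      then show ?thesis by (auto simp: polar_op_zero srestr_def restr_def)
    qed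
  qed
next
  fix V f g s i x
  assume "open V \<and> V \<subseteq> diag_vimage W" and f: "f \<in> O_X A V" and g: "g \<in> O_X A V" and s: "s \<in> sections A L V"
  then have V: "open V" "V \<subseteq> diag_vimage W" by auto
  have f': "\<And>y. y \<in> V \<Longrightarrow> hol_at A f y" and g': "\<And>y. y \<in> V \<Longrightarrow> hol_at A g y"
    using f g by (auto simp: O_X_iff[OF V(1)])
  show "polar_op W \<sigma> V (fscale f (fscale g s)) i x - f x * polar_op W \<sigma> V (fscale g s) i x
      - g x * polar_op W \<sigma> V (fscale f s) i x + g x * f x * polar_op W \<sigma> V s i x = 0"
  proof (cases rule: polar_op_cases[OF \<sigma> V, of i x, case_names inside outside])
    case (inside U z a b)
    show ?thesis
      using polar_op_fscale[OF V s inside f'] polar_op_fscale[OF V s inside g']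
        polar_op_fscale[OF V fscale_section_hol_at[OF V(1) s g'] inside f']
      by (simp add: fscale_def[of g s] algebra_simps)
  next
    case outside
    then show ?thesis by (simp add: polar_op_zero)
  qed
qed

lemma polar_op_add:
  assumes \<sigma>: "\<sigma> \<in> sec (polar_quotient A) W" and \<tau>: "\<tau> \<in> sec (polar_quotient A) W"
  shows "polar_op W (add (polar_quotient A) W \<sigma> \<tau>) = add (D1_sheaf A L) W (polar_op W \<sigma>) (polar_op W \<tau>)"
proof (intro ext)
  fix V s i x
  let ?add = "add (polar_quotient A) W \<sigma> \<tau>"
  show "polar_op W ?add V s i x = add (D1_sheaf A L) W (polar_op W \<sigma>) (polar_op W \<tau>) V s i x"
  proof (cases "open V \<and> V \<subseteq> diag_vimage W \<and> s \<in> sections A L V")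
    case True
    then have V: "open V" "V \<subseteq> diag_vimage W" and s: "s \<in> sections A L V" by auto
    show ?thesis
    proof (cases rule: polar_op_cases[OF \<sigma> V , of i x, case_names inside outside])
      case (inside U z a b)
      then have "(x, x) \<in> W" using V by (auto simp: diag_vimage_def)
      from represented_jet_exists[OF \<tau> this inside(4,5)] obtain a' b' where j: "represented_jet \<tau> z x a' b'" .
      show ?thesis
        using polar_op_eq[OF V s inside] polar_op_eq[OF V s inside(1-5) j]
          polar_op_eq[OF V s inside(1-5) represented_jet_add[OF \<sigma> \<tau> inside(6) j]]
        by (simp add: D1_sheaf_def sadd_def twisted_derivative_jet_add)
    next
      case outside
      then show ?thesis by (simp add: polar_op_zero D1_sheaf_def sadd_def)
    qed
  next
    case False
    then have "polar_op W \<sigma>' V s i x = 0" for \<sigma>' by (intro polar_op_zero) blast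
    then show ?thesis by (simp add: D1_sheaf_def sadd_def)
  qed
qed

lemma polar_op_scale:
  assumes W: "open W" and \<sigma>: "\<sigma> \<in> sec (polar_quotient A) W" and h: "h \<in> O_XX A W"
  shows "polar_op W (scale (polar_quotient A) W h \<sigma>) = scale (D1_sheaf A L) W h (polar_op W \<sigma>)"
proof (intro ext)
  fix V s i x
  let ?sc = "scale (polar_quotient A) W h \<sigma>"
  have hol: "\<And>p. p \<in> W \<Longrightarrow> hol2_at A h p" using h unfolding O_XX_iff[OF W] by blast
  show "polar_op W ?sc V s i x = scale (D1_sheaf A L) W h (polar_op W \<sigma>) V s i x"
  proof (cases "open V \<and> V \<subseteq> diag_vimage W \<and> s \<in> sections A L V")
    case True
    then have V: "open V" "V \<subseteq> diag_vimage W" and s: "s \<in> sections A L V" by auto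
    define V' where "V' = {y \<in> V. (x, y) \<in> W}"
    have "open (Pair x -` W)"
      using W by (intro open_vimage continuous_intros)
    then have V': "open V'" "V' \<subseteq> V" "V' \<subseteq> diag_vimage W"
      using V by (auto simp: V'_def vimage_def Collect_conj_eq)
    have hx: "hol_at A (\<lambda>y. h (x, y)) y" if "y \<in> V'" for y
      using that by (intro hol_at_slice hol) (simp add: V'_def)
    let ?s = "srestr V' s"
    have s': "?s \<in> sections A L V'" by (rule srestr_section[OF riemann s V'(2)])
    have rhs: "scale (D1_sheaf A L) W h (polar_op W \<sigma>) V s i x = polar_op W \<sigma> V' (fscale (\<lambda>y. h (x, y)) ?s) i x"
      using True by (simp add: D1_sheaf_def bimodule_action_def V'_def Let_def)
    show ?thesis
    proof (cases rule: polar_op_cases[OF \<sigma> V , of i x, case_names inside outside])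
      case (inside U z a b)
      then have xV': "x \<in> V'" using V by (auto simp: V'_def diag_vimage_def)
      have "polar_op W \<sigma> V' (fscale (\<lambda>y. h (x, y)) ?s) i x
          = h (x, x) * polar_op W \<sigma> V' ?s i x + a * param_deriv U z (\<lambda>y. h (x, y)) x * ?s i x"
        by (rule polar_op_fscale[OF V'(1,3) s' inside(1) xV' inside(3-6) hx])
      also have "?s i x = s i x" using xV' by (simp add: srestr_def restr_def)
      also have "polar_op W \<sigma> V' ?s i x = op_value U z a b ?s i x"
        by (rule polar_op_eq[OF V'(1,3) s' inside(1) xV' inside(3-6)])
      also have "\<dots> = op_value U z a b s i x"
        by (rule twisted_derivative_cong[OF _ inside(4,5)])
          (use eventually_nhds_in_open[OF V'(1) xV'] in \<open>eventually_elim, simp add: srestr_def restr_def\<close>)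
      finally show ?thesis
        using polar_op_eq[OF V s inside(1-5) represented_jet_scale[OF W \<sigma> h inside(4-6)]]
        by (simp add: rhs twisted_derivative_jet_scale)
    next
      case outside
      then have "\<not> (i \<in> idx L \<and> x \<in> V' \<and> x \<in> triv L i)" using V' by blast
      then show ?thesis using outside unfolding rhs by (simp add: polar_op_zero)
    qed
  next
    case False
    then have "polar_op W ?sc V s i x = 0" by (intro polar_op_zero) blast
    then show ?thesis
      by (simp only: D1_sheaf_def bimodule_action_def sheaf_of_modules.simps if_not_P[OF False])
  qed
qed

lemma polar_op_res:
  assumes "V \<subseteq> W"
  shows "polar_op V (res (polar_quotient A) W V \<sigma>) = res (D1_sheaf A L) W V (polar_op W \<sigma>)"
proof (intro ext)
  fix N s i x
  have "diag_vimage V \<subseteq> diag_vimage W" using assms by (auto simp: diag_vimage_def)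
  then show "polar_op V (res (polar_quotient A) W V \<sigma>) N s i x = res (D1_sheaf A L) W V (polar_op W \<sigma>) N s i x"
    by (auto simp: polar_op_def D1_sheaf_def polar_quotient_def quotient_sheaf_def diag_vimage_def subset_iff)
qed

end

context spin_surface
begin

section \<open>From operators back to polar parts\<close>

text \<open>Testing on a frame \<open>e\<close> and on \<open>z e\<close> recovers first \<open>b + a c'/(2c)\<close> and then \<open>a\<close>.\<close>

lemma op_value_determines_jet:
  assumes c: "(U, z) \<in> A" "x \<in> U" and V0: "open V0" "x \<in> V0"
    and eq: "\<And>V s i. open V \<Longrightarrow> x \<in> V \<Longrightarrow> V \<subseteq> V0 \<Longrightarrow> s \<in> sections A L V \<Longrightarrow> i \<in> idx L \<Longrightarrow> x \<in> triv L i \<Longrightarrow>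
      op_value U z a b s i x = op_value U z a' b' s i x"
  shows "a = a' \<and> b = b'"
proof -
  obtain i where i: "i \<in> idx L" "x \<in> triv L i" by (rule triv_around)
  let ?V = "V0 \<inter> U \<inter> triv L i"
  have V: "open ?V" "x \<in> ?V" using V0 c is_chartD(1)[OF chart[OF c(1)]] triv_open[OF i(1)] i by auto
  have sub: "?V \<subseteq> V0" by blast
  let ?e = "frame i ?V"
  have e: "?e \<in> sections A L ?V" by (rule frame_section[OF i(1) V(1)]) auto
  have ze: "fscale z ?e \<in> sections A L ?V"
    by (rule fscale_section_hol_at[OF V(1) e hol_at_chart[OF c(1)]]) auto
  have e1: "\<forall>\<^sub>F y in nhds x. ?e i y = 1"
    using eventually_nhds_in_open[OF V] by eventually_elim (rule frame_self[OF i(1)], auto)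
  have "\<forall>\<^sub>F y in nhds x. fscale z ?e i y = z y"
    using e1 by eventually_elim (simp add: fscale_def)
  then have val_z: "op_value U z a b (fscale z ?e) i x = op_value U z a b (\<lambda>_. z) i x" for a b
    by (rule twisted_derivative_cong[OF _ c])
  have val_1: "op_value U z a b ?e i x = op_value U z a b (\<lambda>_ _. 1) i x" for a b
    by (rule twisted_derivative_cong[OF e1 c])
  let ?k = "\<lambda>a b. a * param_deriv U z (\<rho> i (U, z)) x / (2 * \<rho> i (U, z) x) + b"
  have "?k a b = ?k a' b'"
    using eq[OF V sub e i] unfolding val_1 by (simp add: twisted_derivative_def param_deriv_const)
  moreover have "a + ?k a b * z x = a' + ?k a' b' * z x"
    using eq[OF V sub ze i] unfolding val_z by (simp add: twisted_derivative_def param_deriv_self[OF c])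
  ultimately have "a = a'" by simp
  with \<open>?k a b = ?k a' b'\<close> show ?thesis by simp
qed

lemma polar_op_inj:
  assumes W: "open W" and \<sigma>: "\<sigma> \<in> sec (polar_quotient A) W" and \<tau>: "\<tau> \<in> sec (polar_quotient A) W"
    and eq: "polar_op W \<sigma> = polar_op W \<tau>"
  shows "\<sigma> = \<tau>"
proof
  fix p
  show "\<sigma> p = \<tau> p"
  proof (cases "p \<in> W")
    case False
    then show ?thesis using \<sigma> \<tau> unfolding polar_quotient_sec by blast
  next
    case True
    obtain x y where p: "p = (x, y)" by (cases p)
    obtain N F where N: "open N" "p \<in> N" "N \<subseteq> W" "F \<in> O_plus_Delta A N"
      "\<forall>q\<in>N. \<sigma> q = stalk q `` {(N, F)}" "\<forall>q\<in>N. (N, F) \<in> \<sigma> q"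
      by (rule polar_quotient_local[OF \<sigma> True])
    obtain N' F' where N': "open N'" "p \<in> N'" "N' \<subseteq> W" "F' \<in> O_plus_Delta A N'"
      "\<forall>q\<in>N'. \<tau> q = stalk q `` {(N', F')}" "\<forall>q\<in>N'. (N', F') \<in> \<tau> q"
      by (rule polar_quotient_local[OF \<tau> True])
    have "((N, F), (N', F')) \<in> stalk p"
    proof (cases "x = y")
      case False
      then show ?thesis unfolding p
        using N(1,2,4) N'(1,2,4) p by (intro stalk_off_diagonal) auto
    next
      case True
      with p have px: "p = (x, x)" by simp
      let ?M = "diag_vimage (N \<inter> N')"
      obtain U z where c: "(U, z) \<in> A" "x \<in> U" by (rule chart_around)
      have M: "open ?M" "x \<in> ?M" using open_diag_vimage[of "N \<inter> N'"] N(1,2) N'(1,2) px by (auto simp: diag_vimage_def)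
      have MW: "?M \<subseteq> diag_vimage W" using N(3) by (auto simp: diag_vimage_def)
      show ?thesis
        unfolding px
      proof (rule stalk_of_polar_jet[OF N(1) N(2)[unfolded px] N(4) N'(1) N'(2)[unfolded px] N'(4) c M])
        fix y a b a' b'
        assume y: "y \<in> ?M" "y \<in> U" and j: "polar_jet z F y a b" "polar_jet z F' y a' b'"
        have yN: "(y, y) \<in> N" "(y, y) \<in> N'" using y by (auto simp: diag_vimage_def)
        have r: "represented_jet \<sigma> z y a b" "represented_jet \<tau> z y a' b'"
          using represented_jetI[of \<sigma> y N F, OF N(5)[rule_format, OF yN(1)] N(6)[rule_format, OF yN(1)] j(1)]
            represented_jetI[of \<tau> y N' F', OF N'(5)[rule_format, OF yN(2)] N'(6)[rule_format, OF yN(2)] j(2)] .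
        show "a = a' \<and> b = b'"
        proof (rule op_value_determines_jet[OF c(1) y(2) M(1) y(1)])
          fix V s i
          assume V: "open V" "y \<in> V" "V \<subseteq> ?M" and s: "s \<in> sections A L V" and i: "i \<in> idx L" "y \<in> triv L i"
          have VW: "V \<subseteq> diag_vimage W" using V(3) MW by blast
          show "op_value U z a b s i y = op_value U z a' b' s i y"
            using polar_op_eq[OF V(1) VW s i(1) V(2) i(2) c(1) y(2) r(1)]
              polar_op_eq[OF V(1) VW s i(1) V(2) i(2) c(1) y(2) r(2)] eq by simp
        qed
      qed
    qed
    from stalk_class_eq[OF this] show ?thesis
      using N(2,5) N'(2,5) by simp
  qed
qed

text \<open>All sections near \<open>x\<close> and all frames are tested, so that the notion can be transported between
  neighbourhoods and parameters and still determines \<open>(a, b)\<close>.\<close>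

definition has_symbol :: "'a set \<Rightarrow> ('a, 'i) operator \<Rightarrow> 'a set \<Rightarrow> ('a \<Rightarrow> complex) \<Rightarrow> 'a \<Rightarrow> complex \<Rightarrow> complex \<Rightarrow> bool" where
  "has_symbol Y D U z x a b \<longleftrightarrow> (\<forall>V s i. open V \<and> V \<subseteq> Y \<and> x \<in> V \<and> s \<in> sections A L V \<and> i \<in> idx L \<and> x \<in> triv L i \<longrightarrow>
     D V s i x = op_value U z a b s i x)"

lemma has_symbol_change:
  assumes "has_symbol Y D U z x a b" and c: "(U, z) \<in> A" "x \<in> U" and c': "(V, w) \<in> A" "x \<in> V"
    and j: "polar_jet z F x a b" "polar_jet w F x a' b'"
  shows "has_symbol Y D V w x a' b'"
  unfolding has_symbol_def
proof (intro allI impI, elim conjE)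
  fix V' s i
  assume V': "open V'" "V' \<subseteq> Y" "x \<in> V'" and s: "s \<in> sections A L V'" and i: "i \<in> idx L" "x \<in> triv L i"
  have "D V' s i x = op_value U z a b s i x"
    using assms(1) V' s i unfolding has_symbol_def by blast
  then show "D V' s i x = op_value V w a' b' s i x"
    using op_value_jet_unique[OF i c c' s V'(1,3) j] by simp
qed

lemma has_symbol_unique:
  assumes "has_symbol Y D U z x a b" "has_symbol Y D U z x a' b'" "(U, z) \<in> A" "x \<in> U" "open Y" "x \<in> Y"
  shows "a = a' \<and> b = b'"
proof (rule op_value_determines_jet[OF assms(3-6)])
  fix V s i assume "open V" "x \<in> V" "V \<subseteq> Y" "s \<in> sections A L V" "i \<in> idx L" "x \<in> triv L i"
  then have "D V s i x = op_value U z a b s i x" "D V s i x = op_value U z a' b' s i x"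
    using assms(1,2) unfolding has_symbol_def by blast+
  then show "op_value U z a b s i x = op_value U z a' b' s i x" by simp
qed

lemma diffopsD:
  assumes "D \<in> diffops1 A L Y"
  shows "\<And>V s. \<not> (open V \<and> V \<subseteq> Y \<and> s \<in> sections A L V) \<Longrightarrow> D V s = (\<lambda>i x. 0)"
    and "\<And>V s. open V \<Longrightarrow> V \<subseteq> Y \<Longrightarrow> s \<in> sections A L V \<Longrightarrow> D V s \<in> sections A L V"
    and "\<And>V s t. open V \<Longrightarrow> V \<subseteq> Y \<Longrightarrow> s \<in> sections A L V \<Longrightarrow> t \<in> sections A L V \<Longrightarrow>
      D V (sadd s t) = sadd (D V s) (D V t)"
    and "\<And>V c s. open V \<Longrightarrow> V \<subseteq> Y \<Longrightarrow> s \<in> sections A L V \<Longrightarrow>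
      D V (fscale (\<lambda>_. c) s) = fscale (\<lambda>_. c) (D V s)"
    and "\<And>V V' s. open V \<Longrightarrow> V \<subseteq> Y \<Longrightarrow> s \<in> sections A L V \<Longrightarrow> open V' \<Longrightarrow> V' \<subseteq> V \<Longrightarrow>
      D V' (srestr V' s) = srestr V' (D V s)"
    and "\<And>V f g s i x. open V \<Longrightarrow> V \<subseteq> Y \<Longrightarrow> s \<in> sections A L V \<Longrightarrow> f \<in> O_X A V \<Longrightarrow> g \<in> O_X A V \<Longrightarrow>
      D V (fscale f (fscale g s)) i x - f x * D V (fscale g s) i x - g x * D V (fscale f s) i x + g x * f x * D V s i x = 0"
proof -
  note 0 = assms[unfolded diffops1_def mem_Collect_eq]
  show "D V s = (\<lambda>i x. 0)" if "\<not> (open V \<and> V \<subseteq> Y \<and> s \<in> sections A L V)" for V s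
    using 0[THEN conjunct1] that by blast
  note 1 = 0[THEN conjunct2, THEN spec, THEN mp, OF conjI]
  show "D V s \<in> sections A L V" if "open V" "V \<subseteq> Y" "s \<in> sections A L V" for V s
    using 1[OF that(1,2), THEN conjunct1] that(3) by blast
  show "D V (sadd s t) = sadd (D V s) (D V t)"
    if "open V" "V \<subseteq> Y" "s \<in> sections A L V" "t \<in> sections A L V" for V s t
    using 1[OF that(1,2), THEN conjunct2, THEN conjunct1] that(3,4) by blast
  show "D V (fscale (\<lambda>_. c) s) = fscale (\<lambda>_. c) (D V s)"
    if "open V" "V \<subseteq> Y" "s \<in> sections A L V" for V c s
    using 1[OF that(1,2), THEN conjunct2, THEN conjunct2, THEN conjunct1] that(3) by blast
  show "D V' (srestr V' s) = srestr V' (D V s)"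
    if "open V" "V \<subseteq> Y" "s \<in> sections A L V" "open V'" "V' \<subseteq> V" for V V' s
    using 1[OF that(1,2), THEN conjunct2, THEN conjunct2, THEN conjunct2, THEN conjunct1] that(3-5) by blast
  show "D V (fscale f (fscale g s)) i x - f x * D V (fscale g s) i x - g x * D V (fscale f s) i x + g x * f x * D V s i x = 0"
    if "open V" "V \<subseteq> Y" "s \<in> sections A L V" "f \<in> O_X A V" "g \<in> O_X A V" for V f g s i x
    using 1[OF that(1,2), THEN conjunct2, THEN conjunct2, THEN conjunct2, THEN conjunct2] that(3-5) by blast
qed

lemma hol_at_surface_quotient:
  assumes c: "(U, z) \<in> A" and V: "open V" "V \<subseteq> U" and f: "\<And>y. y \<in> V \<Longrightarrow> hol_at A f y" and x: "x \<in> V" and y: "y \<in> V"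
  shows "hol_at A (\<lambda>y. if y = x then param_deriv U z f x else (f y - f x) / (z y - z x)) y"
proof -
  let ?g = "f \<circ> inv_into U z"
  note ch = chart[OF c]
  note inv = is_chartD(5)[OF ch]
  have op: "open (z ` V)" using open_chart_image[OF ch V(1)] V(2) by (simp add: Int_absorb1)
  have "hol_on A V f" using f by (simp add: hol_on_iff[OF V(1)])
  then have "?g holomorphic_on z ` (U \<inter> V)" using c unfolding hol_on_def by blast
  then have "?g holomorphic_on z ` V" using V(2) by (simp add: Int_absorb1)
  from pole_lemma_open[OF this op, of "z x"]
  have q: "(\<lambda>w. if w = z x then deriv ?g (z x) else (?g w - ?g (z x)) / (w - z x)) holomorphic_on z ` V" .
  show ?thesis
  proof (rule hol_atI[OF c])
    show "y \<in> U" using y V by blast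
    have "(\<lambda>w. if w = z x then deriv ?g (z x) else (?g w - ?g (z x)) / (w - z x)) field_differentiable at (z y)"
      by (rule holomorphic_on_imp_differentiable_at[OF q op]) (use y in blast)
    moreover have "\<forall>\<^sub>F w in nhds (z y). w \<in> z ` V"
      by (rule eventually_nhds_in_open[OF op]) (use y in blast)
    then have "\<forall>\<^sub>F w in nhds (z y). (if w = z x then deriv ?g (z x) else (?g w - ?g (z x)) / (w - z x))
        = ((\<lambda>y. if y = x then param_deriv U z f x else (f y - f x) / (z y - z x)) \<circ> inv_into U z) w"
    proof eventually_elim
      case (elim w)
      then obtain t where t: "w = z t" "t \<in> V" by blast
      have U: "t \<in> U" "x \<in> U" using t x V by auto
      then have "z t = z x \<longleftrightarrow> t = x" using is_chartD(6)[OF ch] by (auto dest: inj_onD)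
      then show ?case using U inv by (simp add: t(1) param_deriv_def)
    qed
    ultimately show "((\<lambda>y. if y = x then param_deriv U z f x else (f y - f x) / (z y - z x)) \<circ> inv_into U z)
        field_differentiable at (z y)"
      by (rule field_differentiable_cong_nhds)
  qed
qed

lemma restr_O_X:
  assumes "open V" "\<And>y. y \<in> V \<Longrightarrow> hol_at A f y"
  shows "restr V f \<in> O_X A V"
  unfolding O_X_iff[OF assms(1)]
proof (intro conjI ballI allI impI)
  fix y assume y: "y \<in> V"
  show "hol_at A (restr V f) y"
    by (rule hol_at_cong[OF assms(2)[OF y]])
      (use eventually_nhds_in_open[OF assms(1) y] in \<open>eventually_elim, simp add: restr_def\<close>)
next
  fix y assume "y \<notin> V"
  then show "restr V f y = 0" unfolding restr_def by (rule if_not_P)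
qed

lemma fscale_restr:
  assumes "s \<in> sections A L V"
  shows "fscale (restr V f) s = fscale f s"
proof (intro ext)
  fix i x show "fscale (restr V f) s i x = fscale f s i x"
    using section_zero[OF assms, of i x] by (auto simp: fscale_def restr_def)
qed

text \<open>Write \<open>f = f(x) + (z - z(x)) g\<close> with \<open>g\<close> holomorphic and \<open>g(x) = f'(x)\<close>.  Since
  \<open>[[D, z - z(x)], g] = 0\<close> and \<open>z - z(x)\<close> vanishes at \<open>x\<close>, evaluating \<open>D((z - z(x)) g e)\<close> at \<open>x\<close> leaves only
  \<open>g(x) D((z - z(x)) e)(x)\<close>.\<close>

lemma diffop_fscale:
  assumes D: "D \<in> diffops1 A L Y" and V: "open V" "V \<subseteq> Y" "V \<subseteq> U" and c: "(U, z) \<in> A" and e: "e \<in> sections A L V"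
    and f: "\<And>y. y \<in> V \<Longrightarrow> hol_at A f y" and x: "x \<in> V"
  shows "D V (fscale f e) i x = f x * D V e i x + param_deriv U z f x * (D V (fscale z e) i x - z x * D V e i x)"
proof -
  note d = diffopsD[OF D]
  \<comment> \<open>The function \<open>g\<close> with \<open>f = f(x) + u g\<close>, where \<open>u = z - z(x)\<close> vanishes at \<open>x\<close>.\<close>
  define g where "g y = (if y = x then param_deriv U z f x else (f y - f x) / (z y - z x))" for y
  define u where "u y = z y - z x" for y
  have g: "hol_at A g y" if "y \<in> V" for y
    unfolding g_def[abs_def] by (rule hol_at_surface_quotient[OF c V(1,3) f x that])
  have z: "hol_at A z y" if "y \<in> V" for y
    using that V by (intro hol_at_chart[OF c]) auto
  have u: "hol_at A u y" if "y \<in> V" for y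
    unfolding u_def[abs_def] using z[OF that] by (intro hol_at_diff hol_at_const)
  have f_eq: "f y = f x + u y * g y" if "y \<in> V" for y
  proof -
    have "y \<in> U" "x \<in> U" using that x V by auto
    then have "z y = z x \<longleftrightarrow> y = x" using is_chartD(6)[OF chart[OF c]] by (auto dest: inj_onD)
    then show ?thesis by (auto simp: g_def u_def)
  qed
  let ?u = "restr V u" and ?g = "restr V g"
  have ug: "?u \<in> O_X A V" "?g \<in> O_X A V" using restr_O_X[OF V(1)] u g by auto
  have ge: "fscale ?g e \<in> sections A L V" and ue: "fscale ?u e \<in> sections A L V" and ze: "fscale z e \<in> sections A L V"
    and ce: "\<And>k. fscale (\<lambda>_. k) e \<in> sections A L V"
    unfolding fscale_restr[OF e] using fscale_section_hol_at[OF V(1) e] g u z hol_at_const by blast+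
  have uge: "fscale ?u (fscale ?g e) \<in> sections A L V"
    unfolding fscale_restr[OF ge] using fscale_section_hol_at[OF V(1) ge] u by blast
  have "fscale f e = sadd (fscale (\<lambda>_. f x) e) (fscale ?u (fscale ?g e))"
  proof (intro ext)
    fix j y
    show "fscale f e j y = sadd (fscale (\<lambda>_. f x) e) (fscale ?u (fscale ?g e)) j y"
    proof (cases "y \<in> V")
      case True
      then show ?thesis by (simp add: fscale_def sadd_def restr_def f_eq algebra_simps)
    next
      case False
      then show ?thesis using section_zero[OF e, of j y] by (simp add: fscale_def sadd_def)
    qed
  qed
  then have "D V (fscale f e) i x = sadd (fscale (\<lambda>_. f x) (D V e)) (D V (fscale ?u (fscale ?g e))) i x"
    by (simp only: d(3)[OF V(1,2) ce uge] d(4)[OF V(1,2) e])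
  then have "D V (fscale f e) i x = f x * D V e i x + D V (fscale ?u (fscale ?g e)) i x"
    by (simp add: sadd_def fscale_def[of "\<lambda>_. f x"])
  moreover have "D V (fscale ?u (fscale ?g e)) i x = g x * D V (fscale ?u e) i x"
    using d(6)[OF V(1,2) e ug, of i x] x by (simp add: restr_def u_def)
  moreover have "D V (fscale ?u e) i x = D V (fscale z e) i x - z x * D V e i x"
  proof -
    have "fscale ?u e = sadd (fscale z e) (fscale (\<lambda>_. - z x) e)"
      unfolding fscale_restr[OF e] by (simp add: fscale_def sadd_def u_def fun_eq_iff algebra_simps)
    then have "D V (fscale ?u e) i x = sadd (D V (fscale z e)) (fscale (\<lambda>_. - z x) (D V e)) i x"
      by (simp only: d(3)[OF V(1,2) ze ce] d(4)[OF V(1,2) e])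
    then show ?thesis by (simp add: sadd_def fscale_def[of "\<lambda>_. - z x"])
  qed
  ultimately show ?thesis by (simp add: g_def)
qed

text \<open>In a frame \<open>e\<close> the coefficients are \<open>a e = D(z e) - z D e\<close> and \<open>D e = (b + a c'/(2c)) e\<close>; they are
  holomorphic because \<open>D\<close> maps holomorphic sections to holomorphic sections.\<close>

lemma diffop_local_symbol:
  assumes D: "D \<in> diffops1 A L Y" and Y: "open Y" "x0 \<in> Y" and c: "(U, z) \<in> A" "x0 \<in> U"
  obtains M a b where "open M" "x0 \<in> M" "M \<subseteq> U" "M \<subseteq> Y" "\<forall>x\<in>M. hol_at A a x" "\<forall>x\<in>M. hol_at A b x"
    "\<forall>x\<in>M. has_symbol Y D U z x (a x) (b x)"
proof -
  note d = diffopsD[OF D]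
  obtain i where i: "i \<in> idx L" "x0 \<in> triv L i" by (rule triv_around)
  define M where "M = Y \<inter> U \<inter> triv L i"
  have M: "open M" "x0 \<in> M" "M \<subseteq> U" "M \<subseteq> Y" "M \<subseteq> triv L i"
    using Y c i is_chartD(1)[OF chart[OF c(1)]] triv_open[OF i(1)] by (auto simp: M_def)
  let ?e = "frame i M"
  have e: "?e \<in> sections A L M" by (rule frame_section[OF i(1) M(1,5)])
  have ze: "fscale z ?e \<in> sections A L M"
    by (rule fscale_section_hol_at[OF M(1) e hol_at_chart[OF c(1)]]) (use M in auto)
  define a where "a x = D M (fscale z ?e) i x - z x * D M ?e i x" for x
  define b where "b x = D M ?e i x - a x * param_deriv U z (\<rho> i (U, z)) x / (2 * \<rho> i (U, z) x)" for x
  have hol_e: "hol_at A (D M ?e i) x" "hol_at A (D M (fscale z ?e) i) x" if "x \<in> M" for x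
    using section_hol[OF d(2)[OF M(1,4) e] M(1) i(1) that] section_hol[OF d(2)[OF M(1,4) ze] M(1) i(1) that]
      that M(5) by auto
  have hol_z: "hol_at A z x" if "x \<in> M" for x using that M by (intro hol_at_chart[OF c(1)]) auto
  have a: "hol_at A a x" if "x \<in> M" for x
    unfolding a_def[abs_def] using that by (intro hol_at_diff hol_at_mult hol_e hol_z)
  have b: "hol_at A b x" if x: "x \<in> M" for x
  proof -
    have c': "x \<in> triv L i" "x \<in> U" using x M by auto
    have "\<forall>\<^sub>F y in nhds x. hol_at A (\<rho> i (U, z)) y"
      using eventually_domain[OF i(1) c'(1) c(1) c'(2)] by eventually_elim (rule spin_formD(1)[OF i(1) _ c(1)])
    then have "hol_at A (param_deriv U z (\<rho> i (U, z))) x" by (rule hol_at_param_deriv[OF c(1) c'(2)])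
    then show ?thesis
      unfolding b_def[abs_def] using x a spin_formD(1,2)[OF i(1) c'(1) c(1) c'(2)]
      by (intro hol_at_diff hol_at_mult hol_at_divide hol_e hol_at_const) auto
  qed
  have "has_symbol Y D U z x (a x) (b x)" if x: "x \<in> M" for x
    unfolding has_symbol_def
  proof (intro allI impI, elim conjE)
    fix V s j
    assume V: "open V" "V \<subseteq> Y" "x \<in> V" and s: "s \<in> sections A L V" and j: "j \<in> idx L" "x \<in> triv L j"
    have xi: "x \<in> triv L i" "x \<in> U" using x M by auto
    let ?V = "V \<inter> M"
    have V': "open ?V" "?V \<subseteq> V" "?V \<subseteq> M" "?V \<subseteq> Y" "?V \<subseteq> U" "?V \<subseteq> triv L i" "x \<in> ?V"
      using V M x by auto
    let ?s = "srestr ?V s" and ?e' = "srestr ?V ?e"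
    have s': "?s \<in> sections A L ?V" by (rule srestr_section[OF riemann s V'(2)])
    have e': "?e' \<in> sections A L ?V" by (rule srestr_section[OF riemann e V'(3)])
    have "?e' = frame i ?V" by (auto simp: srestr_def restr_def frame_def fun_eq_iff)
    then have s_eq: "?s = fscale (?s i) ?e'"
      using section_eq_frame[OF s' i(1) V'(6)] by simp
    have hs: "hol_at A (?s i) y" if "y \<in> ?V" for y
      using section_hol[OF s' V'(1) i(1)] that V'(6) by blast
    have "fscale z ?e' = srestr ?V (fscale z ?e)"
      by (simp add: fscale_def srestr_def restr_def fun_eq_iff)
    then have De: "D ?V ?e' i x = D M ?e i x" "D ?V (fscale z ?e') i x = D M (fscale z ?e) i x"
      using d(5)[OF M(1,4) e V'(1,3)] d(5)[OF M(1,4) ze V'(1,3)] V'(7) by (simp_all add: srestr_def restr_def)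
    have "D V s i x = D ?V ?s i x"
      using d(5)[OF V(1,2) s V'(1,2)] V'(7) by (simp add: srestr_def restr_def)
    also have "D ?V ?s i x = D ?V (fscale (?s i) ?e') i x"
      using s_eq by simp
    also have "\<dots> = ?s i x * D M ?e i x + param_deriv U z (?s i) x * a x"
      using diffop_fscale[OF D V'(1,4,5) c(1) e' hs V'(7), of i] by (simp add: De a_def)
    also have "\<dots> = s i x * D M ?e i x + param_deriv U z (s i) x * a x"
    proof -
      have ev: "\<forall>\<^sub>F y in nhds x. ?s i y = s i y"
        using eventually_nhds_in_open[OF V'(1,7)] by eventually_elim (simp add: srestr_def restr_def)
      show ?thesis
        using param_deriv_cong[OF c(1) xi(2) ev] eventually_nhds_x_imp_x[OF ev] by simp
    qed
    also have "\<dots> = op_value U z (a x) (b x) s i x"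
      by (simp add: twisted_derivative_def b_def)
    finally have Di: "D V s i x = op_value U z (a x) (b x) s i x" .
    have "D V s j x = tf L j i x * D V s i x"
      using section_tf[OF d(2)[OF V(1,2) s] j(1) i(1) V(3) j(2) xi(1)] .
    also have "\<dots> = op_value U z (a x) (b x) s j x"
      using op_value_index[OF j i(1) xi(1) c(1) xi(2) s V(1,3)] Di by simp
    finally show "D V s j x = op_value U z (a x) (b x) s j x" .
  qed
  then show ?thesis using M a b by (intro that[of M a b]) auto
qed

definition represents :: "'a set \<Rightarrow> ('a, 'i) operator \<Rightarrow> ('a \<times> 'a \<Rightarrow> complex) \<Rightarrow> 'a \<Rightarrow> bool" where
  "represents Y D F x \<longleftrightarrow> (\<forall>U z a b. (U, z) \<in> A \<and> x \<in> U \<and> polar_jet z F x a b \<longrightarrow> has_symbol Y D U z x a b)"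

text \<open>The germs at a diagonal point whose operators agree with \<open>D\<close> at all nearby points.  Defining the
  class by this property makes gluing automatic.\<close>

definition inverse_section ::
  "('a \<times> 'a) set \<Rightarrow> ('a, 'i) operator \<Rightarrow> 'a \<times> 'a \<Rightarrow> ('a \<times> 'a) local_function set" where
  "inverse_section W D p = (if p \<notin> W then {} else {(N, F). open N \<and> p \<in> N \<and> F \<in> O_plus_Delta A N \<and>
     (\<forall>x. p = (x, x) \<longrightarrow> (\<exists>M. open M \<and> x \<in> M \<and> (\<forall>y\<in>M. represents (diag_vimage W) D F y)))})"

lemma inverse_section_off_diagonal:
  assumes "x \<noteq> y" "(x, y) \<in> W" "open N" "(x, y) \<in> N" "F \<in> O_plus_Delta A N"
  shows "inverse_section W D (x, y) = stalk (x, y) `` {(N, F)}"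
proof (rule set_eqI)
  fix q :: "('a \<times> 'a) local_function"
  obtain K G where q: "q = (K, G)" by (cases q)
  have "q \<in> inverse_section W D (x, y) \<longleftrightarrow> open K \<and> (x, y) \<in> K \<and> G \<in> O_plus_Delta A K"
    using assms(1,2) by (simp add: inverse_section_def q)
  also have "\<dots> \<longleftrightarrow> ((N, F), (K, G)) \<in> stalk (x, y)"
    using stalk_off_diagonal[OF assms(1,3-5)] unfolding stalk_rel_def by blast
  finally show "q \<in> inverse_section W D (x, y) \<longleftrightarrow> q \<in> stalk (x, y) `` {(N, F)}"
    by (simp add: q)
qed

text \<open>Near a diagonal point the class is that of \<open>a(z\<^sub>1)(z\<^sub>2 - z\<^sub>1)\<^sup>-\<^sup>1 + b(z\<^sub>1)\<close>, where \<open>(a, b)\<close> is the local symbol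
  of \<open>D\<close>: a germ represents \<open>D\<close> exactly if it has the same jets, which are determined by \<open>D\<close>.\<close>

lemma inverse_section_section:
  assumes W: "open W" and D: "D \<in> diffops1 A L (diag_vimage W)"
  shows "inverse_section W D \<in> sec (polar_quotient A) W"
  unfolding polar_quotient_sec
proof (intro conjI allI impI ballI)
  fix p assume "p \<notin> W"
  then show "inverse_section W D p = {}" by (simp add: inverse_section_def)
next
  fix p assume pW: "p \<in> W"
  let ?Y = "diag_vimage W"
  have Y: "open ?Y" by (rule open_diag_vimage[OF W])
  show "\<exists>N F. open N \<and> p \<in> N \<and> N \<subseteq> W \<and> F \<in> O_plus_Delta A N \<and>
      (\<forall>q\<in>N. inverse_section W D q = stalk q `` {(N, F)})"
  proof (cases "p \<in> Id")
    case False
    have N: "open (W - Id)" by (rule open_Diff_Id[OF W])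
    have "inverse_section W D q = stalk q `` {(W - Id, \<lambda>_. 0)}" if q: "q \<in> W - Id" for q
    proof -
      obtain x y where xy: "q = (x, y)" by (cases q)
      show ?thesis unfolding xy
        using q xy by (intro inverse_section_off_diagonal[OF _ _ N _ O_plus_Delta_zero[OF N]]) auto
    qed
    then show ?thesis using N pW False O_plus_Delta_zero[OF N] by blast
  next
    case True
    then obtain x0 where p: "p = (x0, x0)" by (cases p) auto
    then have x0: "x0 \<in> ?Y" using pW by (simp add: diag_vimage_def)
    obtain U z where c: "(U, z) \<in> A" "x0 \<in> U" by (rule chart_around)
    obtain M1 a b where M1: "open M1" "x0 \<in> M1" "M1 \<subseteq> U" "M1 \<subseteq> ?Y" "\<forall>x\<in>M1. hol_at A a x" "\<forall>x\<in>M1. hol_at A b x"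
      "\<forall>x\<in>M1. has_symbol ?Y D U z x (a x) (b x)"
      by (rule diffop_local_symbol[OF D Y x0 c])
    obtain R1 R2 where R: "open R1" "open R2" "x0 \<in> R1" "x0 \<in> R2" "R1 \<times> R2 \<subseteq> W"
      using open_prod_elim[OF W pW] p by (metis mem_Sigma_iff)
    define M where "M = M1 \<inter> R1 \<inter> R2"
    have M: "open M" "x0 \<in> M" "M \<subseteq> U" "M \<times> M \<subseteq> W" "\<And>x. x \<in> M \<Longrightarrow> hol_at A a x" "\<And>x. x \<in> M \<Longrightarrow> hol_at A b x"
      "\<And>x. x \<in> M \<Longrightarrow> has_symbol ?Y D U z x (a x) (b x)" "M \<subseteq> ?Y"
      using M1 R by (auto simp: M_def)
    let ?F = "restr (M \<times> M - Id) (\<lambda>(p, q). a p / (z q - z p) + b p)"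
    have F: "?F \<in> O_plus_Delta A (M \<times> M)" by (rule O_plus_Delta_polar_part[OF c(1) M(1,3,5,6)])
    have MM: "open (M \<times> M)" using M(1) by (intro open_Times)
    have jet: "polar_jet z ?F y (a y) (b y)" if "y \<in> M" for y
      by (rule polar_part_jet[OF c(1) M(1) that])
    have rep: "represents ?Y D ?F y" if y: "y \<in> M" for y
      unfolding represents_def
    proof (intro allI impI, elim conjE)
      fix V w a' b' assume V: "(V, w) \<in> A" "y \<in> V" and j: "polar_jet w ?F y a' b'"
      have "y \<in> U" using y M(3) by blast
      from has_symbol_change[OF M(7)[OF y] c(1) this V jet[OF y] j]
      show "has_symbol ?Y D V w y a' b'" .
    qed
    have "inverse_section W D q = stalk q `` {(M \<times> M, ?F)}" if q: "q \<in> M \<times> M" for q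
    proof -
      obtain x y where xy: "q = (x, y)" by (cases q)
      show ?thesis
      proof (cases "x = y")
        case False
        then show ?thesis
          unfolding xy using q M(4) xy by (intro inverse_section_off_diagonal[OF _ _ MM _ F]) auto
      next
        case True
        then have qx: "q = (x, x)" "x \<in> M" using q xy by auto
        have qW: "q \<in> W" using q M(4) by blast
        have xU: "x \<in> U" using qx M(3) by blast
        have qMM: "(x, x) \<in> M \<times> M" using qx by simp
        show ?thesis
        proof (rule set_eqI)
          fix r :: "('a \<times> 'a) local_function"
          obtain K G where r: "r = (K, G)" by (cases r)
          have mem: "r \<in> inverse_section W D q \<longleftrightarrow> open K \<and> (x, x) \<in> K \<and> G \<in> O_plus_Delta A K \<and>
              (\<exists>M'. open M' \<and> x \<in> M' \<and> (\<forall>y\<in>M'. represents ?Y D G y))"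
            using qW by (simp add: inverse_section_def r qx)
          have "r \<in> inverse_section W D q \<longleftrightarrow> ((M \<times> M, ?F), (K, G)) \<in> stalk (x, x)"
          proof
            assume "r \<in> inverse_section W D q"
            then obtain M' where G: "open K" "(x, x) \<in> K" "G \<in> O_plus_Delta A K"
              and M': "open M'" "x \<in> M'" "\<forall>y\<in>M'. represents ?Y D G y"
              unfolding mem by blast
            have M'': "open (M \<inter> M')" "x \<in> M \<inter> M'" using M(1) M' qx by auto
            show "((M \<times> M, ?F), (K, G)) \<in> stalk (x, x)"
            proof (rule stalk_of_polar_jet[OF MM qMM F G c(1) xU M''])
              fix y a1 b1 a2 b2
              assume y: "y \<in> M \<inter> M'" "y \<in> U" and j: "polar_jet z ?F y a1 b1" "polar_jet z G y a2 b2"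
              have "has_symbol ?Y D U z y a1 b1" "has_symbol ?Y D U z y a2 b2"
                using rep[of y] M'(3) y j c(1) unfolding represents_def by blast+
              then show "a1 = a2 \<and> b1 = b2"
                using y M(8) by (intro has_symbol_unique[OF _ _ c(1) y(2) Y]) auto
            qed
          next
            assume s: "((M \<times> M, ?F), (K, G)) \<in> stalk (x, x)"
            then have K: "open K" "(x, x) \<in> K" "G \<in> O_plus_Delta A K"
              unfolding stalk_rel_def by blast+
            from s show "r \<in> inverse_section W D q"
            proof (rule stalk_polar_jet)
              fix M' assume M': "open M'" "x \<in> M'"
                and jets: "\<And>y z a b. y \<in> M' \<Longrightarrow> polar_jet z ?F y a b \<longleftrightarrow> polar_jet z G y a b"
              have "represents ?Y D G y" if "y \<in> M \<inter> M'" for y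
                using rep[of y] jets[of y] that unfolding represents_def by blast
              then show "r \<in> inverse_section W D q"
                unfolding mem using K M' M(1) qx by (intro conjI exI[of _ "M \<inter> M'"]) auto
            qed
          qed
          then show "r \<in> inverse_section W D q \<longleftrightarrow> r \<in> stalk q `` {(M \<times> M, ?F)}"
            by (simp add: r qx)
        qed
      qed
    qed
    then show ?thesis
      using MM F M(2,4) p by (intro exI[of _ "M \<times> M"] exI[of _ ?F]) auto
  qed
qed

lemma polar_op_inverse_section:
  assumes W: "open W" and D: "D \<in> diffops1 A L (diag_vimage W)"
  shows "polar_op W (inverse_section W D) = D"
proof (intro ext)
  fix V s i x
  note d = diffopsD[OF D]
  let ?\<sigma> = "inverse_section W D"
  have \<sigma>: "?\<sigma> \<in> sec (polar_quotient A) W" by (rule inverse_section_section[OF W D])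
  show "polar_op W ?\<sigma> V s i x = D V s i x"
  proof (cases "open V \<and> V \<subseteq> diag_vimage W \<and> s \<in> sections A L V")
    case False
    have "polar_op W ?\<sigma> V s i x = 0" by (rule polar_op_zero) (use False in blast)
    then show ?thesis using d(1)[OF False] by simp
  next
    case True
    then have V: "open V" "V \<subseteq> diag_vimage W" and s: "s \<in> sections A L V" by auto
    show ?thesis
    proof (cases rule: polar_op_cases[OF \<sigma> V, of i x, case_names inside outside])
      case (inside U z a b)
      have xW: "(x, x) \<in> W" using inside V by (auto simp: diag_vimage_def)
      obtain N F where NF: "(N, F) \<in> ?\<sigma> (x, x)"
        using inside(6) unfolding represented_jet_def by (metis equals0I surj_pair)
      then have "represents (diag_vimage W) D F x"
        using xW unfolding inverse_section_def by auto
      then have "has_symbol (diag_vimage W) D U z x a b"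
        using represented_jet_element[OF inside(6) NF] inside(4,5) unfolding represents_def by blast
      then have "D V s i x = op_value U z a b s i x"
        using V s inside unfolding has_symbol_def by blast
      then show ?thesis using polar_op_eq[OF V s inside] by simp
    next
      case outside
      then show ?thesis using section_zero[OF d(2)[OF V s], of i x] by (auto simp: polar_op_zero)
    qed
  qed
qed

lemma polar_op_iso: "sheaf_iso (O_XX A) (polar_quotient A) (D1_sheaf A L) polar_op"
  unfolding sheaf_iso_def
proof (intro allI impI conjI ballI, goal_cases)
  case (1 W)
  then show ?case
  proof (intro bij_betw_imageI inj_onI)
    show "\<sigma> = \<tau>" if "\<sigma> \<in> sec (polar_quotient A) W" "\<tau> \<in> sec (polar_quotient A) W" "polar_op W \<sigma> = polar_op W \<tau>" for \<sigma> \<tau>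
      by (rule polar_op_inj[OF 1 that])
    have sec_D: "sec (D1_sheaf A L) W = diffops1 A L (diag_vimage W)" by (simp add: D1_sheaf_def)
    show "polar_op W ` sec (polar_quotient A) W = sec (D1_sheaf A L) W"
      unfolding sec_D
    proof
      show "polar_op W ` sec (polar_quotient A) W \<subseteq> diffops1 A L (diag_vimage W)"
        using polar_op_diffop by blast
      show "diffops1 A L (diag_vimage W) \<subseteq> polar_op W ` sec (polar_quotient A) W"
      proof
        fix D assume D: "D \<in> diffops1 A L (diag_vimage W)"
        from polar_op_inverse_section[OF 1 D] inverse_section_section[OF 1 D]
        show "D \<in> polar_op W ` sec (polar_quotient A) W" by (metis imageI)
      qed
    qed
  qed
next
  case (2 W \<sigma> \<tau>)
  then show ?case by (intro polar_op_add)
next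
  case (3 W h \<sigma>)
  then show ?case by (intro polar_op_scale)
next
  case (4 W V \<sigma>)
  then show ?case by (intro polar_op_res) blast
qed

section \<open>The explicit form\<close>

text \<open>A local parameter may be added to the atlas; everything known about charts then applies to it.\<close>

lemma local_parameter_atlas:
  assumes "local_parameter A U z"
  shows "holomorphic_atlas (insert (U, z) A)"
proof
  have c: "is_chart (U, z)"
    and tr: "\<And>d. d \<in> A \<Longrightarrow> transition_holomorphic (U, z) d" "\<And>d. d \<in> A \<Longrightarrow> transition_holomorphic d (U, z)"
    using assms unfolding local_parameter_def by blast+
  have "(z \<circ> inv_into U z) holomorphic_on z ` U"
    by (rule holomorphic_transform[OF holomorphic_on_ident]) (auto simp: f_inv_into_f)
  then have self: "transition_holomorphic (U, z) (U, z)"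
    by (simp add: transition_holomorphic_def)
  have A: "\<forall>c\<in>A. is_chart c" "\<forall>c\<in>A. \<forall>c'\<in>A. transition_holomorphic c c'" "\<Union> (fst ` A) = UNIV" "connected (UNIV :: 'a set)"
    using riemann unfolding riemann_surface_def by blast+
  show "riemann_surface (insert (U, z) A)"
    unfolding riemann_surface_def using A c tr self by auto
qed

text \<open>This is the change from the frame of the bundle to \<open>e\<close> and from a chart of the atlas to \<open>z\<close>.  As
  \<open>e \<otimes> e\<close> corresponds to \<open>dz\<close>, the factor \<open>c\<close> of the new frame is constant and the twisted derivative
  becomes \<open>a f' + b f\<close>.\<close>

lemma polar_op_explicit_form:
  assumes "compact (UNIV :: 'a set)" and \<alpha>: "square_root_iso A L \<alpha>"
  shows "has_explicit_form A L \<alpha> polar_op"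
  unfolding has_explicit_form_def
proof (intro allI impI, elim conjE)
  fix W \<sigma> U z e a b V f
  assume W: "open W" and \<sigma>: "\<sigma> \<in> sec (polar_quotient A) W" and UW: "U \<subseteq> diag_vimage W"
    and z: "local_parameter A U z" and e: "e \<in> sections A L U"
    and \<alpha>e: "\<alpha> U (tensor_section e e) = differential A U z"
    and a: "a \<in> O_X A U" and b: "b \<in> O_X A U" and rep: "local_representative A \<sigma> U z a b"
    and V: "open V" "V \<subseteq> U" and f: "f \<in> O_X A V"
  have c: "is_chart (U, z)" using z unfolding local_parameter_def by blast
  note U = is_chartD(1)[OF c]
  interpret ext: holomorphic_atlas "insert (U, z) A" by (rule local_parameter_atlas[OF z])
  have UzI: "(U, z) \<in> insert (U, z) A" by simp
  have ext_hol: "hol_at (insert (U, z) A) g x" if "hol_at A g x" for g x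
    using that unfolding hol_at_def by blast
  have hol_z: "hol_at A z x" if "x \<in> U" for x
  proof -
    obtain V' w where "(V', w) \<in> A" "x \<in> V'" by (rule chart_around)
    then show ?thesis
      using ext.hol_atD[OF ext.hol_at_chart[OF UzI that], of V' w] by (intro hol_atI) auto
  qed
  obtain \<rho>' where \<rho>': "spin_form A L \<rho>'"
    and \<alpha>_\<rho>': "\<And>V e i c x. open V \<Longrightarrow> e \<in> sections A L V \<Longrightarrow> i \<in> idx L \<Longrightarrow> x \<in> V \<Longrightarrow> x \<in> triv L i \<Longrightarrow>
      \<alpha> V (tensor_section e e) c x = e i x * e i x * \<rho>' i c x"
    by (rule square_root_spin_form[OF \<alpha>]) blast
  obtain k where k: "k \<noteq> 0"
    and \<rho>_k: "\<And>i c x. i \<in> idx L \<Longrightarrow> c \<in> A \<Longrightarrow> x \<in> triv L i \<Longrightarrow> x \<in> fst c \<Longrightarrow> \<rho>' i c x = k * \<rho> i c x"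
    by (rule spin_form_unique[OF assms(1) spin \<rho>']) blast
  have VW: "V \<subseteq> diag_vimage W" using V(2) UW by blast
  have hol_f: "\<And>y. y \<in> V \<Longrightarrow> hol_at A f y" and f0: "\<And>y. y \<notin> V \<Longrightarrow> f y = 0"
    using f unfolding O_X_iff[OF V(1)] by blast+
  have "fscale f e = fscale f (srestr V e)"
    by (auto simp: fscale_def srestr_def restr_def f0 fun_eq_iff)
  then have fe: "fscale f e \<in> sections A L V"
    using fscale_section_hol_at[OF V(1) srestr_section[OF riemann e V(2)] hol_f] by simp
  show "polar_op W \<sigma> V (fscale f e) = srestr V (fscale (\<lambda>x. a x * param_deriv U z f x + b x * f x) e)"
  proof (intro ext)
    fix i x
    show "polar_op W \<sigma> V (fscale f e) i x = srestr V (fscale (\<lambda>x. a x * param_deriv U z f x + b x * f x) e) i x"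
    proof (cases rule: polar_op_cases[OF \<sigma> V(1) VW, of i x, case_names inside outside])
      case outside
      then show ?thesis
        using section_zero[OF e, of i x] by (auto simp: polar_op_zero srestr_def restr_def fscale_def)
    next
      case (inside V' w a' b')
      have xU: "x \<in> U" using inside V by blast
      have cI: "(V', w) \<in> insert (U, z) A" using inside by simp
      let ?d = "param_deriv V' w z x" and ?d2 = "param_deriv V' w (param_deriv V' w z) x"
      have d: "?d \<noteq> 0" by (rule ext.param_deriv_transition_nonzero[OF UzI xU cI inside(5)])
      have ev_U: "\<forall>\<^sub>F y in nhds x. y \<in> U" by (rule eventually_nhds_in_open[OF U xU])
      then have ev_z: "\<forall>\<^sub>F y in nhds x. hol_at A z y"
        by eventually_elim (rule hol_z)
      obtain N F R where NF: "(N, F) \<in> \<sigma> (x, x)" and R: "R \<in> O_minus_Delta A N"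
        and F: "\<forall>p q. (p, q) \<in> N \<and> p \<noteq> q \<longrightarrow> F (p, q) = a p / (z q - z p) + b p + R (p, q)"
      proof -
        from rep[unfolded local_representative_def] xU
        have "\<exists>(N, F)\<in>\<sigma> (x, x). N \<subseteq> U \<times> U \<and> (\<exists>R\<in>O_minus_Delta A N. \<forall>p q. (p, q) \<in> N \<and> p \<noteq> q \<longrightarrow>
            F (p, q) = a p / (z q - z p) + b p + R (p, q))" by (rule bspec)
        then show thesis by (elim bexE conjE case_prodE) (rule that, simp_all)
      qed
      note N = polar_quotient_element[OF \<sigma> NF]
      have "polar_jet z F x (a x) (b x)"
        unfolding polar_jet_def
      proof (rule Lim_transform_eventually)
        have "hol2_at A R (x, x)" "R (x, x) = 0"
          using R N(2) unfolding O_minus_Delta_iff[OF N(1)] by blast+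
        then have "((\<lambda>y. R (x, y)) \<longlongrightarrow> 0) (at x)"
          using hol_at_isCont[OF hol_at_slice[of R x x]] by (simp add: isCont_def)
        then show "((\<lambda>y. b x + R (x, y)) \<longlongrightarrow> b x) (at x)"
          using tendsto_add[OF tendsto_const[of "b x"]] by fastforce
        have "open (Pair x -` N)" using N(1) by (intro open_vimage continuous_intros)
        from eventually_nhds_in_open[OF this, of x] have "\<forall>\<^sub>F y in nhds x. (x, y) \<in> N"
          using N(2) by simp
        then show "\<forall>\<^sub>F y in at x. b x + R (x, y) = F (x, y) - a x / (z y - z x)"
          unfolding eventually_at_filter by eventually_elim (use F in simp)
      qed
      moreover have "polar_jet z F x (a' * ?d) (b' + a' * ?d2 / (2 * ?d))"
        by (rule polar_jet_change[OF represented_jet_element[OF inside(6) NF] inside(4,5) ev_z d])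
      ultimately have ab: "a x = a' * ?d" "b x = b' + a' * ?d2 / (2 * ?d)"
        using polar_jet_unique[OF c xU] by blast+
      have hol_e: "hol_at A (e i) x" by (rule section_hol[OF e U inside(1) xU inside(3)])
      have ee: "e i y * e i y * \<rho>' i (V', w) y = param_deriv V' w z y"
        if "y \<in> U" "y \<in> V'" "y \<in> triv L i" for y
        using \<alpha>_\<rho>'[OF U e inside(1) that(1,3), of "(V', w)"] \<alpha>e that inside(4)
        by (simp add: differential_def param_deriv_def)
      \<comment> \<open>The constant \<open>1 / k\<close> compares the spin form of \<open>\<alpha>\<close> with \<open>\<rho>\<close>.\<close>
      have ev: "\<forall>\<^sub>F y in nhds x. e i y * e i y * \<rho> i (V', w) y = 1 / k * param_deriv V' w z y"
        using ev_U eventually_domain[OF inside(1,3-5)]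
      proof eventually_elim
        case (elim y)
        then have "e i y * e i y * (k * \<rho> i (V', w) y) = param_deriv V' w z y"
          using ee[of y] \<rho>_k[OF inside(1,4), of y] by simp
        then show ?case using k by (simp add: field_simps)
      qed
      have ei: "e i x \<noteq> 0" using ee[OF xU inside(5,3)] d by auto
      have fe_i: "\<forall>\<^sub>F y in nhds x. fscale f e i y = e i y * f y"
        by (simp add: fscale_def)
      have chain: "param_deriv V' w f x = param_deriv U z f x * ?d"
        by (rule ext.param_deriv_chain[OF ext_hol[OF hol_f[OF inside(2)]] UzI xU cI inside(5)])
      have "polar_op W \<sigma> V (fscale f e) i x = op_value V' w a' b' (fscale f e) i x"
        by (rule polar_op_eq[OF V(1) VW fe inside])
      also have "\<dots> = e i x * (a' * param_deriv V' w f x + b x * f x)"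
        using twisted_derivative_change[OF inside(4,5) ev_z d hol_e hol_f[OF inside(2)]
            spin_formD(1)[OF inside(1,3-5)] hol_at_const fe_i ev ei spin_formD(2)[OF inside(1,3-5)], of a' b']
        by (simp add: param_deriv_const ab(2))
      also have "\<dots> = e i x * (a x * param_deriv U z f x + b x * f x)"
        by (simp add: chain ab(1) mult_ac)
      finally show ?thesis
        using inside(2) by (simp add: srestr_def restr_def fscale_def mult.commute)
    qed
  qed
qed

end

theorem propositionA1:
  fixes A :: "'a::t2_space chart set"
    and L :: "('a, 'i) line_bundle"
  assumes "compact_riemann_surface A"
    and "is_line_bundle A L"
    and "\<exists>\<alpha>. square_root_iso A L \<alpha>"
  shows "\<exists>\<Phi>. sheaf_iso (O_XX A) (polar_quotient A) (D1_sheaf A L) \<Phi> \<and>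
           (\<forall>\<alpha>. square_root_iso A L \<alpha> \<longrightarrow> has_explicit_form A L \<alpha> \<Phi>)"
proof -
  have A: "riemann_surface A" "compact (UNIV :: 'a set)"
    using assms(1) by (auto simp: compact_riemann_surface_def)
  interpret bundle_on_surface A L
    using A(1) assms(2) by unfold_locales
  obtain \<alpha> where \<alpha>: "square_root_iso A L \<alpha>" using assms(3) by blast
  obtain \<rho> where "spin_form A L \<rho>"
    by (rule square_root_spin_form[OF \<alpha>]) blast
  then interpret spin_surface A L \<rho>
    by unfold_locales
  show ?thesis
    using polar_op_iso polar_op_explicit_form[OF A(2)] by blast
qed

end
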